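(* (Cooperative blocking strategy.) Consider the attack-stage BVR differential game described in the context. Assume that $\mathbf{x}\in\mathcal{R}_R$ and that simultaneous blocking of $B_L$ by $R_1$ and $R_2$ (both reaching distance $\rho$ from $B_L$ at the same instant) is the optimal play. Then the optimal headings of $B_L$, $R_1$ and $R_2$ in the relative coordinate frame are given by $$\cos\theta_B^*=\frac{x^*}{\sqrt{x^{*2}+y^{*2}}},\qquad \sin\theta_B^*=\frac{y^*}{\sqrt{x^{*2}+y^{*2}}},$$ $$\cos\theta_1^*=\frac{x^*-x_1'}{\sqrt{(x^*-x_1')^2+y^{*2}}},\qquad \sin\theta_1^*=\frac{y^*}{\sqrt{(x^*-x_1')^2+y^{*2}}},$$ $$\cos\theta_2^*=\frac{x^*-x_2'}{\sqrt{(x^*-x_2')^2+(y^*-y_2')^2}},\qquad \sin\theta_2^*=\frac{y^*-y_2'}{\sqrt{(x^*-x_2')^2+(y^*-y_2')^2}},$$ where $y^*=mx^*+n$ and $$x^*=\arg\min\{J(x_{in_1}),J(x_{in_2})\},$$ where $x_{in_1}$ and $x_{in_2}$ are the solutions of the quartic equation $$b^2(1+m^2)^2x^4+4k_{3_c}x^3+4k_{2_c}x^2+4k_{1_c}x+k_{0_c}=0$$ which satisfy $O(x_{in_i})=0$ for $i=1,2$. The coefficients are $$k_{3_c}=b(1+m^2)(bmn-x_1'),$$ $$k_{2_c}=\tfrac{b^2n^2(3m^2+1)}{2}-b\Big(2mnx_1'+\tfrac{\eta(1+m^2)}{2}\Big)+x_1'^2-\beta^2\rho^2(1+m^2),$$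 $$k_{1_c}=b^2mn^3-bn(nx_1'+m\eta)+x_1'\eta-2\beta^2\rho^2mn,$$ $$k_{0_c}=(bn^2-\eta)^2-(2\beta\rho n)^2,$$ with $b=1-\beta^2$ and $\eta=\rho^2-x_1'^2$.
   Context: Attack-stage BVR (Beyond Visual Range) differential game. Players move in the plane: the blue leader $B_L$ at $(x_B,y_B)$ and two red interceptors $R_1$ at $(x_1,y_1)$, $R_2$ at $(x_2,y_2)$; there is a static red asset $R_s=(x_s,y_s)$. Constants: $\rho_s>0$, $\rho>0$ (engagement ranges). Speeds are constant and normalized: $B_L$ has speed $1$ and $R_1,R_2$ have speed $\beta>1$. The state is $\mathbf{x}=(x_B,y_B,x_1,y_1,x_2,y_2)\in\mathbb{R}^6$, with dynamics $$\dot x_B=\cos\theta_B,\ \dot y_B=\sin\theta_B,\quad \dot x_i=\beta\cos\theta_i,\ \dot y_i=\beta\sin\theta_i\quad (i=1,2),$$ where the controls are the instantaneous headings $\theta_B,\theta_1,\theta_2\in[-\pi,\pi)$; $\theta_B$ is chosen by $B_L$ and $\theta_1,\theta_2$ by the red team. The termination set is $\mathcal{T}=\mathcal{T}_\Gamma\cup\mathcal{T}_R$, where $\mathcal{T}_\Gamma=\{\mathbf{x}:\sqrt{(x_B-x_s)^2+(y_B-y_s)^2}=\rho_s\}$ ($B_L$ reaches the engagement zone of $R_s$, the closed disk $\Gamma$ of radius $\rho_s$ centered at $R_s$, before being blocked) and $\mathcal{T}_R=\{\mathbf{x}:\sqrt{(x_B-x_1)^2+(y_B-y_1)^2}=\rho\}\cup\{\mathbf{x}:\sqrt{(x_B-x_2)^2+(y_B-y_2)^2}=\rho\}$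 (at least one interceptor blocks $B_L$). $\mathcal{R}_R\subset\mathbb{R}^6$ denotes the red team's winning subspace: the states from which, under optimal play, the game terminates in $\mathcal{T}_R$. On $\mathcal{R}_R$ the game terminates at the time $t_f$ when the state satisfies the condition defining $\mathcal{T}_R$, with terminal payoff $\sqrt{(x_B(t_f)-x_s)^2+(y_B(t_f)-y_s)^2}$, minimized by $B_L$ and maximized by the red team over state-feedback strategies. "Optimal" means saddle-point strategies of this zero-sum game. Relative coordinate frame: the translated and rotated frame in which $B_L=(0,0)$, $R_1=(x_1',0)$ with $x_1'=\sqrt{(x_1-x_B)^2+(y_1-y_B)^2}>0$, $R_2=(x_2',y_2')$ and $R_s=(x_s',y_s')$. Explicitly, with $\lambda_1,\lambda_2,\lambda_s$ the polar angles of the vectors from $B_L$ to $R_1$, $R_2$, $R_s$ (i.e. $\lambda_i=\arctan\frac{y_i-y_B}{x_i-x_B}$ taken in the correct quadrant) and $d_2,d_s$ the distances from $B_L$ to $R_2$, $R_s$: $x_2'=d_2\cos(\lambda_2-\lambda_1)$, $y_2'=d_2\sin(\lambda_2-\lambda_1)$, $x_s'=d_s\cos(\lambda_s-\lambda_1)$, $y_s'=d_s\sin(\lambda_s-\lambda_1)$. The orthogonal bisector of the segment $\overline{R_1R_2}$ is $y=mx+n$ with $$m=\frac{x_1'-x_2'}{y_2'},\qquad n=-\frac12\,\frac{x_1'^2-y_2'^2-x_2'^2}{y_2'}.$$ Define $$O(x)=\sqrt{(x-x_1')^2+(mx+n)^2}-\beta\sqrt{x^2+(mx+n)^2}-\rho,$$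 $$J(x)=\sqrt{(x_s'-x)^2+(y_s'-mx-n)^2}.$$ The Cartesian Ovals of $B_L$ with respect to $R_1$ and $R_2$ are, respectively, $\sqrt{(x-x_1')^2+y^2}=\rho+\beta\sqrt{x^2+y^2}$ and $\sqrt{(x-x_2')^2+(y-y_2')^2}=\rho+\beta\sqrt{x^2+y^2}$. Under simultaneous blocking, the line $y=mx+n$ passes through the intersection of these two ovals. *)

theory Defs
  imports "HOL-Analysis.Analysis"
begin

section \<open>The game\<close>

text \<open>The plane is identified with the complex numbers, so that a unit-speed motion with heading
  \<open>\<theta>\<close> has velocity \<open>cis \<theta>\<close>. A state lists the positions of \<open>B\<^sub>L\<close>, \<open>R\<^sub>1\<close> and \<open>R\<^sub>2\<close>, in this order.\<close>

type_synonym state = "complex \<times> complex \<times> complex"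

abbreviation blue :: "state \<Rightarrow> complex" where "blue x \<equiv> fst x"
abbreviation red1 :: "state \<Rightarrow> complex" where "red1 x \<equiv> fst (snd x)"
abbreviation red2 :: "state \<Rightarrow> complex" where "red2 x \<equiv> snd (snd x)"

record bvr_game =
  beta :: real
  rho :: real
  rho_s :: real
  asset :: complex

definition asset_reached :: "bvr_game \<Rightarrow> state set" where
  "asset_reached G = {x. dist (blue x) (asset G) = rho_s G}"

definition blocked :: "bvr_game \<Rightarrow> state set" where
  "blocked G = {x. dist (blue x) (red1 x) = rho G} \<union> {x. dist (blue x) (red2 x) = rho G}"

definition terminal :: "bvr_game \<Rightarrow> state set" where
  "terminal G = asset_reached G \<union> blocked G"

text \<open>The states in which the game is still being played: \<open>B\<^sub>L\<close> is outside all engagement zones.\<close>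

definition playing_states :: "bvr_game \<Rightarrow> state set" where
  "playing_states G = {x. rho_s G < dist (blue x) (asset G) \<and>
     rho G < dist (blue x) (red1 x) \<and> rho G < dist (blue x) (red2 x)}"

definition dynamics :: "bvr_game \<Rightarrow> real \<Rightarrow> real \<times> real \<Rightarrow> state" where
  "dynamics G \<theta>\<^sub>B \<theta>\<^sub>R =
     (cis \<theta>\<^sub>B, of_real (beta G) * cis (fst \<theta>\<^sub>R), of_real (beta G) * cis (snd \<theta>\<^sub>R))"


section \<open>Strategies, plays and saddle points\<close>

text \<open>State-feedback (closed-loop) laws assign headings \<open>\<gamma> t x\<close> to the current time and state;
  laws that ignore the time are included.\<close>

type_synonym blue_law = "real \<Rightarrow> state \<Rightarrow> real"
type_synonym red_law = "real \<Rightarrow> state \<Rightarrow> real \<times> real"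

definition headings :: "real set" where
  "headings = {-pi..<pi}"

text \<open>\<open>trajectory G \<gamma>\<^sub>B \<gamma>\<^sub>R t0 x T X\<close>: the closed-loop motion \<open>X\<close> starts in \<open>x\<close> at time \<open>t0\<close> and does
  not meet the termination set before time \<open>T\<close>, which may be infinite. Feedback laws may be
  discontinuous and headings may jump, hence the equations of motion are imposed on the forward
  derivative; they hold at every instant, so that the heading used at each instant (in particular
  at \<open>t0\<close>) is the one prescribed by the law.\<close>

definition trajectory ::
  "bvr_game \<Rightarrow> blue_law \<Rightarrow> red_law \<Rightarrow> real \<Rightarrow> state \<Rightarrow> ereal \<Rightarrow> (real \<Rightarrow> state) \<Rightarrow> bool" where
  "trajectory G \<gamma>\<^sub>B \<gamma>\<^sub>R t0 x T X \<longleftrightarrow>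
     ereal t0 \<le> T \<and> X t0 = x \<and> continuous_on {t. t0 \<le> t \<and> ereal t \<le> T} X \<and>
     (\<forall>t. t0 \<le> t \<and> ereal t < T \<longrightarrow>
        X t \<notin> terminal G \<and>
        (X has_vector_derivative dynamics G (\<gamma>\<^sub>B t (X t)) (\<gamma>\<^sub>R t (X t))) (at_right t))"

text \<open>A law is admissible if it can be executed: from every time and every playing state, and
  against every frozen pair of opponent headings (heading, for red laws), the equations of motion
  can be solved on some time interval of positive length. Laws whose velocities depend
  continuously on time and state are admissible by Peano's theorem.\<close>

definition blue_strategies :: "bvr_game \<Rightarrow> blue_law set" where
  "blue_strategies G = {\<gamma>. (\<forall>t x. \<gamma> t x \<in> headings) \<and>
     (\<forall>t0\<ge>0. \<forall>x\<in>playing_states G. \<forall>\<theta>\<in>headings \<times> headings.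
        \<exists>T>t0. \<exists>X. trajectory G \<gamma> (\<lambda>_ _. \<theta>) t0 x (ereal T) X)}"

definition red_strategies :: "bvr_game \<Rightarrow> red_law set" where
  "red_strategies G = {\<gamma>. (\<forall>t x. \<gamma> t x \<in> headings \<times> headings) \<and>
     (\<forall>t0\<ge>0. \<forall>x\<in>playing_states G. \<forall>\<theta>\<in>headings.
        \<exists>T>t0. \<exists>X. trajectory G (\<lambda>_ _. \<theta>) \<gamma> t0 x (ereal T) X)}"

text \<open>A play runs until the first time \<open>T\<close> at which the termination set is met, or forever.\<close>

definition play :: "bvr_game \<Rightarrow> blue_law \<Rightarrow> red_law \<Rightarrow> state \<Rightarrow> ereal \<Rightarrow> (real \<Rightarrow> state) \<Rightarrow> bool" where
  "play G \<gamma>\<^sub>B \<gamma>\<^sub>R x T X \<longleftrightarrow>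
     trajectory G \<gamma>\<^sub>B \<gamma>\<^sub>R 0 x T X \<and> (T \<noteq> \<infinity> \<longrightarrow> X (real_of_ereal T) \<in> terminal G)"

text \<open>\<open>B\<^sub>L\<close> minimizes the terminal distance to the asset; never terminating is worst for \<open>B\<^sub>L\<close>.\<close>

definition payoff :: "bvr_game \<Rightarrow> ereal \<Rightarrow> (real \<Rightarrow> state) \<Rightarrow> ereal" where
  "payoff G T X =
     (if T = \<infinity> then \<infinity> else ereal (dist (blue (X (real_of_ereal T))) (asset G)))"

text \<open>Closed-loop motions need not be unique, so the saddle-point inequalities are required for all
  plays that the respective pairs of strategies can generate.\<close>

definition saddle_point :: "bvr_game \<Rightarrow> state \<Rightarrow> blue_law \<Rightarrow> red_law \<Rightarrow> bool" where
  "saddle_point G x \<gamma>\<^sub>B \<gamma>\<^sub>R \<longleftrightarrow>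
     \<gamma>\<^sub>B \<in> blue_strategies G \<and> \<gamma>\<^sub>R \<in> red_strategies G \<and>
     (\<exists>T X. play G \<gamma>\<^sub>B \<gamma>\<^sub>R x T X) \<and>
     (\<forall>T X. play G \<gamma>\<^sub>B \<gamma>\<^sub>R x T X \<longrightarrow>
        (\<forall>\<gamma>\<^sub>R' \<in> red_strategies G. \<forall>T' X'. play G \<gamma>\<^sub>B \<gamma>\<^sub>R' x T' X' \<longrightarrow> payoff G T' X' \<le> payoff G T X) \<and>
        (\<forall>\<gamma>\<^sub>B' \<in> blue_strategies G. \<forall>T' X'. play G \<gamma>\<^sub>B' \<gamma>\<^sub>R x T' X' \<longrightarrow> payoff G T X \<le> payoff G T' X'))"

text \<open>The red team wins if \<open>B\<^sub>L\<close> is blocked before it has reached the engagement zone of the asset.\<close>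

definition red_winning :: "bvr_game \<Rightarrow> state set" where
  "red_winning G = {x \<in> playing_states G. \<exists>\<gamma>\<^sub>B \<gamma>\<^sub>R. saddle_point G x \<gamma>\<^sub>B \<gamma>\<^sub>R \<and>
     (\<forall>T X. play G \<gamma>\<^sub>B \<gamma>\<^sub>R x T X \<longrightarrow>
        T \<noteq> \<infinity> \<and> X (real_of_ereal T) \<in> blocked G - asset_reached G)}"


section \<open>Relative frame, bisector, oval and quartic\<close>

definition polar_angle :: "state \<Rightarrow> complex \<Rightarrow> real" where
  "polar_angle x p = Arg (p - blue x)"

definition rel_x :: "state \<Rightarrow> complex \<Rightarrow> real" where
  "rel_x x p = dist (blue x) p * cos (polar_angle x p - polar_angle x (red1 x))"

definition rel_y :: "state \<Rightarrow> complex \<Rightarrow> real" where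
  "rel_y x p = dist (blue x) p * sin (polar_angle x p - polar_angle x (red1 x))"

definition bisector_slope :: "real \<Rightarrow> real \<Rightarrow> real \<Rightarrow> real" where
  "bisector_slope x\<^sub>1 x\<^sub>2 y\<^sub>2 = (x\<^sub>1 - x\<^sub>2) / y\<^sub>2"

definition bisector_intercept :: "real \<Rightarrow> real \<Rightarrow> real \<Rightarrow> real" where
  "bisector_intercept x\<^sub>1 x\<^sub>2 y\<^sub>2 = - (1/2) * ((x\<^sub>1\<^sup>2 - y\<^sub>2\<^sup>2 - x\<^sub>2\<^sup>2) / y\<^sub>2)"

definition oval_fun :: "real \<Rightarrow> real \<Rightarrow> real \<Rightarrow> real \<Rightarrow> real \<Rightarrow> real \<Rightarrow> real" where
  "oval_fun \<beta> \<rho> x\<^sub>1 m n x =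
     sqrt ((x - x\<^sub>1)\<^sup>2 + (m * x + n)\<^sup>2) - \<beta> * sqrt (x\<^sup>2 + (m * x + n)\<^sup>2) - \<rho>"

definition asset_dist :: "real \<Rightarrow> real \<Rightarrow> real \<Rightarrow> real \<Rightarrow> real \<Rightarrow> real" where
  "asset_dist x\<^sub>s y\<^sub>s m n x = sqrt ((x\<^sub>s - x)\<^sup>2 + (y\<^sub>s - m * x - n)\<^sup>2)"

definition quartic :: "real \<Rightarrow> real \<Rightarrow> real \<Rightarrow> real \<Rightarrow> real \<Rightarrow> real \<Rightarrow> real" where
  "quartic \<beta> \<rho> x\<^sub>1 m n x =
     (let b = 1 - \<beta>\<^sup>2;
          \<eta> = \<rho>\<^sup>2 - x\<^sub>1\<^sup>2;
          k3 = b * (1 + m\<^sup>2) * (b * m * n - x\<^sub>1);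
          k2 = b\<^sup>2 * n\<^sup>2 * (3 * m\<^sup>2 + 1) / 2 - b * (2 * m * n * x\<^sub>1 + \<eta> * (1 + m\<^sup>2) / 2)
               + x\<^sub>1\<^sup>2 - \<beta>\<^sup>2 * \<rho>\<^sup>2 * (1 + m\<^sup>2);
          k1 = b\<^sup>2 * m * n^3 - b * n * (n * x\<^sub>1 + m * \<eta>) + x\<^sub>1 * \<eta> - 2 * \<beta>\<^sup>2 * \<rho>\<^sup>2 * m * n;
          k0 = (b * n\<^sup>2 - \<eta>)\<^sup>2 - (2 * \<beta> * \<rho> * n)\<^sup>2
      in b\<^sup>2 * (1 + m\<^sup>2)\<^sup>2 * x^4 + 4 * k3 * x^3 + 4 * k2 * x\<^sup>2 + 4 * k1 * x + k0)"

end

theory Submission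
  imports Defs
begin

text \<open>
  Let \<open>S(x)\<close> be the set of points \<open>p\<close> with \<open>|p - R\<^sub>i| \<ge> \<rho> + \<beta> |p - B\<^sub>L|\<close> for \<open>i = 1, 2\<close>, that is, the points that
  blue can reach unblocked whatever red does, and let \<open>W(x)\<close> be the distance of the asset from \<open>S(x)\<close>.
  The set \<open>S(x)\<close> is strictly convex and bounded by the two Cartesian ovals. Blue guarantees \<open>W(x)\<close> (or
  reaches the asset) by running straight to the nearest point \<open>p(x)\<close> of \<open>S(x)\<close>; red guarantees \<open>W(x)\<close> by always
  running straight towards the current \<open>p(x)\<close>. Hence \<open>W\<close> is constant along an optimal play, and blue
  must head to \<open>p(x)\<close> at every instant, since otherwise red gains to first order. A Gronwall argument
  shows that \<open>p(x)\<close> does not move, so blue runs straight to the initial \<open>p(x)\<close>; simultaneous blocking there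
  forces both interceptors to run straight to it as well and puts it on both ovals. On the bisector the
  points of the first oval are points of \<open>S(x)\<close>, there are at most two of them by strict convexity, and they
  are the roots of \<open>O\<close>, which solve the quartic.
\<close>

section \<open>Right derivatives and piecewise controlled motions\<close>

text \<open>The saddle point is given, so only necessary conditions are derived; the value is never
  differentiated. The obstacle is the breadth of the strategy classes: feedback laws may be
  discontinuous, closed-loop motions need not be unique, and admissibility provides only a short
  motion against frozen opposing headings. A deviation must nevertheless be an admissible law with a
  complete play against an unknown opponent. This is why deviations are open-loop after a switching
  time and are controlled through invariants instead of explicit trajectories. One such play
  suffices, because the saddle inequalities hold for all plays. The estimates rest on two rates.
  Moving a point towards blue repairs a violated oval constraint at rate \<beta> - 1, which gives
  the Lipschitz constants. One minus the cosine of a small angle is quadratic, so pursuing a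
  slightly moving target costs red only order \<delta>^2 over a step \<delta>, while a wrong heading
  costs blue order \<delta>.\<close>

lemma nonincreasing_if_right_deriv_nonpos:
  fixes f :: "real \<Rightarrow> real"
  assumes "a \<le> b" "continuous_on {a..b} f"
    and deriv: "\<And>t. a \<le> t \<Longrightarrow> t < b \<Longrightarrow> \<exists>D\<le>0. (f has_real_derivative D) (at_right t)"
  shows "f b \<le> f a"
proof -
  have "f b - f a \<le> e * (b - a)" if e: "e > 0" for e
  proof (rule ccontr)
    define g where "g t = f t - f a - e * (t - a)" for t
    define S where "S = {t\<in>{a..b}. 0 < g t}"
    assume "\<not> ?thesis"
    then have bS: "b \<in> S" using assms(1) by (simp add: S_def g_def)
    have bdd: "bdd_below S" by (rule bdd_belowI[of _ a]) (simp add: S_def)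
    define c where "c = Inf S"
    have ac: "a \<le> c" unfolding c_def using bS by (intro cInf_greatest) (auto simp: S_def)
    have cb: "c \<le> b" unfolding c_def by (rule cInf_lower[OF bS bdd])
    have cont: "continuous_on {a..b} g"
      unfolding g_def using assms(2) by (intro continuous_intros)
    have low: "g t \<le> 0" if "a \<le> t" "t < c" for t
      using that cb cInf_lower[of t S] bdd by (force simp: c_def S_def not_le[symmetric])
    have gc: "g c \<le> 0"
    proof (cases "a = c")
      case False
      then have "a < c" using ac by simp
      have "continuous (at_left c) g"
      proof -
        have "continuous_on {a..c} g" using cont by (rule continuous_on_subset) (use cb in auto)
        then have "continuous (at c within {a..c}) g"
          using ac by (simp add: continuous_on_eq_continuous_within)
        then show ?thesis using \<open>a < c\<close> by (simp add: at_within_Icc_at_left)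
      qed
      moreover have "\<forall>\<^sub>F t in at_left c. g t \<le> 0"
        using low \<open>a < c\<close> by (auto simp: eventually_at_left_field intro!: exI[of _ a])
      ultimately show ?thesis
        by (intro tendsto_upperbound[of g "g c" "at_left c"]) (auto simp: continuous_within)
    qed (simp add: g_def)
    then have "c < b" using cb bS by (cases "c = b") (auto simp: S_def)
    with deriv[OF ac] obtain D where D: "D \<le> 0" "(f has_real_derivative D) (at_right c)" by blast
    have "(g has_real_derivative D - e) (at_right c)"
      unfolding g_def using D(2) by (auto intro!: derivative_eq_intros)
    then obtain d where d: "d > 0" "\<And>h. 0 < h \<Longrightarrow> c + h \<in> {c<..} \<Longrightarrow> h < d \<Longrightarrow> g (c + h) < g c"
      using has_real_derivative_neg_dec_right[of g "D - e" c "{c<..}"] D(1) e by auto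
    have "t \<notin> S" if "t < c + d" for t
    proof
      assume t: "t \<in> S"
      then have "c \<le> t" unfolding c_def by (rule cInf_lower[OF _ bdd])
      moreover have "t \<noteq> c" using gc t by (auto simp: S_def)
      ultimately have "g t < g c" using d(2)[of "t - c"] that by simp
      then show False using gc t by (simp add: S_def)
    qed
    then have "c + d \<le> c" unfolding c_def using bS by (intro cInf_greatest) (auto simp: not_less[symmetric])
    then show False using d(1) by simp
  qed
  note * = this
  have "f b - f a \<le> 0 + e" if "e > 0" for e
  proof (cases "a = b")
    case False
    then show ?thesis using *[of "e / (b - a)"] that assms(1) by simp
  qed (use that in simp)
  then show ?thesis using field_le_epsilon[of "f b - f a" 0] by simp
qed

text \<open>Projecting on the total increment \<open>w = f b - f a\<close> reduces the vector case
  to the monotonicity of a scalar function.\<close>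

lemma lipschitz_if_right_deriv_bounded:
  fixes f :: "real \<Rightarrow> 'a::real_inner"
  assumes "a \<le> b" "continuous_on {a..b} f"
    and "\<And>t. a \<le> t \<Longrightarrow> t < b \<Longrightarrow> \<exists>D. norm D \<le> L \<and> (f has_vector_derivative D) (at_right t)"
  shows "dist (f a) (f b) \<le> L * (b - a)"
proof (cases "f a = f b")
  case True
  have "0 \<le> L * (b - a)"
  proof (cases "a = b")
    case False
    then have "a < b" using assms(1) by simp
    then obtain D :: 'a where "norm D \<le> L" using assms(3)[OF order_refl] by blast
    then have "0 \<le> L" using norm_ge_zero order_trans by blast
    then show ?thesis using assms(1) by simp
  qed simp
  then show ?thesis using True by simp
next
  case False
  define w where "w = f b - f a"
  have "inner (f b) w - L * norm w * b \<le> inner (f a) w - L * norm w * a"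
  proof (rule nonincreasing_if_right_deriv_nonpos[OF assms(1), where f = "\<lambda>t. inner (f t) w - L * norm w * t"])
    show "continuous_on {a..b} (\<lambda>t. inner (f t) w - L * norm w * t)"
      using assms(2) by (intro continuous_intros)
    fix t assume "a \<le> t" "t < b"
    then obtain D where D: "norm D \<le> L" "(f has_vector_derivative D) (at_right t)" using assms(3) by blast
    have "((\<lambda>t. inner (f t) w) has_vector_derivative inner D w) (at_right t)"
      using bounded_linear.has_vector_derivative[OF bounded_linear_inner_left D(2)] .
    then have "((\<lambda>t. inner (f t) w - L * norm w * t) has_real_derivative (inner D w - L * norm w)) (at_right t)"
      unfolding has_real_derivative_iff_has_vector_derivative by (auto intro!: derivative_eq_intros)
    moreover have "inner D w \<le> L * norm w"
      using norm_cauchy_schwarz[of D w] mult_right_mono[OF D(1), of "norm w"] by simp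
    ultimately show "\<exists>D\<le>0. ((\<lambda>t. inner (f t) w - L * norm w * t) has_real_derivative D) (at_right t)"
      by (intro exI[of _ "inner D w - L * norm w"]) simp
  qed
  then have "inner w w \<le> L * norm w * (b - a)"
    by (simp add: w_def inner_diff_left algebra_simps)
  then have "norm w * norm w \<le> (L * (b - a)) * norm w" by (simp add: dot_square_norm power2_eq_square mult_ac)
  then show ?thesis using False by (simp add: w_def dist_norm norm_minus_commute)
qed

lemma affine_if_right_deriv_const:
  fixes f :: "real \<Rightarrow> 'a::real_inner"
  assumes "a \<le> b" "continuous_on {a..b} f"
    and "\<And>t. a \<le> t \<Longrightarrow> t < b \<Longrightarrow> (f has_vector_derivative v) (at_right t)"
  shows "f b = f a + (b - a) *\<^sub>R v"
proof -
  have "dist (f a - a *\<^sub>R v) (f b - b *\<^sub>R v) \<le> 0 * (b - a)"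
  proof (rule lipschitz_if_right_deriv_bounded[OF assms(1), where f = "\<lambda>t. f t - t *\<^sub>R v"])
    show "continuous_on {a..b} (\<lambda>t. f t - t *\<^sub>R v)"
      using assms(2) by (intro continuous_intros)
    fix t assume "a \<le> t" "t < b"
    then have "((\<lambda>t. f t - t *\<^sub>R v) has_vector_derivative 0) (at_right t)"
      using assms(3) by (auto intro!: derivative_eq_intros)
    then show "\<exists>D. norm D \<le> 0 \<and> ((\<lambda>t. f t - t *\<^sub>R v) has_vector_derivative D) (at_right t)"
      by auto
  qed
  then show ?thesis by (simp add: algebra_simps)
qed

section \<open>Gluing motions with piecewise constant control\<close>

lemma has_vector_derivative_at_right_cong:
  assumes "(f has_vector_derivative D) (at_right t)" "t < s" "\<And>r. t \<le> r \<Longrightarrow> r < s \<Longrightarrow> g r = f r"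
  shows "(g has_vector_derivative D) (at_right t)"
proof -
  have "\<forall>\<^sub>F r in at_right t. (1 / norm (r - t)) *\<^sub>R (f r - (f t + (r - t) *\<^sub>R D))
      = (1 / norm (r - t)) *\<^sub>R (g r - (g t + (r - t) *\<^sub>R D))"
    using assms(2,3) by (auto simp: eventually_at_right_field intro!: exI[of _ s])
  then show ?thesis
    using assms(1) unfolding has_vector_derivative_def has_derivative_within
    by (blast intro: Lim_transform_eventually)
qed

lemma continuous_on_initial_segments:
  assumes "\<And>s. t0 \<le> s \<Longrightarrow> P s \<Longrightarrow> continuous_on {t0..s} (X :: real \<Rightarrow> 'a::topological_space)"
    and "\<And>t. t0 \<le> t \<Longrightarrow> P t \<Longrightarrow> \<exists>s>t. (\<forall>r\<in>{t0..}. r < s \<longrightarrow> P r) \<and> P s"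
  shows "continuous_on {t. t0 \<le> t \<and> P t} X"
  unfolding continuous_on_eq_continuous_within
proof
  fix t assume "t \<in> {t. t0 \<le> t \<and> P t}"
  then obtain s where t: "t0 \<le> t" and s: "t < s" "\<forall>r\<in>{t0..}. r < s \<longrightarrow> P r" "P s" using assms(2) by blast
  have "continuous_on {t0..s} X" using assms(1) t s by auto
  then have "continuous (at t within {t0..s}) X" using t s by (simp add: continuous_on_eq_continuous_within)
  then have "continuous (at t within {t0..s} \<inter> {..<s}) X" by (rule continuous_within_subset) auto
  moreover have "at t within {t0..s} \<inter> {..<s} = at t within {t. t0 \<le> t \<and> P t}"
    using s by (intro at_within_nhd[of t "{..<s}"]) auto
  ultimately show "continuous (at t within {t. t0 \<le> t \<and> P t}) X" by (simp add: continuous_within)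
qed

text \<open>\<open>F c\<close> is a velocity field into which the opponent's feedback law is already
  inserted, so \<open>c\<close> is the control of one player only. All conditions refer to times
  before \<open>T\<close>: the final state may lie outside \<open>Q\<close>, and the union of a
  chain of motions is again a motion.\<close>

definition motion_on ::
  "('c \<Rightarrow> real \<Rightarrow> 's::real_normed_vector \<Rightarrow> 's) \<Rightarrow> 's set \<Rightarrow> (real \<Rightarrow> 's \<Rightarrow> bool) \<Rightarrow> 'c set \<Rightarrow>
   real \<Rightarrow> ereal \<Rightarrow> (real \<Rightarrow> 'c) \<Rightarrow> (real \<Rightarrow> 's) \<Rightarrow> bool" where
  "motion_on F Q I U t0 T u X \<longleftrightarrow> (\<forall>t. t0 \<le> t \<and> ereal t < T \<longrightarrow>
     X t \<in> Q \<and> I t (X t) \<and> continuous_on {t0..t} X \<and> u t \<in> U \<and>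
     (\<exists>s>t. \<forall>r\<in>{t..<s}. u r = u t) \<and> (X has_vector_derivative F (u t) t (X t)) (at_right t))"

lemma motion_on_cong:
  assumes "motion_on F Q I U t0 T u X" "\<And>t. t0 \<le> t \<Longrightarrow> ereal t < T \<Longrightarrow> u' t = u t \<and> X' t = X t"
  shows "motion_on F Q I U t0 T u' X'"
  unfolding motion_on_def
proof (intro allI impI)
  fix t assume t: "t0 \<le> t \<and> ereal t < T"
  then have m: "X t \<in> Q \<and> I t (X t) \<and> continuous_on {t0..t} X \<and> u t \<in> U \<and>
     (\<exists>s>t. \<forall>r\<in>{t..<s}. u r = u t) \<and> (X has_vector_derivative F (u t) t (X t)) (at_right t)"
    using assms(1) by (simp add: motion_on_def)
  obtain s where s: "t < s" "ereal s < T" using t ereal_dense2[of "ereal t" T] by auto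
  obtain s' where s': "t < s'" "\<forall>r\<in>{t..<s'}. u r = u t" using m by blast
  have eq: "u' r = u r" "X' r = X r" if "t0 \<le> r" "r \<le> s" for r
    using assms(2)[OF that(1)] that(2) s(2) by (auto simp: le_less_trans[of "ereal r" "ereal s"])
  have "continuous_on {t0..t} X" using m by blast
  then have "continuous_on {t0..t} X'"
    by (rule continuous_on_eq) (metis atLeastAtMost_iff eq(2) less_imp_le order_trans s(1))
  moreover have "\<exists>s>t. \<forall>r\<in>{t..<s}. u' r = u' t"
  proof (intro exI[of _ "min s s'"] conjI ballI)
    fix r assume r: "r \<in> {t..<min s s'}"
    then have "t0 \<le> r" "r \<le> s" using t by simp_all
    then have "u' r = u r" by (rule eq(1))
    also have "u r = u t" using bspec[OF s'(2), of r] r by simp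
    also have "u t = u' t" using eq(1)[of t] t s(1) by simp
    finally show "u' r = u' t" .
  qed (use s s' in auto)
  moreover have "(X' has_vector_derivative F (u t) t (X t)) (at_right t)"
    by (rule has_vector_derivative_at_right_cong[of X _ t s]) (use m s(1) eq(2) t in auto)
  ultimately show "X' t \<in> Q \<and> I t (X' t) \<and> continuous_on {t0..t} X' \<and> u' t \<in> U \<and>
     (\<exists>s>t. \<forall>r\<in>{t..<s}. u' r = u' t) \<and> (X' has_vector_derivative F (u' t) t (X' t)) (at_right t)"
    using m eq[of t] t s by simp
qed

lemma motion_on_append:
  assumes X: "motion_on F Q I U t0 (ereal \<tau>) u X" and Y: "motion_on F Q I U \<tau> T v Y"
    and "t0 \<le> \<tau>" "continuous_on {t0..\<tau>} X" "Y \<tau> = X \<tau>"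
  shows "motion_on F Q I U t0 T (\<lambda>t. if t < \<tau> then u t else v t) (\<lambda>t. if t < \<tau> then X t else Y t)"
    (is "motion_on F Q I U t0 T ?u ?X")
  unfolding motion_on_def
proof (intro allI impI)
  fix t assume t: "t0 \<le> t \<and> ereal t < T"
  show "?X t \<in> Q \<and> I t (?X t) \<and> continuous_on {t0..t} ?X \<and> ?u t \<in> U \<and>
     (\<exists>s>t. \<forall>r\<in>{t..<s}. ?u r = ?u t) \<and> (?X has_vector_derivative F (?u t) t (?X t)) (at_right t)"
  proof (cases "t < \<tau>")
    case True
    have "motion_on F Q I U t0 (ereal \<tau>) ?u ?X"
      by (rule motion_on_cong[OF X]) auto
    then show ?thesis using t True unfolding motion_on_def by simp
  next
    case False
    have "motion_on F Q I U \<tau> T ?u ?X" by (rule motion_on_cong[OF Y]) auto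
    then have m: "?X t \<in> Q \<and> I t (?X t) \<and> continuous_on {\<tau>..t} ?X \<and> ?u t \<in> U \<and>
     (\<exists>s>t. \<forall>r\<in>{t..<s}. ?u r = ?u t) \<and> (?X has_vector_derivative F (?u t) t (?X t)) (at_right t)"
      using t False unfolding motion_on_def by simp
    have "continuous_on {t0..\<tau>} ?X"
      by (rule continuous_on_eq[OF assms(4)]) (use assms(5) in auto)
    then have "continuous_on ({t0..\<tau>} \<union> {\<tau>..t}) ?X"
      using m by (intro continuous_on_closed_Un) auto
    moreover have "{t0..\<tau>} \<union> {\<tau>..t} = {t0..t}" using assms(3) False by auto
    ultimately show ?thesis using m by simp
  qed
qed

lemma motion_on_lipschitz:
  fixes F :: "'c \<Rightarrow> real \<Rightarrow> 's::real_inner \<Rightarrow> 's"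
  assumes "motion_on F Q I U t0 T u X" "\<And>c t y. norm (F c t y) \<le> L" "t0 \<le> s" "s \<le> r" "ereal r < T"
  shows "dist (X s) (X r) \<le> L * (r - s)"
proof (rule lipschitz_if_right_deriv_bounded[OF assms(4)])
  have m: "continuous_on {t0..r} X" using assms unfolding motion_on_def by auto
  then show "continuous_on {s..r} X" by (rule continuous_on_subset) (use assms in auto)
  fix t assume "s \<le> t" "t < r"
  then have "t0 \<le> t \<and> ereal t < T" using assms by (auto intro: less_trans[of "ereal t" "ereal r"])
  then show "\<exists>D. norm D \<le> L \<and> (X has_vector_derivative D) (at_right t)"
    using assms(1,2) unfolding motion_on_def by blast
qed

text \<open>Segments with constant control are pieced together transfinitely, by Zorn's lemma on the graphs of
  control and motion. The resulting control is right-locally constant, which makes it executable as an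
  open-loop law against any opponent.\<close>

lemma continuation:
  fixes F :: "'c \<Rightarrow> real \<Rightarrow> 's::{real_inner,complete_space} \<Rightarrow> 's"
  assumes bound: "\<And>c t y. norm (F c t y) \<le> L"
    and start: "y0 \<in> Q" "I t0 y0"
    and closed: "\<And>Y s t. t0 \<le> t \<Longrightarrow> t < s \<Longrightarrow> continuous_on {t..s} Y \<Longrightarrow> (\<forall>r\<in>{t..<s}. Y r \<in> Q \<and> I r (Y r)) \<Longrightarrow> I s (Y s)"
    and extend: "\<And>t y. t0 \<le> t \<Longrightarrow> y \<in> Q \<Longrightarrow> I t y \<Longrightarrow>
      \<exists>c s Y. t < s \<and> Y t = y \<and> motion_on F Q I U t (ereal s) (\<lambda>_. c) Y"
  obtains T u X where "ereal t0 < T" "X t0 = y0" "motion_on F Q I U t0 T u X"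
    "continuous_on {t. t0 \<le> t \<and> ereal t \<le> T} X"
    "T \<noteq> \<infinity> \<Longrightarrow> X (real_of_ereal T) \<notin> Q \<and> I (real_of_ereal T) (X (real_of_ereal T))"
proof -
  \<comment> \<open>Restricting the graph to times in \<open>[t0, T)\<close> makes set inclusion the
    same as continuation of both control and motion.\<close>
  define graph :: "ereal \<Rightarrow> (real \<Rightarrow> 'c) \<Rightarrow> (real \<Rightarrow> 's) \<Rightarrow> (real \<times> 'c \<times> 's) set"
    where "graph T u X = {(t, u t, X t) |t. t0 \<le> t \<and> ereal t < T}" for T u X
  define sol where "sol T u X \<longleftrightarrow> ereal t0 < T \<and> X t0 = y0 \<and> motion_on F Q I U t0 T u X" for T u X
  define \<A> where "\<A> = {graph T u X |T u X. sol T u X}"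
  have graph_eq: "u t = u' t \<and> X t = X' t"
    if "graph T u X \<subseteq> graph T' u' X' \<or> graph T' u' X' \<subseteq> graph T u X" "t0 \<le> t" "ereal t < T" "ereal t < T'"
    for T u X T' u' X' t
  proof -
    have "(t, u t, X t) \<in> graph T u X" "(t, u' t, X' t) \<in> graph T' u' X'"
      using that by (auto simp: graph_def)
    then show ?thesis using that(1) by (auto simp: graph_def)
  qed
  have "\<exists>M\<in>\<A>. \<forall>Z\<in>\<A>. M \<subseteq> Z \<longrightarrow> Z = M"
  proof (rule subset_Zorn_nonempty)
    obtain c s Y where "t0 < s" "Y t0 = y0" "motion_on F Q I U t0 (ereal s) (\<lambda>_. c) Y"
      using extend[OF order_refl start] by blast
    then have "sol (ereal s) (\<lambda>_. c) Y" by (simp add: sol_def)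
    then have "graph (ereal s) (\<lambda>_. c) Y \<in> \<A>" unfolding \<A>_def by blast
    then show "\<A> \<noteq> {}" by auto
    fix \<C> assume ne: "\<C> \<noteq> {}" and chain: "subset.chain \<A> \<C>"
    have "\<forall>Z\<in>\<C>. \<exists>T u X. Z = graph T u X \<and> sol T u X"
      using chain unfolding subset.chain_def \<A>_def by auto
    then have "\<exists>T u X. \<forall>Z\<in>\<C>. Z = graph (T Z) (u Z) (X Z) \<and> sol (T Z) (u Z) (X Z)"
      by (simp only: bchoice_iff)
    then obtain T u X where TuX: "\<forall>Z\<in>\<C>. Z = graph (T Z) (u Z) (X Z) \<and> sol (T Z) (u Z) (X Z)"
      by (elim exE)
    note Z = bspec[OF TuX, THEN conjunct1] bspec[OF TuX, THEN conjunct2]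
    \<comment> \<open>Members of the chain agree wherever both are defined, so any member still
      running at \<open>t\<close> may supply the values at \<open>t\<close>.\<close>
    define T' where "T' = (SUP Z\<in>\<C>. T Z)"
    define pick where "pick t = (SOME Z. Z \<in> \<C> \<and> ereal t < T Z)" for t
    define u' where "u' t = u (pick t) t" for t
    define X' where "X' t = X (pick t) t" for t
    have eq: "u' t = u Z t \<and> X' t = X Z t" if "Z \<in> \<C>" "t0 \<le> t" "ereal t < T Z" for Z t
    proof -
      have p: "pick t \<in> \<C> \<and> ereal t < T (pick t)"
        unfolding pick_def by (rule someI[of _ Z]) (use that in auto)
      then have "pick t \<subseteq> Z \<or> Z \<subseteq> pick t" using chain that unfolding subset.chain_def by blast
      then show ?thesis
        using graph_eq[of "T (pick t)" "u (pick t)" "X (pick t)" "T Z" "u Z" "X Z" t]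
        unfolding u'_def X'_def Z(1)[OF conjunct1[OF p], symmetric] Z(1)[OF that(1), symmetric]
        using p that by blast
    qed
    have ex: "\<exists>Z\<in>\<C>. ereal t < T Z" if "ereal t < T'" for t
      using that unfolding T'_def less_SUP_iff .
    have TT': "T Z \<le> T'" if "Z \<in> \<C>" for Z using that unfolding T'_def by (rule SUP_upper)
    have mZ: "motion_on F Q I U t0 (T Z) u' X'" if "Z \<in> \<C>" for Z
      using Z(2)[OF that] eq[OF that] unfolding sol_def by (auto intro: motion_on_cong)
    have "sol T' u' X'"
      unfolding sol_def
    proof (intro conjI)
      obtain Z where Z0: "Z \<in> \<C>" using ne by blast
      with Z(2) have "ereal t0 < T Z" "X Z t0 = y0" unfolding sol_def by auto
      then show "ereal t0 < T'" "X' t0 = y0" using TT'[OF Z0] eq[OF Z0, of t0] by auto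
      show "motion_on F Q I U t0 T' u' X'"
        unfolding motion_on_def
      proof (intro allI impI)
        fix t assume t: "t0 \<le> t \<and> ereal t < T'"
        then obtain Z where "Z \<in> \<C>" "ereal t < T Z" using ex by blast
        then show "X' t \<in> Q \<and> I t (X' t) \<and> continuous_on {t0..t} X' \<and> u' t \<in> U \<and>
          (\<exists>s>t. \<forall>r\<in>{t..<s}. u' r = u' t) \<and> (X' has_vector_derivative F (u' t) t (X' t)) (at_right t)"
          using mZ t unfolding motion_on_def by blast
      qed
    qed
    moreover have "\<Union>\<C> = graph T' u' X'"
    proof
      show "\<Union>\<C> \<subseteq> graph T' u' X'"
      proof
        fix z assume "z \<in> \<Union>\<C>"
        then obtain C where C: "C \<in> \<C>" "z \<in> C" by blast
        then obtain t where "z = (t, u C t, X C t)" "t0 \<le> t" "ereal t < T C"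
          using Z(1)[OF C(1)] unfolding graph_def by auto
        then show "z \<in> graph T' u' X'"
          using eq[OF C(1)] TT'[OF C(1)] unfolding graph_def by (auto intro: less_le_trans)
      qed
      show "graph T' u' X' \<subseteq> \<Union>\<C>"
      proof
        fix z assume "z \<in> graph T' u' X'"
        then obtain t where t: "z = (t, u' t, X' t)" "t0 \<le> t" "ereal t < T'" unfolding graph_def by auto
        then obtain C where C: "C \<in> \<C>" "ereal t < T C" using ex by blast
        then have "z \<in> graph (T C) (u C) (X C)" using eq[OF C(1) t(2) C(2)] t unfolding graph_def by auto
        then show "z \<in> \<Union>\<C>" using Z(1)[OF C(1)] C(1) by auto
      qed
    qed
    ultimately show "\<Union>\<C> \<in> \<A>" unfolding \<A>_def by blast
  qed
  then obtain M where M: "M \<in> \<A>" and maxM: "\<forall>Z\<in>\<A>. M \<subseteq> Z \<longrightarrow> Z = M" by (elim bexE)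
  from M obtain T u X where s: "sol T u X" and M': "M = graph T u X" unfolding \<A>_def by auto
  have max: "graph T' u' X' = graph T u X" if "sol T' u' X'" "graph T u X \<subseteq> graph T' u' X'" for T' u' X'
  proof -
    have "graph T' u' X' \<in> \<A>" using that(1) unfolding \<A>_def by auto
    then show ?thesis using maxM that(2) unfolding M' by simp
  qed
  have m: "motion_on F Q I U t0 T u X" and T0: "ereal t0 < T" and X0: "X t0 = y0"
    using s unfolding sol_def by auto
  have "T = \<infinity> \<or> (\<exists>\<tau>. T = ereal \<tau>)" using T0 by (cases T) auto
  then show thesis
  proof (elim disjE exE)
    assume T: "T = \<infinity>"
    have "continuous_on {t. t0 \<le> t \<and> True} X"
      using m unfolding motion_on_def T by (intro continuous_on_initial_segments) (auto intro: gt_ex)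
    then show thesis using that[OF T0 X0 m] T by simp
  next
    fix \<tau> assume T: "T = ereal \<tau>"
    have \<tau>: "t0 < \<tau>" using T0 T by simp
    have L: "0 \<le> L" using bound norm_ge_zero order_trans by blast
    \<comment> \<open>Bounded speed and completeness yield a limit state at \<open>\<tau>\<close>,
      and \<open>closed\<close> carries the invariant to it.\<close>
    have "L-lipschitz_on {t0..<\<tau>} X"
    proof (rule lipschitz_onI[OF _ L])
      fix a b assume ab: "a \<in> {t0..<\<tau>}" "b \<in> {t0..<\<tau>}"
      show "dist (X a) (X b) \<le> L * dist a b"
        using motion_on_lipschitz[OF m bound, of a b] motion_on_lipschitz[OF m bound, of b a] ab T
        by (cases "a \<le> b") (auto simp: dist_real_def dist_commute)
    qed
    then obtain g where g: "uniformly_continuous_on (closure {t0..<\<tau>}) g" "\<And>t. t \<in> {t0..<\<tau>} \<Longrightarrow> X t = g t"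
      using uniformly_continuous_on_extension_on_closure[OF lipschitz_on_uniformly_continuous] by metis
    have contg: "continuous_on {t0..\<tau>} g"
      using uniformly_continuous_imp_continuous[OF g(1)] \<tau> by simp
    have mg: "motion_on F Q I U t0 T u g"
      by (rule motion_on_cong[OF m]) (use g(2) T in auto)
    have g0: "g t0 = y0" using g(2)[of t0] X0 \<tau> by simp
    have Ig: "I \<tau> (g \<tau>)"
      by (rule closed[OF order_refl \<tau> contg]) (use mg T in \<open>auto simp: motion_on_def\<close>)
    \<comment> \<open>Otherwise one more constant segment could be appended at
      \<open>\<tau>\<close>, against maximality.\<close>
    have "g \<tau> \<notin> Q"
    proof
      assume "g \<tau> \<in> Q"
      then obtain c s Y where Y: "\<tau> < s" "Y \<tau> = g \<tau>" "motion_on F Q I U \<tau> (ereal s) (\<lambda>_. c) Y"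
        using extend[OF less_imp_le[OF \<tau>] _ Ig] by blast
      let ?u = "\<lambda>t. if t < \<tau> then u t else c" and ?X = "\<lambda>t. if t < \<tau> then g t else Y t"
      have "motion_on F Q I U t0 (ereal s) ?u ?X"
        using motion_on_append[OF mg[unfolded T] Y(3) less_imp_le[OF \<tau>] contg Y(2)] .
      then have s': "sol (ereal s) ?u ?X" unfolding sol_def using \<tau> Y(1) g0 by auto
      have "graph T u X \<subseteq> graph (ereal s) ?u ?X"
        using g(2) Y(1) unfolding graph_def T by auto
      from max[OF s' this] have "graph (ereal s) ?u ?X = graph T u X" .
      moreover have "(\<tau>, ?u \<tau>, ?X \<tau>) \<in> graph (ereal s) ?u ?X" using \<tau> Y(1) unfolding graph_def by auto
      ultimately show False unfolding graph_def T by auto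
    qed
    moreover have "{t. t0 \<le> t \<and> ereal t \<le> T} = {t0..\<tau>}" using T by auto
    ultimately show thesis using that[OF T0 g0 mg] contg Ig T by simp
  qed
qed

section \<open>Cartesian ovals\<close>

text \<open>A margin in distance: while blue covers \<open>dist p B\<close>, the interceptor covers
  \<open>\<beta>\<close> times as much, and its engagement range accounts for \<open>\<rho>\<close>.
  The zero set is the Cartesian oval of \<open>B\<close> with respect to \<open>R\<close>.\<close>

definition slack :: "real \<Rightarrow> real \<Rightarrow> complex \<Rightarrow> complex \<Rightarrow> complex \<Rightarrow> real" where
  "slack \<beta> \<rho> B R p = dist p R - \<rho> - \<beta> * dist p B"

lemma slack_self: "slack \<beta> \<rho> B R B = dist B R - \<rho>"
  by (simp add: slack_def)

lemma slack_lipschitz: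
  assumes "\<beta> \<ge> 0"
  shows "slack \<beta> \<rho> B R p - (1 + \<beta>) * dist p p' \<le> slack \<beta> \<rho> B R p'"
proof -
  have "\<beta> * dist p' B \<le> \<beta> * (dist p B + dist p p')"
    using assms dist_triangle[of p' B p] by (intro mult_left_mono) (auto simp: dist_commute)
  moreover have "dist p R \<le> dist p' R + dist p p'"
    using dist_triangle[of p R p'] by simp
  ultimately show ?thesis by (simp add: slack_def algebra_simps)
qed

text \<open>Each unit walked from \<open>p\<close> towards blue saves \<open>\<beta>\<close> in
  blue's term and costs at most 1 in the distance to \<open>R\<close>; the net rate is
  \<open>\<beta> - 1\<close>.\<close>

lemma slack_ray:
  assumes "\<beta> \<ge> 0" "0 \<le> t" "t \<le> 1"
  shows "slack \<beta> \<rho> B R (p + t *\<^sub>R (B - p)) \<ge> slack \<beta> \<rho> B R p + (\<beta> - 1) * t * dist p B"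
proof -
  have "dist (p + t *\<^sub>R (B - p)) p = t * dist p B"
    using assms by (simp add: dist_norm norm_minus_commute)
  then have 1: "dist p R \<le> dist (p + t *\<^sub>R (B - p)) R + t * dist p B"
    using dist_triangle[of p R "p + t *\<^sub>R (B - p)"] by (simp add: dist_commute)
  have "p + t *\<^sub>R (B - p) - B = (1 - t) *\<^sub>R (p - B)"
    by (simp add: algebra_simps)
  then have 2: "dist (p + t *\<^sub>R (B - p)) B = (1 - t) * dist p B"
    using assms by (simp add: dist_norm)
  from 1 show ?thesis unfolding slack_def 2 by (simp add: algebra_simps)
qed

section \<open>The safe set, its convexity and the projection of the asset\<close>

definition safe :: "real \<Rightarrow> real \<Rightarrow> state \<Rightarrow> complex set" where
  "safe \<beta> \<rho> x = {p. 0 \<le> slack \<beta> \<rho> (blue x) (red1 x) p \<and> 0 \<le> slack \<beta> \<rho> (blue x) (red2 x) p}"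

lemma blue_in_safe:
  "blue x \<in> safe \<beta> \<rho> x \<longleftrightarrow> \<rho> \<le> dist (blue x) (red1 x) \<and> \<rho> \<le> dist (blue x) (red2 x)"
  by (simp add: safe_def slack_self)

lemma closed_safe: "closed (safe \<beta> \<rho> x)"
proof -
  have "closed ({p. 0 \<le> slack \<beta> \<rho> (blue x) (red1 x) p} \<inter> {p. 0 \<le> slack \<beta> \<rho> (blue x) (red2 x) p})"
    unfolding slack_def by (intro closed_Int closed_Collect_le continuous_intros)
  then show ?thesis by (simp add: safe_def Collect_conj_eq)
qed

text \<open>Squaring turns the defining inequality of an oval into \<open>h p \<le> 0\<close> for a uniformly convex \<open>h\<close>;
  the additional square term survives because \<open>\<beta> > 1\<close>.\<close>

lemma slack_convex_combination:
  assumes "\<beta> > 1" "\<rho> > 0" "0 \<le> slack \<beta> \<rho> B R p" "0 \<le> slack \<beta> \<rho> B R q" "0 < t" "t < 1" "p \<noteq> q"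
  shows "0 < slack \<beta> \<rho> B R ((1 - t) *\<^sub>R p + t *\<^sub>R q)"
proof -
  \<comment> \<open>\<open>h\<close> is
    \<open>(\<rho> + \<beta> * dist z B)^2 - (dist z R)^2\<close> expressed in
    \<open>w = z - B\<close>. Both squared quantities are nonnegative, so the sign of
    \<open>h\<close> is opposite to that of the slack.\<close>
  define h where "h w = (\<beta>\<^sup>2 - 1) * (norm w)\<^sup>2 + 2 * \<rho> * \<beta> * norm w + 2 * inner w (R - B)
     + \<rho>\<^sup>2 - (norm (R - B))\<^sup>2" for w
  have h: "h (z - B) = (\<rho> + \<beta> * dist z B)\<^sup>2 - (dist z R)\<^sup>2" for z
  proof -
    have "z - R = (z - B) - (R - B)" by simp
    then have "(dist z R)\<^sup>2 = (norm (z - B))\<^sup>2 - 2 * inner (z - B) (R - B) + (norm (R - B))\<^sup>2"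
      unfolding dist_norm power2_norm_eq_inner
      by (simp only: inner_diff_left inner_diff_right inner_commute) (simp add: algebra_simps)
    then show ?thesis unfolding h_def by (simp add: dist_norm power2_eq_square algebra_simps)
  qed
  have sgn: "0 \<le> slack \<beta> \<rho> B R z \<longleftrightarrow> h (z - B) \<le> 0" "0 < slack \<beta> \<rho> B R z \<longleftrightarrow> h (z - B) < 0" for z
  proof -
    have nn: "0 \<le> \<rho> + \<beta> * dist z B" using assms by simp
    show "0 \<le> slack \<beta> \<rho> B R z \<longleftrightarrow> h (z - B) \<le> 0"
      unfolding h using power_mono_iff[OF nn, of "dist z R" 2] by (auto simp: slack_def)
    show "0 < slack \<beta> \<rho> B R z \<longleftrightarrow> h (z - B) < 0"
      unfolding h using power_mono_iff[of "dist z R" "\<rho> + \<beta> * dist z B" 2] nn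
      by (auto simp: slack_def not_le[symmetric])
  qed
  define u v where "u = p - B" and "v = q - B"
  have uv: "(1 - t) *\<^sub>R p + t *\<^sub>R q - B = (1 - t) *\<^sub>R u + t *\<^sub>R v"
    by (simp add: u_def v_def algebra_simps)
  have n1: "norm ((1 - t) *\<^sub>R u + t *\<^sub>R v) \<le> (1 - t) * norm u + t * norm v"
    using norm_triangle_ineq[of "(1 - t) *\<^sub>R u" "t *\<^sub>R v"] assms by simp
  \<comment> \<open>The defect \<open>t * (1 - t) * (norm (u - v))^2\<close> in this identity is the
    source of strictness.\<close>
  have n2: "(norm ((1 - t) *\<^sub>R u + t *\<^sub>R v))\<^sup>2
      = (1 - t) * (norm u)\<^sup>2 + t * (norm v)\<^sup>2 - t * (1 - t) * (norm (u - v))\<^sup>2"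
    unfolding power2_norm_eq_inner
    by (simp add: inner_left_distrib inner_right_distrib inner_diff_left inner_diff_right
        inner_commute[of v u] algebra_simps)
  have n3: "inner ((1 - t) *\<^sub>R u + t *\<^sub>R v) (R - B) = (1 - t) * inner u (R - B) + t * inner v (R - B)"
    by (simp add: inner_left_distrib)
  have "2 * \<rho> * \<beta> * norm ((1 - t) *\<^sub>R u + t *\<^sub>R v) \<le> 2 * \<rho> * \<beta> * ((1 - t) * norm u + t * norm v)"
    using n1 assms by (intro mult_left_mono) auto
  then have "h ((1 - t) *\<^sub>R u + t *\<^sub>R v)
      \<le> (1 - t) * h u + t * h v - (\<beta>\<^sup>2 - 1) * (t * (1 - t) * (norm (u - v))\<^sup>2)"
    unfolding h_def n2 n3 by (simp add: algebra_simps)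
  moreover have "0 < (\<beta>\<^sup>2 - 1) * (t * (1 - t) * (norm (u - v))\<^sup>2)"
    using assms by (intro mult_pos_pos) (auto simp: u_def v_def)
  moreover have "(1 - t) * h u \<le> 0" "t * h v \<le> 0"
    using assms sgn by (auto simp: mult_le_0_iff u_def v_def)
  ultimately show ?thesis unfolding sgn uv by linarith
qed

lemma convex_safe:
  assumes "\<beta> > 1" "\<rho> > 0"
  shows "convex (safe \<beta> \<rho> x)"
  unfolding convex_alt
proof (intro ballI allI impI)
  fix p q and t :: real
  assume *: "p \<in> safe \<beta> \<rho> x" "q \<in> safe \<beta> \<rho> x" "0 \<le> t \<and> t \<le> 1"
  show "(1 - t) *\<^sub>R p + t *\<^sub>R q \<in> safe \<beta> \<rho> x"
  proof (cases "t = 0 \<or> t = 1 \<or> p = q")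
    case True
    then show ?thesis using * by (auto simp flip: scaleR_left_distrib)
  next
    case False
    then show ?thesis
      using * slack_convex_combination[OF assms, of "blue x" _ p q t] by (auto simp: safe_def less_imp_le)
  qed
qed

text \<open>Walking towards blue raises both slacks at rate \<open>\<beta> - 1\<close>, so a
  violation of \<open>k\<close> is repaired within distance \<open>k / (\<beta> - 1)\<close>. If
  blue is closer than that, blue's own position serves.\<close>

lemma safe_near:
  assumes "\<beta> > 1" "0 \<le> k" "blue x \<in> safe \<beta> \<rho> x"
    and "- k \<le> slack \<beta> \<rho> (blue x) (red1 x) p" "- k \<le> slack \<beta> \<rho> (blue x) (red2 x) p"
  obtains p' where "p' \<in> safe \<beta> \<rho> x" "dist p p' \<le> k / (\<beta> - 1)"
proof (cases "dist p (blue x) \<le> k / (\<beta> - 1)")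
  case True
  then show ?thesis by (rule that[OF assms(3)])
next
  case False
  define t where "t = k / ((\<beta> - 1) * dist p (blue x))"
  have pos: "0 < dist p (blue x)" using False assms
    by (smt (verit) divide_nonneg_pos zero_le_dist)
  have td: "t * dist p (blue x) = k / (\<beta> - 1)" using pos by (simp add: t_def)
  have t: "0 \<le> t" "t \<le> 1"
    using False assms pos by (auto simp: t_def divide_simps mult.commute split: if_splits)
  have k: "(\<beta> - 1) * t * dist p (blue x) = k" using td assms by (simp add: mult.assoc)
  show ?thesis
  proof
    show "p + t *\<^sub>R (blue x - p) \<in> safe \<beta> \<rho> x"
      using slack_ray[of \<beta> t \<rho> "blue x" "red1 x" p] slack_ray[of \<beta> t \<rho> "blue x" "red2 x" p] assms t
      by (simp add: safe_def k)
    show "dist p (p + t *\<^sub>R (blue x - p)) \<le> k / (\<beta> - 1)"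
      using td t by (simp add: dist_norm norm_minus_commute)
  qed
qed

text \<open>For the initial state, this is the paper's point \<open>(x\<^sup>*, y\<^sup>*)\<close>.\<close>

definition aim :: "real \<Rightarrow> real \<Rightarrow> complex \<Rightarrow> state \<Rightarrow> complex" where
  "aim \<beta> \<rho> A x = closest_point (safe \<beta> \<rho> x) A"

definition game_value :: "real \<Rightarrow> real \<Rightarrow> complex \<Rightarrow> state \<Rightarrow> real" where
  "game_value \<beta> \<rho> A x = dist A (aim \<beta> \<rho> A x)"

lemma aim_in_safe: "blue x \<in> safe \<beta> \<rho> x \<Longrightarrow> aim \<beta> \<rho> A x \<in> safe \<beta> \<rho> x"
  unfolding aim_def by (rule closest_point_in_set[OF closed_safe]) auto

lemma game_value_le: "p \<in> safe \<beta> \<rho> x \<Longrightarrow> game_value \<beta> \<rho> A x \<le> dist A p"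
  unfolding game_value_def aim_def by (rule closest_point_le[OF closed_safe])

text \<open>The angle at the foot of a projection onto a closed convex set is not acute, so the
  excess of squared distance dominates the squared displacement. This turns near-optimality of a
  safe point into closeness to the target.\<close>

lemma dist_aim_le:
  assumes "\<beta> > 1" "\<rho> > 0" "p \<in> safe \<beta> \<rho> x"
  shows "(dist p (aim \<beta> \<rho> A x))\<^sup>2 \<le> (dist A p)\<^sup>2 - (game_value \<beta> \<rho> A x)\<^sup>2"
proof -
  let ?c = "aim \<beta> \<rho> A x"
  have "inner (A - ?c) (p - ?c) \<le> 0"
    unfolding aim_def by (rule closest_point_dot[OF convex_safe[OF assms(1,2)] closed_safe assms(3)])
  moreover have "(norm (A - p))\<^sup>2 = (norm (A - ?c))\<^sup>2 + (norm (p - ?c))\<^sup>2 - 2 * inner (A - ?c) (p - ?c)"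
    unfolding power2_norm_eq_inner by (simp add: inner_diff_left inner_diff_right inner_commute algebra_simps)
  ultimately show ?thesis by (simp add: game_value_def dist_norm)
qed

text \<open>A point with room in both constraints can be shifted towards \<open>A\<close>: a shift
  of length \<open>l\<close> lowers each slack by at most \<open>(1 + \<beta>) * l\<close>, which
  determines \<open>t\<close> in the proof.\<close>

lemma game_value_interior:
  assumes "\<beta> > 0" "0 < slack \<beta> \<rho> (blue x) (red1 x) p" "0 < slack \<beta> \<rho> (blue x) (red2 x) p" "p \<noteq> A"
  shows "game_value \<beta> \<rho> A x < dist A p"
proof -
  define k where "k = min (slack \<beta> \<rho> (blue x) (red1 x) p) (slack \<beta> \<rho> (blue x) (red2 x) p)"
  define t where "t = min 1 (k / ((1 + \<beta>) * dist p A))"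
  have k: "k > 0" using assms by (simp add: k_def)
  have dp: "dist p A > 0" using assms by simp
  have t: "0 < t" "t \<le> 1" using k dp assms by (auto simp: t_def)
  have d: "dist p (p + t *\<^sub>R (A - p)) = t * dist p A"
    using t by (simp add: dist_norm norm_minus_commute)
  have "t \<le> k / ((1 + \<beta>) * dist p A)" by (simp add: t_def)
  then have "(1 + \<beta>) * (t * dist p A) \<le> k"
    using dp assms by (simp add: pos_le_divide_eq mult_ac)
  then have "p + t *\<^sub>R (A - p) \<in> safe \<beta> \<rho> x"
    using slack_lipschitz[of \<beta> \<rho> "blue x" "red1 x" p "p + t *\<^sub>R (A - p)"]
      slack_lipschitz[of \<beta> \<rho> "blue x" "red2 x" p "p + t *\<^sub>R (A - p)"] assms
    unfolding safe_def d k_def by simp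
  from game_value_le[OF this, of A]
  have "game_value \<beta> \<rho> A x \<le> dist A (p + t *\<^sub>R (A - p))" .
  also have "A - (p + t *\<^sub>R (A - p)) = (1 - t) *\<^sub>R (A - p)" by (simp add: algebra_simps)
  then have "dist A (p + t *\<^sub>R (A - p)) = (1 - t) * dist A p" using t by (simp add: dist_norm)
  also have "\<dots> < dist A p" using t dp by (simp add: dist_commute)
  finally show ?thesis .
qed

text \<open>At blue's position the slack is the separation minus \<open>\<rho>\<close>. A target too
  close to blue would inherit positive slack and could not be optimal. The bound keeps directions to
  the target well defined.\<close>

lemma aim_dist_lower:
  assumes "\<beta> > 0" "\<rho> \<le> dist (blue x) (red1 x)" "\<rho> \<le> dist (blue x) (red2 x)" "game_value \<beta> \<rho> A x > 0"
  shows "min (dist (blue x) (red1 x)) (dist (blue x) (red2 x)) - \<rho> \<le> (1 + \<beta>) * dist (aim \<beta> \<rho> A x) (blue x)"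
proof (rule ccontr)
  assume "\<not> ?thesis"
  then have *: "(1 + \<beta>) * dist (blue x) (aim \<beta> \<rho> A x) < min (dist (blue x) (red1 x)) (dist (blue x) (red2 x)) - \<rho>"
    by (simp add: dist_commute)
  have "0 < slack \<beta> \<rho> (blue x) (red1 x) (aim \<beta> \<rho> A x)" "0 < slack \<beta> \<rho> (blue x) (red2 x) (aim \<beta> \<rho> A x)"
    using * slack_lipschitz[of \<beta> \<rho> "blue x" "red1 x" "blue x" "aim \<beta> \<rho> A x"]
      slack_lipschitz[of \<beta> \<rho> "blue x" "red2 x" "blue x" "aim \<beta> \<rho> A x"] assms(1)
    by (auto simp: slack_self)
  then have "game_value \<beta> \<rho> A x < dist A (aim \<beta> \<rho> A x)"
    using game_value_interior[OF assms(1)] assms(4) by (force simp: game_value_def)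
  then show False by (simp add: game_value_def)
qed

section \<open>Change of slack and value while red runs at the target\<close>

lemma inner_sgn_ge:
  fixes a c :: "'a::real_inner"
  assumes "a \<noteq> 0" "c \<noteq> 0"
  shows "1 - (norm (a - c))\<^sup>2 / (2 * norm a * norm c) \<le> inner (sgn a) (sgn c)"
proof -
  \<comment> \<open>Law of cosines, combined with the inequality between squares and products of the
    norms. The deficit of the cosine is quadratic in \<open>norm (a - c)\<close>, the origin of all
    second-order errors below.\<close>
  have "(norm (a - c))\<^sup>2 = (norm a)\<^sup>2 + (norm c)\<^sup>2 - 2 * inner a c"
    unfolding power2_norm_eq_inner by (simp add: inner_diff_left inner_diff_right inner_commute)
  moreover have "2 * norm a * norm c \<le> (norm a)\<^sup>2 + (norm c)\<^sup>2" by (rule sum_squares_bound)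
  ultimately have "2 * norm a * norm c - (norm (a - c))\<^sup>2 \<le> 2 * inner a c" by linarith
  then have "(2 * norm a * norm c - (norm (a - c))\<^sup>2) / (2 * norm a * norm c)
      \<le> 2 * inner a c / (2 * norm a * norm c)"
    by (intro divide_right_mono) auto
  moreover have "inner (sgn a) (sgn c) = 2 * inner a c / (2 * norm a * norm c)"
    by (simp add: sgn_div_norm divide_simps)
  moreover have "(2 * norm a * norm c - (norm (a - c))\<^sup>2) / (2 * norm a * norm c)
      = 1 - (norm (a - c))\<^sup>2 / (2 * norm a * norm c)"
    using assms by (simp add: diff_divide_distrib)
  ultimately show ?thesis by simp
qed

text \<open>Subgradient inequality for the norm, with \<open>sgn a\<close> as gradient at
  \<open>a\<close>. It converts changes of distance into projected displacements.\<close>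

lemma inner_sgn_le_norm_diff:
  fixes a c :: "'a::real_inner"
  shows "norm a + inner (sgn a) (c - a) \<le> norm c"
proof (cases "a = 0")
  case False
  have "norm a * norm a = inner a a" by (simp add: dot_square_norm power2_eq_square)
  then have "norm a + inner (sgn a) (c - a) = inner (sgn a) c"
    using False by (simp add: sgn_div_norm inner_diff_right divide_simps)
  also have "\<dots> \<le> norm (sgn a) * norm c" by (rule norm_cauchy_schwarz)
  finally show ?thesis using False by (simp add: norm_sgn)
qed simp

text \<open>Over a time step \<open>\<delta>\<close> the interceptor runs straight towards \<open>q\<close>, so it gains \<open>\<beta> \<delta>\<close> on every point
  seen in almost the same direction as \<open>q\<close>.\<close>

lemma slack_step:
  assumes "\<beta> > 1" "\<rho> > 0" "0 \<le> \<delta>" "\<delta> < dist q B"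
    and "0 \<le> slack \<beta> \<rho> B R q" "0 \<le> slack \<beta> \<rho> B' (R + (\<beta> * \<delta>) *\<^sub>R sgn (q - R)) p"
  shows "\<beta> * (\<delta> + dist p B' - dist p B) - \<beta> * \<delta> * (dist p q)\<^sup>2 / (2 * \<rho>\<^sup>2) \<le> slack \<beta> \<rho> B R p"
proof -
  define R' where "R' = R + (\<beta> * \<delta>) *\<^sub>R sgn (q - R)"
  have qR: "\<rho> + \<beta> * dist q B \<le> dist q R" using assms(5) by (simp add: slack_def)
  have bd: "\<beta> * \<delta> \<le> \<beta> * dist q B" using assms by simp
  \<comment> \<open>\<open>q\<close> is safe and the step is shorter than blue's way to
    \<open>q\<close>, so red stays at least \<open>\<rho>\<close> away from \<open>q\<close>; the
    same holds for \<open>p\<close> by the last assumption. These two bounds produce the denominator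
    \<open>2 * \<rho>^2\<close>.\<close>
  have big: "0 < norm (q - R) - \<beta> * \<delta>" "\<rho> \<le> norm (q - R) - \<beta> * \<delta>"
    using qR bd assms(2) by (auto simp: dist_norm)
  have qR0: "norm (q - R) > 0" using big assms(1,3)
    by (smt (verit) mult_nonneg_nonneg)
  have eq: "q - R' = (norm (q - R) - \<beta> * \<delta>) *\<^sub>R sgn (q - R)"
  proof -
    have "q - R = norm (q - R) *\<^sub>R sgn (q - R)" using qR0 by (simp add: sgn_div_norm)
    then show ?thesis unfolding R'_def by (simp add: scaleR_left_diff_distrib diff_diff_eq)
  qed
  have nq: "norm (q - R') = norm (q - R) - \<beta> * \<delta>"
    using big qR0 unfolding eq by (auto simp: norm_sgn)
  have sq: "sgn (q - R') = sgn (q - R)"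
    unfolding eq sgn_scaleR using big by (simp add: sgn_sgn)
  have pR': "\<rho> + \<beta> * dist p B' \<le> norm (p - R')" "\<rho> \<le> norm (p - R')"
  proof -
    show "\<rho> + \<beta> * dist p B' \<le> norm (p - R')"
      using assms(6) unfolding slack_def R'_def[symmetric] dist_norm by linarith
    moreover have "0 \<le> \<beta> * dist p B'" using assms(1) by simp
    ultimately show "\<rho> \<le> norm (p - R')" by linarith
  qed
  have "\<rho> * \<rho> \<le> norm (p - R') * norm (q - R')"
    using pR' big assms(2) by (intro mult_mono) (auto simp: nq)
  then have "(dist p q)\<^sup>2 / (2 * norm (p - R') * norm (q - R')) \<le> (dist p q)\<^sup>2 / (2 * \<rho>\<^sup>2)"
  proof (intro divide_left_mono)
    have "0 < norm (p - R')" "0 < norm (q - R')" using pR' big assms(2) nq by linarith+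
    then show "0 < 2 * norm (p - R') * norm (q - R') * (2 * \<rho>\<^sup>2)"
      using assms(2) by (intro mult_pos_pos) auto
  qed (simp_all add: power2_eq_square)
  then have "1 - (dist p q)\<^sup>2 / (2 * \<rho>\<^sup>2) \<le> inner (sgn (p - R')) (sgn (q - R'))"
  proof -
    have "p - R' \<noteq> 0" "q - R' \<noteq> 0" using pR'(2) big(2) assms(2) nq by auto
    from inner_sgn_ge[OF this] show ?thesis
      using \<open>_ \<le> (dist p q)\<^sup>2 / (2 * \<rho>\<^sup>2)\<close> by (simp add: dist_norm)
  qed
  \<comment> \<open>The component of red's displacement in the direction of \<open>p\<close> bounds
    from below how much closer red gets to \<open>p\<close>.\<close>
  then have "\<beta> * \<delta> * (1 - (dist p q)\<^sup>2 / (2 * \<rho>\<^sup>2)) \<le> \<beta> * \<delta> * inner (sgn (p - R')) (sgn (q - R'))"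
    using assms by (intro mult_left_mono) auto
  also have "\<dots> = inner (sgn (p - R')) ((p - R) - (p - R'))"
    unfolding sq by (simp add: R'_def)
  also have "\<dots> \<le> norm (p - R) - norm (p - R')"
    using inner_sgn_le_norm_diff[of "p - R'" "p - R"] by linarith
  finally have "\<beta> * \<delta> * (1 - (dist p q)\<^sup>2 / (2 * \<rho>\<^sup>2)) + (\<rho> + \<beta> * dist p B') \<le> norm (p - R)"
    using pR' by linarith
  then show ?thesis unfolding slack_def dist_norm by (simp add: algebra_simps)
qed

text \<open>Blue's new position \<open>B'\<close> is a free argument, since blue's motion during the
  step is arbitrary apart from its speed.\<close>

definition red_step :: "real \<Rightarrow> complex \<Rightarrow> state \<Rightarrow> real \<Rightarrow> complex \<Rightarrow> state" where
  "red_step \<beta> q x \<delta> B' =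
     (B', red1 x + (\<beta> * \<delta>) *\<^sub>R sgn (q - red1 x), red2 x + (\<beta> * \<delta>) *\<^sub>R sgn (q - red2 x))"

lemma slack_red_move:
  assumes "\<beta> \<ge> 0" "dist B B' \<le> \<delta>" "dist R R' \<le> \<beta> * \<delta>"
  shows "slack \<beta> \<rho> B' R' p - 2 * \<beta> * \<delta> \<le> slack \<beta> \<rho> B R p"
proof -
  have "dist p R' \<le> dist p R + \<beta> * \<delta>" using dist_triangle[of p R' R] assms by linarith
  moreover have "\<beta> * dist p B \<le> \<beta> * (dist p B' + \<delta>)"
    using dist_triangle[of p B B'] assms by (intro mult_left_mono) (auto simp: dist_commute)
  ultimately show ?thesis by (simp add: slack_def algebra_simps)
qed

text \<open>A step changes each slack by at most \<open>2 * \<beta> * \<delta>\<close>, so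
  \<open>safe_near\<close> returns \<open>p\<close> to the old safe set within
  \<open>a * \<delta>\<close>, where \<open>dist_aim_le\<close> applies. The resulting distance is
  only of order \<open>sqrt \<delta>\<close>, but \<open>slack_step\<close> multiplies its square by
  another \<open>\<delta>\<close>.\<close>

lemma safe_step_near_aim:
  assumes "\<beta> > 1" "\<rho> > 0" "blue x \<in> safe \<beta> \<rho> x" "0 \<le> \<delta>" "\<delta> \<le> D"
    and "dist (blue x) (blue x') \<le> \<delta>" "dist (red1 x) (red1 x') \<le> \<beta> * \<delta>" "dist (red2 x) (red2 x') \<le> \<beta> * \<delta>"
    and "p \<in> safe \<beta> \<rho> x'" "dist A p \<le> game_value \<beta> \<rho> A x"
  defines "a \<equiv> 2 * \<beta> / (\<beta> - 1)"
  shows "(dist p (aim \<beta> \<rho> A x))\<^sup>2 \<le> (4 * a\<^sup>2 * D + 4 * a * game_value \<beta> \<rho> A x) * \<delta>"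
proof -
  let ?W = "game_value \<beta> \<rho> A x" and ?q = "aim \<beta> \<rho> A x"
  have p: "0 \<le> slack \<beta> \<rho> (blue x') (red1 x') p" "0 \<le> slack \<beta> \<rho> (blue x') (red2 x') p"
    using assms(9) by (auto simp: safe_def)
  have k: "0 \<le> 2 * \<beta> * \<delta>" using assms by simp
  have "- (2 * \<beta> * \<delta>) \<le> slack \<beta> \<rho> (blue x) (red1 x) p" "- (2 * \<beta> * \<delta>) \<le> slack \<beta> \<rho> (blue x) (red2 x) p"
    using slack_red_move[of \<beta> "blue x" "blue x'" \<delta> "red1 x" "red1 x'" \<rho> p]
      slack_red_move[of \<beta> "blue x" "blue x'" \<delta> "red2 x" "red2 x'" \<rho> p] assms p by auto
  from safe_near[OF assms(1) k assms(3) this]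
  obtain p' where p': "p' \<in> safe \<beta> \<rho> x" "dist p p' \<le> a * \<delta>"
    by (auto simp: a_def)
  have a: "a > 0" using assms by (simp add: a_def)
  have W: "0 \<le> ?W" by (simp add: game_value_def)
  have "dist A p' \<le> ?W + a * \<delta>" using dist_triangle[of A p' p] p' assms by linarith
  then have "(dist A p')\<^sup>2 \<le> (?W + a * \<delta>)\<^sup>2" by (intro power_mono) auto
  then have "(dist p' ?q)\<^sup>2 \<le> 2 * ?W * a * \<delta> + (a * \<delta>)\<^sup>2"
    using dist_aim_le[OF assms(1,2) p'(1), of A] by (simp add: power2_sum)
  moreover have "(dist p ?q)\<^sup>2 \<le> (dist p p' + dist p' ?q)\<^sup>2"
    using dist_triangle by (intro power_mono) auto
  moreover have "(dist p p' + dist p' ?q)\<^sup>2 \<le> 2 * (dist p p')\<^sup>2 + 2 * (dist p' ?q)\<^sup>2"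
    using sum_squares_bound[of "dist p p'" "dist p' ?q"] by (simp add: power2_sum)
  moreover have "(dist p p')\<^sup>2 \<le> (a * \<delta>)\<^sup>2" using p' by (intro power_mono) auto
  ultimately have "(dist p ?q)\<^sup>2 \<le> 4 * (a * \<delta>)\<^sup>2 + 4 * ?W * a * \<delta>" by linarith
  also have "(a * \<delta>)\<^sup>2 \<le> a\<^sup>2 * D * \<delta>"
  proof -
    have "a\<^sup>2 * (\<delta> * \<delta>) \<le> a\<^sup>2 * (D * \<delta>)" using assms(4,5) by (intro mult_left_mono mult_right_mono) auto
    then show ?thesis by (simp add: power_mult_distrib power2_eq_square mult_ac)
  qed
  finally show ?thesis by (simp add: algebra_simps)
qed

text \<open>Inserting \<open>(dist p q)^2 \<le> M * \<delta>\<close> into \<open>slack_step\<close>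
  makes the error quadratic. Blue's detour \<open>\<delta> + dist p B' - dist p (blue x)\<close> is
  kept: its sign preserves the value, its size yields a strict gain.\<close>

lemma red_step_slack:
  assumes "\<beta> > 1" "\<rho> > 0" "blue x \<in> safe \<beta> \<rho> x"
  obtains C M where "0 \<le> C" "0 \<le> M"
    "\<And>\<delta> B' p. \<lbrakk>0 \<le> \<delta>; \<delta> < dist (aim \<beta> \<rho> A x) (blue x); dist (blue x) B' \<le> \<delta>;
        p \<in> safe \<beta> \<rho> (red_step \<beta> (aim \<beta> \<rho> A x) x \<delta> B'); dist A p \<le> game_value \<beta> \<rho> A x\<rbrakk> \<Longrightarrow>
      (dist p (aim \<beta> \<rho> A x))\<^sup>2 \<le> M * \<delta> \<and>
      \<beta> * (\<delta> + dist p B' - dist p (blue x)) - C * \<delta>\<^sup>2 \<le> slack \<beta> \<rho> (blue x) (red1 x) p \<and>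
      \<beta> * (\<delta> + dist p B' - dist p (blue x)) - C * \<delta>\<^sup>2 \<le> slack \<beta> \<rho> (blue x) (red2 x) p"
proof -
  let ?q = "aim \<beta> \<rho> A x" and ?W = "game_value \<beta> \<rho> A x"
  define a where "a = 2 * \<beta> / (\<beta> - 1)"
  define M where "M = 4 * a\<^sup>2 * dist ?q (blue x) + 4 * a * ?W"
  define C where "C = \<beta> * M / (2 * \<rho>\<^sup>2)"
  have a: "a > 0" using assms by (simp add: a_def)
  have M: "M \<ge> 0" using a by (simp add: M_def game_value_def)
  show ?thesis
  proof (rule that[of C M])
    show "C \<ge> 0" using M assms by (simp add: C_def)
    fix \<delta> B' p
    assume d: "0 \<le> \<delta>" "\<delta> < dist ?q (blue x)" "dist (blue x) B' \<le> \<delta>"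
      and p: "p \<in> safe \<beta> \<rho> (red_step \<beta> ?q x \<delta> B')" "dist A p \<le> ?W"
    have q: "0 \<le> slack \<beta> \<rho> (blue x) (red1 x) ?q" "0 \<le> slack \<beta> \<rho> (blue x) (red2 x) ?q"
      using aim_in_safe[OF assms(3), of A] by (auto simp: safe_def)
    have n: "norm (sgn z) \<le> 1" for z :: complex by (simp add: norm_sgn)
    have b: "\<beta> * \<delta> * norm (sgn z) \<le> \<beta> * \<delta>" for z :: complex
      using mult_left_mono[OF n, of "\<beta> * \<delta>" z] assms(1) d(1) by simp
    have near: "(dist p ?q)\<^sup>2 \<le> M * \<delta>"
      unfolding M_def a_def
      by (rule safe_step_near_aim[OF assms d(1) less_imp_le[OF d(2)] _ _ _ p])
        (use d assms(1) b in \<open>auto simp: red_step_def dist_norm\<close>)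
    have "\<beta> * \<delta> * (dist p ?q)\<^sup>2 / (2 * \<rho>\<^sup>2) \<le> \<beta> * \<delta> * (M * \<delta>) / (2 * \<rho>\<^sup>2)"
      using near assms(1) d(1) by (intro divide_right_mono mult_left_mono) auto
    also have "\<dots> = C * \<delta>\<^sup>2" by (simp add: C_def power2_eq_square)
    finally have C: "\<beta> * \<delta> * (dist p ?q)\<^sup>2 / (2 * \<rho>\<^sup>2) \<le> C * \<delta>\<^sup>2" .
    show "(dist p ?q)\<^sup>2 \<le> M * \<delta> \<and>
      \<beta> * (\<delta> + dist p B' - dist p (blue x)) - C * \<delta>\<^sup>2 \<le> slack \<beta> \<rho> (blue x) (red1 x) p \<and>
      \<beta> * (\<delta> + dist p B' - dist p (blue x)) - C * \<delta>\<^sup>2 \<le> slack \<beta> \<rho> (blue x) (red2 x) p"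
    proof (intro conjI near)
      have p': "0 \<le> slack \<beta> \<rho> B' (red1 x + (\<beta> * \<delta>) *\<^sub>R sgn (?q - red1 x)) p"
        "0 \<le> slack \<beta> \<rho> B' (red2 x + (\<beta> * \<delta>) *\<^sub>R sgn (?q - red2 x)) p"
        using p(1) by (simp_all add: safe_def red_step_def)
      show "\<beta> * (\<delta> + dist p B' - dist p (blue x)) - C * \<delta>\<^sup>2 \<le> slack \<beta> \<rho> (blue x) (red1 x) p"
        using C slack_step[OF assms(1,2) d(1,2) q(1) p'(1)] by linarith
      show "\<beta> * (\<delta> + dist p B' - dist p (blue x)) - C * \<delta>\<^sup>2 \<le> slack \<beta> \<rho> (blue x) (red2 x) p"
        using C slack_step[OF assms(1,2) d(1,2) q(2) p'(2)] by linarith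
    qed
  qed (use M in auto)
qed

text \<open>Blue's detour is nonnegative by the triangle inequality, so the new target violates the
  old constraints by at most \<open>C * \<delta>^2\<close>, and \<open>safe_near\<close> repairs
  this at proportional cost. Safety of \<open>B'\<close> guarantees that the new safe set is
  nonempty.\<close>

lemma game_value_red_step:
  assumes "\<beta> > 1" "\<rho> > 0" "blue x \<in> safe \<beta> \<rho> x"
  obtains C where "0 \<le> C"
    "\<And>\<delta> B'. \<lbrakk>0 \<le> \<delta>; \<delta> < dist (aim \<beta> \<rho> A x) (blue x); dist (blue x) B' \<le> \<delta>;
        B' \<in> safe \<beta> \<rho> (red_step \<beta> (aim \<beta> \<rho> A x) x \<delta> B')\<rbrakk> \<Longrightarrow>
      game_value \<beta> \<rho> A x - C * \<delta>\<^sup>2 \<le> game_value \<beta> \<rho> A (red_step \<beta> (aim \<beta> \<rho> A x) x \<delta> B')"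
proof -
  let ?q = "aim \<beta> \<rho> A x" and ?W = "game_value \<beta> \<rho> A x"
  obtain C M where C: "0 \<le> C" and *: "\<And>\<delta> B' p. \<lbrakk>0 \<le> \<delta>; \<delta> < dist ?q (blue x); dist (blue x) B' \<le> \<delta>;
        p \<in> safe \<beta> \<rho> (red_step \<beta> ?q x \<delta> B'); dist A p \<le> ?W\<rbrakk> \<Longrightarrow>
      \<beta> * (\<delta> + dist p B' - dist p (blue x)) - C * \<delta>\<^sup>2 \<le> slack \<beta> \<rho> (blue x) (red1 x) p \<and>
      \<beta> * (\<delta> + dist p B' - dist p (blue x)) - C * \<delta>\<^sup>2 \<le> slack \<beta> \<rho> (blue x) (red2 x) p"
    by (rule red_step_slack[OF assms, of A]) blast
  show ?thesis
  proof (rule that[of "C / (\<beta> - 1)"])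
    show "0 \<le> C / (\<beta> - 1)" using C assms by simp
    fix \<delta> B'
    let ?x = "red_step \<beta> ?q x \<delta> B'"
    assume d: "0 \<le> \<delta>" "\<delta> < dist ?q (blue x)" "dist (blue x) B' \<le> \<delta>" and B': "B' \<in> safe \<beta> \<rho> ?x"
    let ?p = "aim \<beta> \<rho> A ?x"
    have p: "?p \<in> safe \<beta> \<rho> ?x" using B' by (intro aim_in_safe) (simp add: red_step_def)
    show "?W - C / (\<beta> - 1) * \<delta>\<^sup>2 \<le> game_value \<beta> \<rho> A ?x"
    proof (cases "?W \<le> game_value \<beta> \<rho> A ?x")
      case True
      then show ?thesis using mult_nonneg_nonneg[OF \<open>0 \<le> C / (\<beta> - 1)\<close> zero_le_power2[of \<delta>]] by linarith
    next
      case False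
      then have "dist A ?p \<le> ?W" by (simp add: game_value_def)
      note * = *[OF d p this]
      have "0 \<le> \<beta> * (\<delta> + dist ?p B' - dist ?p (blue x))"
        using dist_triangle[of ?p "blue x" B'] d assms(1) by (intro mult_nonneg_nonneg) (auto simp: dist_commute)
      then have s: "- (C * \<delta>\<^sup>2) \<le> slack \<beta> \<rho> (blue x) (red1 x) ?p" "- (C * \<delta>\<^sup>2) \<le> slack \<beta> \<rho> (blue x) (red2 x) ?p"
        using * by auto
      have "0 \<le> C * \<delta>\<^sup>2" using C by simp
      from safe_near[OF assms(1) this assms(3) s]
      obtain p' where "p' \<in> safe \<beta> \<rho> x" "dist ?p p' \<le> C * \<delta>\<^sup>2 / (\<beta> - 1)" .
      then show ?thesis
        using game_value_le[of p' \<beta> \<rho> x A] dist_triangle[of A p' ?p] unfolding game_value_def[of \<beta> \<rho> A ?x] by simp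
    qed
  qed
qed

lemma game_value_lipschitz:
  assumes "\<beta> > 1" "blue x \<in> safe \<beta> \<rho> x" "blue x' \<in> safe \<beta> \<rho> x'"
    and "dist (blue x) (blue x') \<le> \<delta>" "dist (red1 x) (red1 x') \<le> \<beta> * \<delta>" "dist (red2 x) (red2 x') \<le> \<beta> * \<delta>"
  shows "game_value \<beta> \<rho> A x \<le> game_value \<beta> \<rho> A x' + 2 * \<beta> * \<delta> / (\<beta> - 1)"
proof -
  let ?p = "aim \<beta> \<rho> A x'"
  have p: "0 \<le> slack \<beta> \<rho> (blue x') (red1 x') ?p" "0 \<le> slack \<beta> \<rho> (blue x') (red2 x') ?p"
    using aim_in_safe[OF assms(3), of A] by (auto simp: safe_def)
  have "0 \<le> \<delta>" using assms(4) zero_le_dist order_trans by blast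
  then have k: "0 \<le> 2 * \<beta> * \<delta>" using assms by simp
  have "- (2 * \<beta> * \<delta>) \<le> slack \<beta> \<rho> (blue x) (red1 x) ?p" "- (2 * \<beta> * \<delta>) \<le> slack \<beta> \<rho> (blue x) (red2 x) ?p"
    using slack_red_move[of \<beta> "blue x" "blue x'" \<delta> "red1 x" "red1 x'" \<rho> ?p]
      slack_red_move[of \<beta> "blue x" "blue x'" \<delta> "red2 x" "red2 x'" \<rho> ?p] assms p by auto
  from safe_near[OF assms(1) k assms(2) this]
  obtain p' where p': "p' \<in> safe \<beta> \<rho> x" "dist ?p p' \<le> 2 * \<beta> * \<delta> / (\<beta> - 1)" .
  then show ?thesis
    using game_value_le[OF p'(1), of A] dist_triangle[of A p' ?p] unfolding game_value_def[of \<beta> \<rho> A x'] by simp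
qed

section \<open>Plays and deviations\<close>

text \<open>\<open>Arg\<close> takes values in \<open>(-pi, pi]\<close> whereas
  \<open>headings\<close> is \<open>[-pi, pi)\<close>, so the angle \<open>pi\<close> is replaced by
  \<open>-pi\<close>.\<close>

lemma heading_exists:
  obtains \<theta> where "\<theta> \<in> headings" "z = norm z *\<^sub>R cis \<theta>"
proof (cases "Arg z = pi")
  case True
  then have "cis (- pi) = cis (Arg z)" by (simp add: complex_eq_iff)
  then show ?thesis
    using that[of "- pi"] rcis_cmod_Arg[of z] by (auto simp: headings_def rcis_def scaleR_conv_of_real)
next
  case False
  then show ?thesis
    using that[of "Arg z"] Arg_bounded[of z] rcis_cmod_Arg[of z]
    by (auto simp: headings_def rcis_def scaleR_conv_of_real)
qed

text \<open>Such an open-loop control is admissible: from every instant it is constant for a while,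
  so against frozen opposing headings a straight line solves the equations of motion.\<close>

definition right_locally_constant :: "(real \<Rightarrow> 'a) \<Rightarrow> bool" where
  "right_locally_constant u \<longleftrightarrow> (\<forall>t. \<exists>s>t. \<forall>r\<in>{t..<s}. u r = u t)"

lemma right_locally_constant_const: "right_locally_constant (\<lambda>_. c)"
  by (auto simp: right_locally_constant_def intro: gt_ex)

lemma right_locally_constant_extend:
  assumes "\<And>t. t0 \<le> t \<Longrightarrow> ereal t < T \<Longrightarrow> \<exists>s>t. \<forall>r\<in>{t..<s}. u r = u t"
  shows "right_locally_constant (\<lambda>t. if t0 \<le> t \<and> ereal t < T then u t else c)"
  unfolding right_locally_constant_def
proof
  fix t
  consider "t < t0" | "t0 \<le> t" "ereal t < T" | "t0 \<le> t" "T \<le> ereal t" by (meson not_le)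
  then show "\<exists>s>t. \<forall>r\<in>{t..<s}. (if t0 \<le> r \<and> ereal r < T then u r else c)
      = (if t0 \<le> t \<and> ereal t < T then u t else c)"
  proof cases
    case 1
    then show ?thesis by (intro exI[of _ t0]) auto
  next
    case 2
    then obtain s1 where s1: "s1 > t" "\<forall>r\<in>{t..<s1}. u r = u t" using assms by blast
    obtain s2 where s2: "t < s2" "ereal s2 < T" using 2 ereal_dense2[of "ereal t" T] by auto
    show ?thesis
    proof (intro exI[of _ "min s1 s2"] conjI ballI)
      fix r assume r: "r \<in> {t..<min s1 s2}"
      have "u r = u t" using bspec[OF s1(2), of r] r by simp
      moreover have "ereal r < T" using less_trans[of "ereal r" "ereal s2" T] r s2(2) by simp
      moreover have "t0 \<le> r" using r 2 by simp
      ultimately show "(if t0 \<le> r \<and> ereal r < T then u r else c) = (if t0 \<le> t \<and> ereal t < T then u t else c)"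
        using 2 by simp
    qed (use s1 s2 in simp)
  next
    case 3
    then have "\<not> ereal r < T" if "t \<le> r" for r
      using that by (metis ereal_less_eq(3) leD order_trans)
    then show ?thesis using 3 by (intro exI[of _ "t + 1"]) auto
  qed
qed

text \<open>Abstracting only over time lets the same operation concatenate laws and motions.\<close>

definition switch :: "real \<Rightarrow> (real \<Rightarrow> 'a) \<Rightarrow> (real \<Rightarrow> 'a) \<Rightarrow> real \<Rightarrow> 'a" where
  "switch t0 f g t = (if t < t0 then f t else g t)"

lemma switch_same [simp]: "switch t0 f f = f"
  by (simp add: switch_def fun_eq_iff)

lemma le_at_right_end:
  fixes f :: "real \<Rightarrow> real"
  assumes "a < b" "continuous_on {a..b} f" "\<And>t. a \<le> t \<Longrightarrow> t < b \<Longrightarrow> f t \<le> c"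
  shows "f b \<le> c"
proof (rule tendsto_upperbound)
  have "continuous (at b within {a..b}) f"
    using assms(1,2) by (simp add: continuous_on_eq_continuous_within)
  then show "(f \<longlongrightarrow> f b) (at_left b)"
    using assms(1) by (simp add: continuous_within at_within_Icc_at_left)
  show "\<forall>\<^sub>F t in at_left b. f t \<le> c"
    using assms(1,3) by (auto simp: eventually_at_left_field intro!: exI[of _ a])
qed simp

lemma positive_if_nonzero:
  fixes f :: "real \<Rightarrow> real"
  assumes "continuous_on {a..b} f" "a \<le> b" "0 < f a" "\<And>t. a \<le> t \<Longrightarrow> t \<le> b \<Longrightarrow> f t \<noteq> 0"
  shows "0 < f b"
proof (rule ccontr)
  assume "\<not> 0 < f b"
  then obtain t where "a \<le> t" "t \<le> b" "f t = 0"
    using IVT2'[of f b 0 a] assms(1,2,3) by auto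
  then show False using assms(4) by blast
qed

section \<open>Trajectories of a fixed game\<close>

locale bvr =
  fixes G :: bvr_game and \<beta> \<rho> \<sigma> :: real and A :: complex
  assumes G: "G = \<lparr>beta = \<beta>, rho = \<rho>, rho_s = \<sigma>, asset = A\<rparr>"
    and \<beta>: "\<beta> > 1" and \<rho>: "\<rho> > 0" and \<sigma>: "\<sigma> > 0"
begin

lemma dynamics_components:
  "fst (dynamics G \<theta> \<phi>) = cis \<theta>"
  "fst (snd (dynamics G \<theta> \<phi>)) = \<beta> *\<^sub>R cis (fst \<phi>)"
  "snd (snd (dynamics G \<theta> \<phi>)) = \<beta> *\<^sub>R cis (snd \<phi>)"
  by (simp_all add: dynamics_def G scaleR_conv_of_real)

lemma norm_dynamics: "norm (dynamics G \<theta> \<phi>) \<le> 1 + 2 * \<beta>"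
proof -
  have "norm (dynamics G \<theta> \<phi>) \<le> norm (cis \<theta>) + norm (\<beta> *\<^sub>R cis (fst \<phi>), \<beta> *\<^sub>R cis (snd \<phi>))"
    unfolding dynamics_def using norm_Pair_le by (simp only: G bvr_game.simps scaleR_conv_of_real)
  also have "\<dots> \<le> norm (cis \<theta>) + (norm (\<beta> *\<^sub>R cis (fst \<phi>)) + norm (\<beta> *\<^sub>R cis (snd \<phi>)))"
    by (intro add_left_mono norm_Pair_le)
  finally show ?thesis using \<beta> by simp
qed

lemma playing_iff:
  "x \<in> playing_states G \<longleftrightarrow>
     \<sigma> < dist (blue x) A \<and> \<rho> < dist (blue x) (red1 x) \<and> \<rho> < dist (blue x) (red2 x)"
  by (simp add: playing_states_def G)

lemma terminal_iff:
  "x \<in> terminal G \<longleftrightarrow>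
     dist (blue x) A = \<sigma> \<or> dist (blue x) (red1 x) = \<rho> \<or> dist (blue x) (red2 x) = \<rho>"
  by (auto simp: terminal_def asset_reached_def blocked_def G)

lemma open_playing: "open (playing_states G)"
proof -
  have "open {x. \<sigma> < dist (blue x) A \<and> \<rho> < dist (blue x) (red1 x) \<and> \<rho> < dist (blue x) (red2 x)}"
    by (intro open_Collect_conj open_Collect_less continuous_intros)
  then show ?thesis by (simp add: playing_states_def G)
qed

lemma playing_not_terminal: "x \<in> playing_states G \<Longrightarrow> x \<notin> terminal G"
  by (auto simp: playing_iff terminal_iff)

lemma playing_blue_in_safe: "x \<in> playing_states G \<Longrightarrow> blue x \<in> safe \<beta> \<rho> x"
  by (auto simp: playing_iff blue_in_safe)

text \<open>By the intermediate value theorem none of the three distances can fall to its threshold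
  without the state being terminal at some moment.\<close>

lemma stays_playing:
  fixes a b :: real
  assumes "continuous_on {a..b} X" "X a \<in> playing_states G" "a \<le> b"
    and "\<And>t. a \<le> t \<Longrightarrow> t \<le> b \<Longrightarrow> X t \<notin> terminal G"
  shows "X b \<in> playing_states G"
proof -
  have "0 < dist (blue (X b)) A - \<sigma>"
    using assms by (intro positive_if_nonzero[of a b "\<lambda>t. dist (blue (X t)) A - \<sigma>"] continuous_intros)
      (auto simp: playing_iff terminal_iff)
  moreover have "0 < dist (blue (X b)) (red1 (X b)) - \<rho>"
    using assms by (intro positive_if_nonzero[of a b "\<lambda>t. dist (blue (X t)) (red1 (X t)) - \<rho>"] continuous_intros)
      (auto simp: playing_iff terminal_iff)
  moreover have "0 < dist (blue (X b)) (red2 (X b)) - \<rho>"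
    using assms by (intro positive_if_nonzero[of a b "\<lambda>t. dist (blue (X t)) (red2 (X t)) - \<rho>"] continuous_intros)
      (auto simp: playing_iff terminal_iff)
  ultimately show ?thesis by (simp add: playing_iff)
qed

lemma playing_limit:
  fixes a b :: real
  assumes "continuous_on {a..b} X" "a < b" "\<And>t. a \<le> t \<Longrightarrow> t < b \<Longrightarrow> X t \<in> playing_states G"
  shows "\<sigma> \<le> dist (blue (X b)) A" "\<rho> \<le> dist (blue (X b)) (red1 (X b))" "\<rho> \<le> dist (blue (X b)) (red2 (X b))"
proof -
  have "- dist (blue (X b)) A \<le> - \<sigma>"
    by (rule le_at_right_end[OF assms(2), of "\<lambda>t. - dist (blue (X t)) A"])
      (use assms(1,3) in \<open>auto simp: playing_iff intro!: continuous_intros less_imp_le\<close>)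
  then show "\<sigma> \<le> dist (blue (X b)) A" by simp
  have "- dist (blue (X b)) (red1 (X b)) \<le> - \<rho>"
    by (rule le_at_right_end[OF assms(2), of "\<lambda>t. - dist (blue (X t)) (red1 (X t))"])
      (use assms(1,3) in \<open>auto simp: playing_iff intro!: continuous_intros less_imp_le\<close>)
  then show "\<rho> \<le> dist (blue (X b)) (red1 (X b))" by simp
  have "- dist (blue (X b)) (red2 (X b)) \<le> - \<rho>"
    by (rule le_at_right_end[OF assms(2), of "\<lambda>t. - dist (blue (X t)) (red2 (X t))"])
      (use assms(1,3) in \<open>auto simp: playing_iff intro!: continuous_intros less_imp_le\<close>)
  then show "\<rho> \<le> dist (blue (X b)) (red2 (X b))" by simp
qed

lemma exit_terminal:
  fixes a b :: real
  assumes "continuous_on {a..b} X" "a < b" "\<And>t. a \<le> t \<Longrightarrow> t < b \<Longrightarrow> X t \<in> playing_states G"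
    and "X b \<notin> playing_states G"
  shows "X b \<in> terminal G"
  using playing_limit[OF assms(1,2,3)] assms(4) by (auto simp: playing_iff terminal_iff)

context
  fixes \<gamma>\<^sub>B :: blue_law and \<gamma>\<^sub>R :: red_law and t0 :: real and x :: state and T :: ereal and X :: "real \<Rightarrow> state"
  assumes tr: "trajectory G \<gamma>\<^sub>B \<gamma>\<^sub>R t0 x T X"
begin

lemma trajectory_continuous: "ereal b \<le> T \<Longrightarrow> t0 \<le> a \<Longrightarrow> continuous_on {a..b} X"
proof (rule continuous_on_subset)
  show "continuous_on {t. t0 \<le> t \<and> ereal t \<le> T} X" using tr by (simp add: trajectory_def)
  assume "ereal b \<le> T" "t0 \<le> a"
  then show "{a..b} \<subseteq> {t. t0 \<le> t \<and> ereal t \<le> T}" by (auto intro: order_trans[of _ "ereal b" T])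
qed

lemma trajectory_deriv:
  assumes "t0 \<le> t" "ereal t < T"
  shows "((\<lambda>t. blue (X t)) has_vector_derivative cis (\<gamma>\<^sub>B t (X t))) (at_right t)"
    "((\<lambda>t. red1 (X t)) has_vector_derivative \<beta> *\<^sub>R cis (fst (\<gamma>\<^sub>R t (X t)))) (at_right t)"
    "((\<lambda>t. red2 (X t)) has_vector_derivative \<beta> *\<^sub>R cis (snd (\<gamma>\<^sub>R t (X t)))) (at_right t)"
proof -
  have d: "(X has_vector_derivative dynamics G (\<gamma>\<^sub>B t (X t)) (\<gamma>\<^sub>R t (X t))) (at_right t)"
    using tr assms by (simp add: trajectory_def)
  note s = bounded_linear.has_vector_derivative[OF bounded_linear_snd d]
  show "((\<lambda>t. blue (X t)) has_vector_derivative cis (\<gamma>\<^sub>B t (X t))) (at_right t)"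
    using bounded_linear.has_vector_derivative[OF bounded_linear_fst d] by (simp add: dynamics_components)
  show "((\<lambda>t. red1 (X t)) has_vector_derivative \<beta> *\<^sub>R cis (fst (\<gamma>\<^sub>R t (X t)))) (at_right t)"
    using bounded_linear.has_vector_derivative[OF bounded_linear_fst s] by (simp add: dynamics_components)
  show "((\<lambda>t. red2 (X t)) has_vector_derivative \<beta> *\<^sub>R cis (snd (\<gamma>\<^sub>R t (X t)))) (at_right t)"
    using bounded_linear.has_vector_derivative[OF bounded_linear_snd s] by (simp add: dynamics_components)
qed

lemma trajectory_lipschitz:
  assumes "t0 \<le> s" "s \<le> r" "ereal r \<le> T"
  shows "dist (blue (X s)) (blue (X r)) \<le> r - s"
    "dist (red1 (X s)) (red1 (X r)) \<le> \<beta> * (r - s)"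
    "dist (red2 (X s)) (red2 (X r)) \<le> \<beta> * (r - s)"
proof -
  have c: "continuous_on {s..r} X" by (rule trajectory_continuous) (use assms in auto)
  have lt: "t0 \<le> t" "ereal t < T" if "s \<le> t" "t < r" for t
    using that assms by (auto intro: less_le_trans[of _ "ereal r"])
  have "dist (blue (X s)) (blue (X r)) \<le> 1 * (r - s)"
  proof (rule lipschitz_if_right_deriv_bounded[OF assms(2), of "\<lambda>t. blue (X t)"])
    show "\<exists>D. norm D \<le> 1 \<and> ((\<lambda>t. blue (X t)) has_vector_derivative D) (at_right t)" if "s \<le> t" "t < r" for t
      using trajectory_deriv(1)[OF lt[OF that]] by (auto intro!: exI)
  qed (use c in \<open>intro continuous_intros\<close>)
  then show "dist (blue (X s)) (blue (X r)) \<le> r - s" by simp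
  show "dist (red1 (X s)) (red1 (X r)) \<le> \<beta> * (r - s)"
  proof (rule lipschitz_if_right_deriv_bounded[OF assms(2), of "\<lambda>t. red1 (X t)"])
    show "\<exists>D. norm D \<le> \<beta> \<and> ((\<lambda>t. red1 (X t)) has_vector_derivative D) (at_right t)" if "s \<le> t" "t < r" for t
      using trajectory_deriv(2)[OF lt[OF that]] \<beta> by (auto intro!: exI)
  qed (use c in \<open>intro continuous_intros\<close>)
  show "dist (red2 (X s)) (red2 (X r)) \<le> \<beta> * (r - s)"
  proof (rule lipschitz_if_right_deriv_bounded[OF assms(2), of "\<lambda>t. red2 (X t)"])
    show "\<exists>D. norm D \<le> \<beta> \<and> ((\<lambda>t. red2 (X t)) has_vector_derivative D) (at_right t)" if "s \<le> t" "t < r" for t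
      using trajectory_deriv(3)[OF lt[OF that]] \<beta> by (auto intro!: exI)
  qed (use c in \<open>intro continuous_intros\<close>)
qed

lemma trajectory_playing:
  assumes "x \<in> playing_states G" "t0 \<le> t" "ereal t < T"
  shows "X t \<in> playing_states G"
proof (rule stays_playing[of t0 t X])
  show "continuous_on {t0..t} X" by (rule trajectory_continuous) (use assms in auto)
  fix r assume "t0 \<le> r" "r \<le> t"
  then show "X r \<notin> terminal G"
    using tr assms(3) le_less_trans[of "ereal r" "ereal t" T] by (simp add: trajectory_def)
qed (use tr assms in \<open>auto simp: trajectory_def\<close>)

lemma trajectory_restrict:
  assumes "ereal t0 \<le> T'" "T' \<le> T"
  shows "trajectory G \<gamma>\<^sub>B \<gamma>\<^sub>R t0 x T' X"
  unfolding trajectory_def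
proof (intro conjI allI impI)
  show "continuous_on {t. t0 \<le> t \<and> ereal t \<le> T'} X"
    using tr assms(2) unfolding trajectory_def by (blast intro: continuous_on_subset order_trans)
qed (use tr assms in \<open>auto simp: trajectory_def intro: less_le_trans\<close>)

lemma trajectory_law_cong:
  assumes "\<And>t y. t0 \<le> t \<Longrightarrow> ereal t < T \<Longrightarrow> \<delta>\<^sub>B t y = \<gamma>\<^sub>B t y \<and> \<delta>\<^sub>R t y = \<gamma>\<^sub>R t y"
  shows "trajectory G \<delta>\<^sub>B \<delta>\<^sub>R t0 x T X"
  using tr assms unfolding trajectory_def by auto

end

text \<open>Only forward derivatives are prescribed, so at \<open>t0\<close> the pieces have to
  agree in position, not in velocity.\<close>

lemma trajectory_append:
  assumes X: "trajectory G \<gamma>\<^sub>B \<gamma>\<^sub>R a x (ereal t0) X" and Y: "trajectory G \<delta>\<^sub>B \<delta>\<^sub>R t0 (X t0) T Y"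
  shows "trajectory G (switch t0 \<gamma>\<^sub>B \<delta>\<^sub>B) (switch t0 \<gamma>\<^sub>R \<delta>\<^sub>R) a x T (switch t0 X Y)"
  unfolding trajectory_def
proof (intro conjI allI impI)
  have a: "a \<le> t0" "ereal t0 \<le> T" "X a = x" "Y t0 = X t0" using X Y by (auto simp: trajectory_def)
  show "ereal a \<le> T" using a by (metis ereal_less_eq(3) order_trans)
  show "switch t0 X Y a = x" using a by (auto simp: switch_def)
  have "continuous_on {a..t0} (switch t0 X Y)"
    by (rule continuous_on_eq[OF trajectory_continuous[OF X]]) (auto simp: switch_def a)
  moreover have "continuous_on {t. t0 \<le> t \<and> ereal t \<le> T} (switch t0 X Y)"
    by (rule continuous_on_eq[of _ Y]) (use Y in \<open>auto simp: switch_def trajectory_def\<close>)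
  moreover have "closed {t. t0 \<le> t \<and> ereal t \<le> T}"
    by (cases T) (auto simp: closed_Collect_conj closed_Collect_le continuous_on_id continuous_on_const)
  ultimately have "continuous_on ({a..t0} \<union> {t. t0 \<le> t \<and> ereal t \<le> T}) (switch t0 X Y)"
    by (intro continuous_on_closed_Un) auto
  moreover have "{t. a \<le> t \<and> ereal t \<le> T} \<subseteq> {a..t0} \<union> {t. t0 \<le> t \<and> ereal t \<le> T}" by auto
  ultimately show "continuous_on {t. a \<le> t \<and> ereal t \<le> T} (switch t0 X Y)"
    by (rule continuous_on_subset)
  fix t assume t: "a \<le> t \<and> ereal t < T"
  show "switch t0 X Y t \<notin> terminal G"
    using X Y t by (cases "t < t0") (auto simp: trajectory_def switch_def)
  show "(switch t0 X Y has_vector_derivative dynamics G (switch t0 \<gamma>\<^sub>B \<delta>\<^sub>B t (switch t0 X Y t))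
      (switch t0 \<gamma>\<^sub>R \<delta>\<^sub>R t (switch t0 X Y t))) (at_right t)"
  proof (cases "t < t0")
    case True
    then have "(X has_vector_derivative dynamics G (\<gamma>\<^sub>B t (X t)) (\<gamma>\<^sub>R t (X t))) (at_right t)"
      using X t by (simp add: trajectory_def)
    then have "(switch t0 X Y has_vector_derivative dynamics G (\<gamma>\<^sub>B t (X t)) (\<gamma>\<^sub>R t (X t))) (at_right t)"
      by (rule has_vector_derivative_at_right_cong[OF _ True]) (auto simp: switch_def)
    then show ?thesis using True by (simp add: switch_def)
  next
    case False
    then have "(Y has_vector_derivative dynamics G (\<delta>\<^sub>B t (Y t)) (\<delta>\<^sub>R t (Y t))) (at_right t)"
      using Y t by (simp add: trajectory_def)
    then have "(switch t0 X Y has_vector_derivative dynamics G (\<delta>\<^sub>B t (Y t)) (\<delta>\<^sub>R t (Y t))) (at_right t)"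
      by (rule has_vector_derivative_at_right_cong[of _ _ _ "t + 1"]) (use False in \<open>auto simp: switch_def\<close>)
    then show ?thesis using False by (simp add: switch_def)
  qed
qed

lemma trajectory_constant:
  assumes "x \<in> playing_states G" "t < s"
    and "\<And>r y. t \<le> r \<Longrightarrow> r < s \<Longrightarrow> \<gamma>\<^sub>B r y = \<theta> \<and> \<gamma>\<^sub>R r y = \<phi>"
  shows "\<exists>T>t. \<exists>X. trajectory G \<gamma>\<^sub>B \<gamma>\<^sub>R t x (ereal T) X"
proof -
  define X where "X r = x + (r - t) *\<^sub>R dynamics G \<theta> \<phi>" for r
  have X: "continuous_on UNIV X" unfolding X_def by (intro continuous_intros)
  have "open (X -` playing_states G)" using open_vimage[OF open_playing X] .
  moreover have "t \<in> X -` playing_states G" using assms(1) by (simp add: X_def)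
  ultimately obtain e where e: "e > 0" "ball t e \<subseteq> X -` playing_states G"
    by (meson openE)
  define T where "T = min s (t + e)"
  have "trajectory G \<gamma>\<^sub>B \<gamma>\<^sub>R t x (ereal T) X"
    unfolding trajectory_def
  proof (intro conjI allI impI)
    show "continuous_on {r. t \<le> r \<and> ereal r \<le> ereal T} X" by (rule continuous_on_subset[OF X]) simp
    fix r assume r: "t \<le> r \<and> ereal r < ereal T"
    then have "r \<in> ball t e" by (simp add: T_def dist_real_def)
    then show "X r \<notin> terminal G" using e(2) playing_not_terminal by blast
    have "(X has_vector_derivative dynamics G \<theta> \<phi>) (at_right r)"
      unfolding X_def by (auto intro!: derivative_eq_intros)
    then show "(X has_vector_derivative dynamics G (\<gamma>\<^sub>B r (X r)) (\<gamma>\<^sub>R r (X r))) (at_right r)"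
      using assms(3) r by (simp add: T_def)
  qed (use assms(2) e(1) in \<open>auto simp: T_def X_def\<close>)
  then show ?thesis using assms(2) e(1) by (intro exI[of _ T]) (auto simp: T_def)
qed

section \<open>Admissible deviations from a given pair of laws\<close>

lemma red_strategyD:
  assumes "\<gamma> \<in> red_strategies G"
  shows "\<gamma> t x \<in> headings \<times> headings"
    "0 \<le> t \<Longrightarrow> x \<in> playing_states G \<Longrightarrow> \<theta> \<in> headings \<Longrightarrow>
      \<exists>T>t. \<exists>X. trajectory G (\<lambda>_ _. \<theta>) \<gamma> t x (ereal T) X"
  using assms unfolding red_strategies_def by blast+

lemma blue_strategyD:
  assumes "\<gamma> \<in> blue_strategies G"
  shows "\<gamma> t x \<in> headings"
    "0 \<le> t \<Longrightarrow> x \<in> playing_states G \<Longrightarrow> \<theta> \<in> headings \<times> headings \<Longrightarrow>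
      \<exists>T>t. \<exists>X. trajectory G \<gamma> (\<lambda>_ _. \<theta>) t x (ereal T) X"
  using assms unfolding blue_strategies_def by blast+

text \<open>Before \<open>t0\<close> a motion under the old law, cut off at \<open>t0\<close>,
  witnesses admissibility; afterwards a straight line does.\<close>

lemma switch_red_strategy:
  assumes "\<gamma> \<in> red_strategies G" "right_locally_constant u" "\<And>t. u t \<in> headings \<times> headings"
  shows "switch t0 \<gamma> (\<lambda>t _. u t) \<in> red_strategies G"
  unfolding red_strategies_def
proof (intro CollectI conjI allI ballI impI)
  fix t x show "switch t0 \<gamma> (\<lambda>t _. u t) t x \<in> headings \<times> headings"
    using red_strategyD(1)[OF assms(1)] assms(3) by (simp only: switch_def split: if_splits) blast
next
  fix t x \<theta> assume *: "0 \<le> (t::real)" "x \<in> playing_states G" "\<theta> \<in> headings"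
  show "\<exists>T>t. \<exists>X. trajectory G (\<lambda>_ _. \<theta>) (switch t0 \<gamma> (\<lambda>t _. u t)) t x (ereal T) X"
  proof (cases "t < t0")
    case True
    obtain T X where T: "T > t" "trajectory G (\<lambda>_ _. \<theta>) \<gamma> t x (ereal T) X"
      using red_strategyD(2)[OF assms(1) *] by blast
    have "trajectory G (\<lambda>_ _. \<theta>) \<gamma> t x (ereal (min T t0)) X"
      by (rule trajectory_restrict[OF T(2)]) (use T True in auto)
    then have "trajectory G (\<lambda>_ _. \<theta>) (switch t0 \<gamma> (\<lambda>t _. u t)) t x (ereal (min T t0)) X"
      by (rule trajectory_law_cong) (auto simp: switch_def)
    then show ?thesis using T True by (intro exI[of _ "min T t0"]) auto
  next
    case False
    obtain s where s: "t < s" "\<forall>r\<in>{t..<s}. u r = u t"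
      using assms(2) unfolding right_locally_constant_def by blast
    show ?thesis
    proof (rule trajectory_constant[OF *(2) s(1)])
      fix r and y :: state assume "t \<le> r" "r < s"
      then show "\<theta> = \<theta> \<and> switch t0 \<gamma> (\<lambda>t _. u t) r y = u t"
        using bspec[OF s(2), of r] False by (simp add: switch_def)
    qed
  qed
qed

lemma switch_blue_strategy:
  assumes "\<gamma> \<in> blue_strategies G" "right_locally_constant u" "\<And>t. u t \<in> headings"
  shows "switch t0 \<gamma> (\<lambda>t _. u t) \<in> blue_strategies G"
  unfolding blue_strategies_def
proof (intro CollectI conjI allI ballI impI)
  fix t x show "switch t0 \<gamma> (\<lambda>t _. u t) t x \<in> headings"
    using blue_strategyD(1)[OF assms(1)] assms(3) by (simp add: switch_def)
next
  fix t x \<theta> assume *: "0 \<le> (t::real)" "x \<in> playing_states G" "\<theta> \<in> headings \<times> headings"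
  show "\<exists>T>t. \<exists>X. trajectory G (switch t0 \<gamma> (\<lambda>t _. u t)) (\<lambda>_ _. \<theta>) t x (ereal T) X"
  proof (cases "t < t0")
    case True
    obtain T X where T: "T > t" "trajectory G \<gamma> (\<lambda>_ _. \<theta>) t x (ereal T) X"
      using blue_strategyD(2)[OF assms(1) *] by blast
    have "trajectory G \<gamma> (\<lambda>_ _. \<theta>) t x (ereal (min T t0)) X"
      by (rule trajectory_restrict[OF T(2)]) (use T True in auto)
    then have "trajectory G (switch t0 \<gamma> (\<lambda>t _. u t)) (\<lambda>_ _. \<theta>) t x (ereal (min T t0)) X"
      by (rule trajectory_law_cong) (auto simp: switch_def)
    then show ?thesis using T True by (intro exI[of _ "min T t0"]) auto
  next
    case False
    obtain s where s: "t < s" "\<forall>r\<in>{t..<s}. u r = u t"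
      using assms(2) unfolding right_locally_constant_def by blast
    show ?thesis
    proof (rule trajectory_constant[OF *(2) s(1)])
      fix r and y :: state assume "t \<le> r" "r < s"
      then show "switch t0 \<gamma> (\<lambda>t _. u t) r y = u t \<and> \<theta> = \<theta>"
        using bspec[OF s(2), of r] False by (simp add: switch_def)
    qed
  qed
qed

lemma motion_on_trajectory:
  assumes m: "motion_on F (playing_states G) I U t0 T u X" and "ereal t0 \<le> T"
    and "continuous_on {t. t0 \<le> t \<and> ereal t \<le> T} X"
    and F: "\<And>t y. t0 \<le> t \<Longrightarrow> ereal t < T \<Longrightarrow> F (u t) t y = dynamics G (\<delta>\<^sub>B t y) (\<delta>\<^sub>R t y)"
  shows "trajectory G \<delta>\<^sub>B \<delta>\<^sub>R t0 (X t0) T X"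
  unfolding trajectory_def
proof (intro conjI allI impI)
  fix t assume "t0 \<le> t \<and> ereal t < T"
  then show "X t \<notin> terminal G"
    "(X has_vector_derivative dynamics G (\<delta>\<^sub>B t (X t)) (\<delta>\<^sub>R t (X t))) (at_right t)"
    using m F playing_not_terminal unfolding motion_on_def by auto
qed (use assms in auto)

lemma trajectory_motion_on:
  assumes tr: "trajectory G \<delta>\<^sub>B \<delta>\<^sub>R t y (ereal s) Y" and "y \<in> playing_states G" "t < s'" "s' \<le> s" "c \<in> U"
    and I: "\<And>r. t \<le> r \<Longrightarrow> r < s' \<Longrightarrow> I r (Y r)"
    and F: "\<And>r z. F c r z = dynamics G (\<delta>\<^sub>B r z) (\<delta>\<^sub>R r z)"
  shows "motion_on F (playing_states G) I U t (ereal s') (\<lambda>_. c) Y"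
  unfolding motion_on_def
proof (intro allI impI conjI)
  fix r assume r: "t \<le> r \<and> ereal r < ereal s'"
  then show "Y r \<in> playing_states G" "I r (Y r)"
    using trajectory_playing[OF tr assms(2)] I assms(4) by auto
  show "continuous_on {t..r} Y" by (rule trajectory_continuous[OF tr]) (use r assms in auto)
  show "(Y has_vector_derivative F c r (Y r)) (at_right r)"
    using tr r assms(4) F by (auto simp: trajectory_def)
qed (use assms in \<open>auto intro: gt_ex\<close>)

text \<open>Red's deviation is assembled by \<open>continuation\<close> from segments with frozen
  red headings against the fixed blue law, and then replayed as an open-loop control.
  \<open>I\<close> is an invariant that red can uphold for a short time by one suitable frozen
  heading pair; \<open>extend\<close> speaks of all motions under that pair because they need not be
  unique.\<close>

lemma red_deviation:
  assumes \<gamma>\<^sub>B: "\<gamma>\<^sub>B \<in> blue_strategies G" and \<gamma>\<^sub>R: "\<gamma>\<^sub>R \<in> red_strategies G"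
    and tr: "trajectory G \<gamma>\<^sub>B \<gamma>\<^sub>R 0 x (ereal t0) X" and start: "X t0 \<in> playing_states G" "I t0 (X t0)"
    and closed: "\<And>Y s t. t0 \<le> t \<Longrightarrow> t < s \<Longrightarrow> continuous_on {t..s} Y \<Longrightarrow>
      (\<And>r. t \<le> r \<Longrightarrow> r < s \<Longrightarrow> Y r \<in> playing_states G \<and> I r (Y r)) \<Longrightarrow> I s (Y s)"
    and extend: "\<And>t y. t0 \<le> t \<Longrightarrow> y \<in> playing_states G \<Longrightarrow> I t y \<Longrightarrow>
      \<exists>\<theta>\<in>headings \<times> headings. \<exists>e>0. \<forall>s Y r. trajectory G \<gamma>\<^sub>B (\<lambda>_ _. \<theta>) t y (ereal s) Y \<longrightarrow>
        t \<le> r \<longrightarrow> r < s \<longrightarrow> r < t + e \<longrightarrow> I r (Y r)"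
  obtains \<gamma>\<^sub>R' T Y where "\<gamma>\<^sub>R' \<in> red_strategies G" "play G \<gamma>\<^sub>B \<gamma>\<^sub>R' x T Y" "ereal t0 < T" "Y t0 = X t0"
    "\<And>t. t0 \<le> t \<Longrightarrow> ereal t < T \<Longrightarrow> I t (Y t)"
    "T \<noteq> \<infinity> \<Longrightarrow> I (real_of_ereal T) (Y (real_of_ereal T))"
proof -
  define F where "F \<theta> t y = dynamics G (\<gamma>\<^sub>B t y) \<theta>" for \<theta> t y
  have t0: "0 \<le> t0" using tr by (simp add: trajectory_def)
  obtain T u Z where T: "ereal t0 < T" and Z0: "Z t0 = X t0"
    and m: "motion_on F (playing_states G) I (headings \<times> headings) t0 T u Z"
    and Zc: "continuous_on {t. t0 \<le> t \<and> ereal t \<le> T} Z"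
    and fin: "T \<noteq> \<infinity> \<Longrightarrow> Z (real_of_ereal T) \<notin> playing_states G \<and> I (real_of_ereal T) (Z (real_of_ereal T))"
  proof (rule continuation[of F "1 + 2 * \<beta>" "X t0" "playing_states G" I t0 "headings \<times> headings"])
    show "norm (F c t y) \<le> 1 + 2 * \<beta>" for c t y unfolding F_def by (rule norm_dynamics)
    show "I s (Y s)" if "t0 \<le> t" "t < s" "continuous_on {t..s} Y" "\<forall>r\<in>{t..<s}. Y r \<in> playing_states G \<and> I r (Y r)"
      for Y s t using closed[OF that(1-3)] that(4) by simp
    fix t y assume *: "t0 \<le> t" "y \<in> playing_states G" "I t y"
    obtain \<theta> e where \<theta>: "\<theta> \<in> headings \<times> headings" "e > 0"
      "\<And>s Y r. trajectory G \<gamma>\<^sub>B (\<lambda>_ _. \<theta>) t y (ereal s) Y \<Longrightarrow> t \<le> r \<Longrightarrow> r < s \<Longrightarrow> r < t + e \<Longrightarrow> I r (Y r)"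
      using extend[OF *] by blast
    obtain s Y where s: "s > t" "trajectory G \<gamma>\<^sub>B (\<lambda>_ _. \<theta>) t y (ereal s) Y"
      using blue_strategyD(2)[OF \<gamma>\<^sub>B order_trans[OF t0 *(1)] *(2) \<theta>(1)] by blast
    have "motion_on F (playing_states G) I (headings \<times> headings) t (ereal (min s (t + e))) (\<lambda>_. \<theta>) Y"
      by (rule trajectory_motion_on[OF s(2) *(2)]) (use s(1) \<theta> \<theta>(3)[OF s(2)] in \<open>auto simp: F_def\<close>)
    moreover have "Y t = y" using s(2) by (simp add: trajectory_def)
    ultimately show "\<exists>c s Y. t < s \<and> Y t = y \<and>
        motion_on F (playing_states G) I (headings \<times> headings) t (ereal s) (\<lambda>_. c) Y"
      using s(1) \<theta>(2) by (intro exI[of _ \<theta>] exI[of _ "min s (t + e)"] exI[of _ Y]) auto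
  qed (use start in auto)
  \<comment> \<open>Outside \<open>[t0, T)\<close> the default heading is zero, which lies in
    \<open>headings\<close>.\<close>
  define v where "v t = (if t0 \<le> t \<and> ereal t < T then u t else (0, 0))" for t
  have v: "right_locally_constant v" "v t \<in> headings \<times> headings" for t
    unfolding v_def using m by (auto simp: motion_on_def headings_def intro!: right_locally_constant_extend)
  have trZ: "trajectory G \<gamma>\<^sub>B (\<lambda>t _. v t) t0 (X t0) T Z"
    unfolding Z0[symmetric] by (rule motion_on_trajectory[OF m less_imp_le[OF T] Zc]) (auto simp: F_def v_def)
  have trY: "trajectory G \<gamma>\<^sub>B (switch t0 \<gamma>\<^sub>R (\<lambda>t _. v t)) 0 x T (switch t0 X Z)"
    using trajectory_append[OF tr trZ] by simp
  show thesis
  proof (rule that[of "switch t0 \<gamma>\<^sub>R (\<lambda>t _. v t)" T "switch t0 X Z"])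
    show "switch t0 \<gamma>\<^sub>R (\<lambda>t _. v t) \<in> red_strategies G" by (rule switch_red_strategy[OF \<gamma>\<^sub>R v])
    show "play G \<gamma>\<^sub>B (switch t0 \<gamma>\<^sub>R (\<lambda>t _. v t)) x T (switch t0 X Z)"
      unfolding play_def
    proof (intro conjI trY impI)
      assume "T \<noteq> \<infinity>"
      then obtain \<tau> where \<tau>: "T = ereal \<tau>" using T by (cases T) auto
      have "Z \<tau> \<in> terminal G"
        by (rule exit_terminal[of t0 \<tau> Z])
          (use m T \<tau> fin trajectory_continuous[OF trZ] in \<open>auto simp: motion_on_def\<close>)
      then show "switch t0 X Z (real_of_ereal T) \<in> terminal G" using T \<tau> by (simp add: switch_def)
    qed
    show "I (real_of_ereal T) (switch t0 X Z (real_of_ereal T))" if "T \<noteq> \<infinity>"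
      using fin[OF that] T that by (cases T) (auto simp: switch_def)
  qed (use T Z0 m in \<open>auto simp: switch_def motion_on_def\<close>)
qed

text \<open>The roles are exchanged: red's law enters the velocity field and blue plays open-loop
  after \<open>t0\<close>.\<close>

lemma blue_deviation:
  assumes \<gamma>\<^sub>B: "\<gamma>\<^sub>B \<in> blue_strategies G" and \<gamma>\<^sub>R: "\<gamma>\<^sub>R \<in> red_strategies G"
    and tr: "trajectory G \<gamma>\<^sub>B \<gamma>\<^sub>R 0 x (ereal t0) X" and start: "X t0 \<in> playing_states G" "I t0 (X t0)"
    and closed: "\<And>Y s t. t0 \<le> t \<Longrightarrow> t < s \<Longrightarrow> continuous_on {t..s} Y \<Longrightarrow>
      (\<And>r. t \<le> r \<Longrightarrow> r < s \<Longrightarrow> Y r \<in> playing_states G \<and> I r (Y r)) \<Longrightarrow> I s (Y s)"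
    and extend: "\<And>t y. t0 \<le> t \<Longrightarrow> y \<in> playing_states G \<Longrightarrow> I t y \<Longrightarrow>
      \<exists>\<theta>\<in>headings. \<exists>e>0. \<forall>s Y r. trajectory G (\<lambda>_ _. \<theta>) \<gamma>\<^sub>R t y (ereal s) Y \<longrightarrow>
        t \<le> r \<longrightarrow> r < s \<longrightarrow> r < t + e \<longrightarrow> I r (Y r)"
  obtains \<gamma>\<^sub>B' T Y where "\<gamma>\<^sub>B' \<in> blue_strategies G" "play G \<gamma>\<^sub>B' \<gamma>\<^sub>R x T Y" "ereal t0 < T" "Y t0 = X t0"
    "\<And>t. t0 \<le> t \<Longrightarrow> ereal t < T \<Longrightarrow> I t (Y t)"
    "T \<noteq> \<infinity> \<Longrightarrow> I (real_of_ereal T) (Y (real_of_ereal T))"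
proof -
  define F where "F \<theta> t y = dynamics G \<theta> (\<gamma>\<^sub>R t y)" for \<theta> t y
  have t0: "0 \<le> t0" using tr by (simp add: trajectory_def)
  obtain T u Z where T: "ereal t0 < T" and Z0: "Z t0 = X t0"
    and m: "motion_on F (playing_states G) I headings t0 T u Z"
    and Zc: "continuous_on {t. t0 \<le> t \<and> ereal t \<le> T} Z"
    and fin: "T \<noteq> \<infinity> \<Longrightarrow> Z (real_of_ereal T) \<notin> playing_states G \<and> I (real_of_ereal T) (Z (real_of_ereal T))"
  proof (rule continuation[of F "1 + 2 * \<beta>" "X t0" "playing_states G" I t0 headings])
    show "norm (F c t y) \<le> 1 + 2 * \<beta>" for c t y unfolding F_def by (rule norm_dynamics)
    show "I s (Y s)" if "t0 \<le> t" "t < s" "continuous_on {t..s} Y" "\<forall>r\<in>{t..<s}. Y r \<in> playing_states G \<and> I r (Y r)"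
      for Y s t using closed[OF that(1-3)] that(4) by simp
    fix t y assume *: "t0 \<le> t" "y \<in> playing_states G" "I t y"
    obtain \<theta> e where \<theta>: "\<theta> \<in> headings" "e > 0"
      "\<And>s Y r. trajectory G (\<lambda>_ _. \<theta>) \<gamma>\<^sub>R t y (ereal s) Y \<Longrightarrow> t \<le> r \<Longrightarrow> r < s \<Longrightarrow> r < t + e \<Longrightarrow> I r (Y r)"
      using extend[OF *] by blast
    obtain s Y where s: "s > t" "trajectory G (\<lambda>_ _. \<theta>) \<gamma>\<^sub>R t y (ereal s) Y"
      using red_strategyD(2)[OF \<gamma>\<^sub>R order_trans[OF t0 *(1)] *(2) \<theta>(1)] by blast
    have "motion_on F (playing_states G) I headings t (ereal (min s (t + e))) (\<lambda>_. \<theta>) Y"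
      by (rule trajectory_motion_on[OF s(2) *(2)]) (use s(1) \<theta> \<theta>(3)[OF s(2)] in \<open>auto simp: F_def\<close>)
    moreover have "Y t = y" using s(2) by (simp add: trajectory_def)
    ultimately show "\<exists>c s Y. t < s \<and> Y t = y \<and> motion_on F (playing_states G) I headings t (ereal s) (\<lambda>_. c) Y"
      using s(1) \<theta>(2) by (intro exI[of _ \<theta>] exI[of _ "min s (t + e)"] exI[of _ Y]) auto
  qed (use start in auto)
  define v where "v t = (if t0 \<le> t \<and> ereal t < T then u t else 0)" for t
  have v: "right_locally_constant v" "v t \<in> headings" for t
    unfolding v_def using m by (auto simp: motion_on_def headings_def intro!: right_locally_constant_extend)
  have trZ: "trajectory G (\<lambda>t _. v t) \<gamma>\<^sub>R t0 (X t0) T Z"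
    unfolding Z0[symmetric] by (rule motion_on_trajectory[OF m less_imp_le[OF T] Zc]) (auto simp: F_def v_def)
  have trY: "trajectory G (switch t0 \<gamma>\<^sub>B (\<lambda>t _. v t)) \<gamma>\<^sub>R 0 x T (switch t0 X Z)"
    using trajectory_append[OF tr trZ] by simp
  show thesis
  proof (rule that[of "switch t0 \<gamma>\<^sub>B (\<lambda>t _. v t)" T "switch t0 X Z"])
    show "switch t0 \<gamma>\<^sub>B (\<lambda>t _. v t) \<in> blue_strategies G" by (rule switch_blue_strategy[OF \<gamma>\<^sub>B v])
    show "play G (switch t0 \<gamma>\<^sub>B (\<lambda>t _. v t)) \<gamma>\<^sub>R x T (switch t0 X Z)"
      unfolding play_def
    proof (intro conjI trY impI)
      assume "T \<noteq> \<infinity>"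
      then obtain \<tau> where \<tau>: "T = ereal \<tau>" using T by (cases T) auto
      have "Z \<tau> \<in> terminal G"
        by (rule exit_terminal[of t0 \<tau> Z])
          (use m T \<tau> fin trajectory_continuous[OF trZ] in \<open>auto simp: motion_on_def\<close>)
      then show "switch t0 X Z (real_of_ereal T) \<in> terminal G" using T \<tau> by (simp add: switch_def)
    qed
    show "I (real_of_ereal T) (switch t0 X Z (real_of_ereal T))" if "T \<noteq> \<infinity>"
      using fin[OF that] T that by (cases T) (auto simp: switch_def)
  qed (use T Z0 m in \<open>auto simp: switch_def motion_on_def\<close>)
qed

end

section \<open>The value of the game\<close>

context bvr
begin

abbreviation "target \<equiv> aim \<beta> \<rho> A"
abbreviation "val \<equiv> game_value \<beta> \<rho> A"

lemma blue_constant_heading: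
  assumes "trajectory G (\<lambda>_ _. \<theta>) \<gamma>\<^sub>R t y (ereal s) Y" "t \<le> r" "r \<le> s"
  shows "blue (Y r) = blue y + (r - t) *\<^sub>R cis \<theta>"
proof -
  have "blue (Y r) = blue (Y t) + (r - t) *\<^sub>R cis \<theta>"
  proof (rule affine_if_right_deriv_const[OF assms(2), of "\<lambda>t. blue (Y t)"])
    show "continuous_on {t..r} (\<lambda>t. blue (Y t))"
      using trajectory_continuous[OF assms(1), of r t] assms(3) by (intro continuous_intros) auto
    show "((\<lambda>t. blue (Y t)) has_vector_derivative cis \<theta>) (at_right r')" if "t \<le> r'" "r' < r" for r'
      using trajectory_deriv(1)[OF assms(1), of r'] that assms(3) by simp
  qed
  then show ?thesis using assms(1) by (simp add: trajectory_def)
qed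

lemma red_constant_heading:
  assumes "trajectory G \<gamma>\<^sub>B (\<lambda>_ _. \<phi>) t y (ereal s) Y" "t \<le> r" "r \<le> s"
  shows "red1 (Y r) = red1 y + (r - t) *\<^sub>R (\<beta> *\<^sub>R cis (fst \<phi>))"
    "red2 (Y r) = red2 y + (r - t) *\<^sub>R (\<beta> *\<^sub>R cis (snd \<phi>))"
proof -
  have c: "continuous_on {t..r} Y"
    using trajectory_continuous[OF assms(1), of r t] assms(3) by simp
  have "red1 (Y r) = red1 (Y t) + (r - t) *\<^sub>R (\<beta> *\<^sub>R cis (fst \<phi>))"
  proof (rule affine_if_right_deriv_const[OF assms(2), of "\<lambda>t. red1 (Y t)"])
    show "((\<lambda>t. red1 (Y t)) has_vector_derivative \<beta> *\<^sub>R cis (fst \<phi>)) (at_right r')" if "t \<le> r'" "r' < r" for r'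
      using trajectory_deriv(2)[OF assms(1), of r'] that assms(3) by simp
  qed (use c in \<open>intro continuous_intros\<close>)
  then show "red1 (Y r) = red1 y + (r - t) *\<^sub>R (\<beta> *\<^sub>R cis (fst \<phi>))"
    using assms(1) by (simp add: trajectory_def)
  have "red2 (Y r) = red2 (Y t) + (r - t) *\<^sub>R (\<beta> *\<^sub>R cis (snd \<phi>))"
  proof (rule affine_if_right_deriv_const[OF assms(2), of "\<lambda>t. red2 (Y t)"])
    show "((\<lambda>t. red2 (Y t)) has_vector_derivative \<beta> *\<^sub>R cis (snd \<phi>)) (at_right r')" if "t \<le> r'" "r' < r" for r'
      using trajectory_deriv(3)[OF assms(1), of r'] that assms(3) by simp
  qed (use c in \<open>intro continuous_intros\<close>)
  then show "red2 (Y r) = red2 y + (r - t) *\<^sub>R (\<beta> *\<^sub>R cis (snd \<phi>))"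
    using assms(1) by (simp add: trajectory_def)
qed

lemma dist_after_heading:
  assumes "q - B = dist B q *\<^sub>R cis \<theta>"
  shows "dist (B + \<delta> *\<^sub>R cis \<theta>) q = \<bar>\<delta> - dist B q\<bar>"
proof -
  have "B + \<delta> *\<^sub>R cis \<theta> - q = (\<delta> - dist B q) *\<^sub>R cis \<theta>"
    using assms by (simp add: algebra_simps)
  then show ?thesis by (simp add: dist_norm)
qed

lemma toward_heading:
  obtains \<theta> where "\<theta> \<in> headings" "q - B = dist B q *\<^sub>R cis \<theta>"
  using heading_exists[of "q - B"] by (metis dist_commute dist_norm)

text \<open>Blue on schedule for \<open>q\<close> is within \<open>t1 - r\<close> of it, while red
  is at least \<open>\<rho> + \<beta> * (t1 - r)\<close> away from \<open>q\<close>. The difference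
  beyond \<open>\<rho>\<close> is \<open>(\<beta> - 1) * (t1 - r)\<close>, positive strictly before
  the arrival time.\<close>

lemma safe_not_blocked_early:
  assumes "q \<in> safe \<beta> \<rho> x" "dist q (blue x) = t1 - t0" "dist B q \<le> t1 - r" "t0 \<le> r" "r < t1"
    and "dist (red1 x) R1 \<le> \<beta> * (r - t0)" "dist (red2 x) R2 \<le> \<beta> * (r - t0)"
  shows "dist B R1 \<noteq> \<rho>" "dist B R2 \<noteq> \<rho>"
proof -
  have "t1 - r + \<beta> * (r - t0) < \<beta> * (t1 - t0)"
    using mult_strict_right_mono[OF \<beta>, of "t1 - r"] assms(5) by (simp add: algebra_simps)
  moreover have "\<rho> + \<beta> * (t1 - t0) \<le> dist q (red1 x)" "\<rho> + \<beta> * (t1 - t0) \<le> dist q (red2 x)"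
    using assms(1,2) by (auto simp: safe_def slack_def)
  moreover have "dist q (red1 x) \<le> dist B q + dist B R1 + dist (red1 x) R1"
    using dist_triangle[of q "red1 x" B] dist_triangle[of B "red1 x" R1] by (simp add: dist_commute)
  moreover have "dist q (red2 x) \<le> dist B q + dist B R2 + dist (red2 x) R2"
    using dist_triangle[of q "red2 x" B] dist_triangle[of B "red2 x" R2] by (simp add: dist_commute)
  ultimately show "dist B R1 \<noteq> \<rho>" "dist B R2 \<noteq> \<rho>" using assms by linarith+
qed

text \<open>Blue can run straight to the target and then straight to the asset.\<close>

lemma value_upper:
  assumes sp: "saddle_point G x \<gamma>\<^sub>B \<gamma>\<^sub>R" and pl: "play G \<gamma>\<^sub>B \<gamma>\<^sub>R x T X" and x: "x \<in> playing_states G"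
    and t0: "0 \<le> t0" "ereal t0 < T"
  shows "payoff G T X \<le> ereal (max \<sigma> (val (X t0)))"
proof -
  have tr: "trajectory G \<gamma>\<^sub>B \<gamma>\<^sub>R 0 x T X" using pl by (simp add: play_def)
  have play0: "X t0 \<in> playing_states G" by (rule trajectory_playing[OF tr x t0])
  define q where "q = target (X t0)"
  define w where "w = val (X t0)"
  define t1 where "t1 = t0 + dist q (blue (X t0))"
  have wq: "dist q A = w" by (simp add: w_def q_def game_value_def dist_commute)
  have t01: "t0 \<le> t1" by (simp add: t1_def)
  have w0: "0 \<le> w" by (simp add: w_def game_value_def)
  \<comment> \<open>A timetable: be at \<open>q\<close> by \<open>t1\<close>, then approach the
    asset at unit speed. Inequalities leave room for being early and survive limits.\<close>
  define I where "I r y \<longleftrightarrow> (r \<le> t1 \<longrightarrow> dist (blue y) q \<le> t1 - r) \<and> (t1 \<le> r \<longrightarrow> dist (blue y) A \<le> w - (r - t1))"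
    for r :: real and y :: state
  obtain \<gamma>\<^sub>B' T' Y where dev: "\<gamma>\<^sub>B' \<in> blue_strategies G" "play G \<gamma>\<^sub>B' \<gamma>\<^sub>R x T' Y" "ereal t0 < T'" "Y t0 = X t0"
    "\<And>t. t0 \<le> t \<Longrightarrow> ereal t < T' \<Longrightarrow> I t (Y t)"
    "T' \<noteq> \<infinity> \<Longrightarrow> I (real_of_ereal T') (Y (real_of_ereal T'))"
  proof (rule blue_deviation[of \<gamma>\<^sub>B \<gamma>\<^sub>R x t0 X I])
    show "\<gamma>\<^sub>B \<in> blue_strategies G" "\<gamma>\<^sub>R \<in> red_strategies G" using sp by (auto simp: saddle_point_def)
    show "trajectory G \<gamma>\<^sub>B \<gamma>\<^sub>R 0 x (ereal t0) X"
      by (rule trajectory_restrict[OF tr]) (use t0 in auto)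
    show "I t0 (X t0)" using wq by (auto simp: I_def t1_def dist_commute)
  next
    fix Y :: "real \<Rightarrow> state" and s t
    assume *: "t0 \<le> t" "t < s" "continuous_on {t..s} Y"
      "\<And>r. t \<le> r \<Longrightarrow> r < s \<Longrightarrow> Y r \<in> playing_states G \<and> I r (Y r)"
    have 1: "dist (blue (Y s)) q \<le> t1 - s" if "s \<le> t1"
    proof -
      have "dist (blue (Y s)) q + s \<le> t1"
        by (rule le_at_right_end[OF *(2), of "\<lambda>r. dist (blue (Y r)) q + r"])
          (use *(3,4) that in \<open>auto intro!: continuous_intros simp: I_def algebra_simps\<close>)
      then show ?thesis by simp
    qed
    have 2: "dist (blue (Y s)) A \<le> w - (s - t1)" if "t1 \<le> s"
    proof (cases "s = t1")
      case True
      then have "blue (Y s) = q" using 1 by simp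
      then show ?thesis using True wq by simp
    next
      case False
      let ?a = "max t t1"
      have "dist (blue (Y s)) A + s \<le> w + t1"
      proof (rule le_at_right_end[of ?a s "\<lambda>r. dist (blue (Y r)) A + r"])
        show "?a < s" using False that * by simp
        have "continuous_on {?a..s} Y" by (rule continuous_on_subset[OF *(3)]) auto
        then show "continuous_on {?a..s} (\<lambda>r. dist (blue (Y r)) A + r)" by (intro continuous_intros)
        show "dist (blue (Y r)) A + r \<le> w + t1" if "?a \<le> r" "r < s" for r
          using *(4)[of r] that by (simp add: I_def)
      qed
      then show ?thesis by simp
    qed
    show "I s (Y s)" using 1 2 by (simp add: I_def)
  next
    fix t y assume *: "t0 \<le> t" "y \<in> playing_states G" "I t y"
    show "\<exists>\<theta>\<in>headings. \<exists>e>0. \<forall>s Y r. trajectory G (\<lambda>_ _. \<theta>) \<gamma>\<^sub>R t y (ereal s) Y \<longrightarrow>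
        t \<le> r \<longrightarrow> r < s \<longrightarrow> r < t + e \<longrightarrow> I r (Y r)"
    proof (cases "t < t1")
      case True
      obtain \<theta> where \<theta>: "\<theta> \<in> headings" "q - blue y = dist (blue y) q *\<^sub>R cis \<theta>" by (rule toward_heading)
      \<comment> \<open>Blue may be ahead of schedule and overshoot \<open>q\<close>. Half of the
        remaining time is a safe step, since the overshoot then does not exceed the time
        left.\<close>
      have d: "dist (blue y) q \<le> t1 - t" using *(3) True by (simp add: I_def)
      show ?thesis
      proof (intro bexI[OF _ \<theta>(1)] exI[of _ "(t1 - t) / 2"] conjI allI impI)
        fix s Y r assume tY: "trajectory G (\<lambda>_ _. \<theta>) \<gamma>\<^sub>R t y (ereal s) Y" and r: "t \<le> r" "r < s" "r < t + (t1 - t) / 2"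
        have "dist (blue (Y r)) q = \<bar>(r - t) - dist (blue y) q\<bar>"
          unfolding blue_constant_heading[OF tY r(1) less_imp_le[OF r(2)]] by (rule dist_after_heading[OF \<theta>(2)])
        also have "\<dots> \<le> t1 - r"
        proof -
          have "2 * r < t1 + t" using r(3) by (simp add: field_simps)
          then show ?thesis using d zero_le_dist[of "blue y" q] unfolding abs_le_iff by linarith
        qed
        finally show "I r (Y r)" using r(3) True by (simp add: I_def field_simps)
      qed (use True in simp)
    next
      case False
      obtain \<theta> where \<theta>: "\<theta> \<in> headings" "A - blue y = dist (blue y) A *\<^sub>R cis \<theta>" by (rule toward_heading)
      have d: "dist (blue y) A \<le> w - (t - t1)" using *(3) False by (simp add: I_def)
      show ?thesis
      proof (intro bexI[OF _ \<theta>(1)] exI[of _ "dist (blue y) A"] conjI allI impI)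
        show "0 < dist (blue y) A" using *(2) \<sigma> by (auto simp: playing_iff)
        fix s Y r assume tY: "trajectory G (\<lambda>_ _. \<theta>) \<gamma>\<^sub>R t y (ereal s) Y" and r: "t \<le> r" "r < s" "r < t + dist (blue y) A"
        have "dist (blue (Y r)) A = \<bar>(r - t) - dist (blue y) A\<bar>"
          unfolding blue_constant_heading[OF tY r(1) less_imp_le[OF r(2)]] by (rule dist_after_heading[OF \<theta>(2)])
        also have "\<dots> \<le> w - (r - t1)" using d r by simp
        finally have a: "dist (blue (Y r)) A \<le> w - (r - t1)" .
        have "r = t \<and> t = t1" if "r \<le> t1" using that r(1) False by simp
        then have "dist (blue (Y r)) q \<le> t1 - r" if "r \<le> t1"
          using that tY *(3) by (auto simp: trajectory_def I_def)
        then show "I r (Y r)" using a by (simp add: I_def)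
      qed
    qed
  qed (use play0 in auto)
  have trY: "trajectory G \<gamma>\<^sub>B' \<gamma>\<^sub>R 0 x T' Y" using dev(2) by (simp add: play_def)
  have "T' \<noteq> \<infinity>"
  proof
    assume "T' = \<infinity>"
    then have "I (t1 + w + 1) (Y (t1 + w + 1))" using t01 w0 by (intro dev(5)) auto
    then have "dist (blue (Y (t1 + w + 1))) A \<le> - 1" using w0 by (simp add: I_def)
    then show False using zero_le_dist[of "blue (Y (t1 + w + 1))" A] by linarith
  qed
  then obtain \<tau> where \<tau>: "T' = ereal \<tau>" using dev(3) by (cases T') auto
  have I: "I \<tau> (Y \<tau>)" using dev(6) \<tau> by simp
  have "Y \<tau> \<in> terminal G" using dev(2) \<tau> by (simp add: play_def)
  \<comment> \<open>Before \<open>t1\<close> only the asset's zone can stop blue, at distance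
    \<open>\<sigma>\<close>. From \<open>t1\<close> on the timetable bounds the distance by
    \<open>w\<close>, whatever ends the play.\<close>
  moreover have "dist (blue (Y \<tau>)) (red1 (Y \<tau>)) \<noteq> \<rho> \<and> dist (blue (Y \<tau>)) (red2 (Y \<tau>)) \<noteq> \<rho>" if "\<tau> < t1"
  proof -
    have L: "dist (red1 (X t0)) (red1 (Y \<tau>)) \<le> \<beta> * (\<tau> - t0)" "dist (red2 (X t0)) (red2 (Y \<tau>)) \<le> \<beta> * (\<tau> - t0)"
      using trajectory_lipschitz(2,3)[OF trY t0(1), of \<tau>] dev(3,4) \<tau> by auto
    have "q \<in> safe \<beta> \<rho> (X t0)"
      unfolding q_def by (rule aim_in_safe[OF playing_blue_in_safe[OF play0]])
    from safe_not_blocked_early[OF this _ _ _ that L] show ?thesis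
      using I that dev(3) \<tau> by (auto simp: I_def t1_def)
  qed
  ultimately have "dist (blue (Y \<tau>)) A \<le> max \<sigma> w"
    using I by (cases "\<tau> < t1") (auto simp: terminal_iff I_def)
  moreover have "payoff G T X \<le> payoff G T' Y"
    using sp pl dev(1,2) unfolding saddle_point_def by blast
  moreover have "payoff G T' Y = ereal (dist (blue (Y \<tau>)) A)" using \<tau> by (simp add: payoff_def G)
  ultimately show ?thesis unfolding w_def by (metis ereal_less_eq(3) order_trans)
qed

text \<open>The limit state may be terminal, but the weak separation bounds keep blue in its safe
  set, so the Lipschitz estimate still applies. This is the closedness needed for an invariant
  bounding the value from below.\<close>

lemma game_value_limit:
  fixes a b :: real
  assumes "a < b" "continuous_on {a..b} Y" "continuous_on {a..b} f"
    and "\<And>t. a \<le> t \<Longrightarrow> t < b \<Longrightarrow> Y t \<in> playing_states G \<and> f t \<le> val (Y t)"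
  shows "f b \<le> val (Y b)"
proof -
  define K where "K = 2 * \<beta> / (\<beta> - 1)"
  have Yb: "blue (Y b) \<in> safe \<beta> \<rho> (Y b)"
    using playing_limit(2,3)[OF assms(2,1)] assms(4) by (auto simp: blue_in_safe)
  have "f b - K * dist (Y b) (Y b) \<le> val (Y b)"
  proof (rule le_at_right_end[OF assms(1), of "\<lambda>t. f t - K * dist (Y t) (Y b)"])
    show "continuous_on {a..b} (\<lambda>t. f t - K * dist (Y t) (Y b))"
      using assms(2,3) by (intro continuous_intros)
    fix t assume t: "a \<le> t" "t < b"
    have 1: "dist (Y t) (Y b) \<le> \<beta> * dist (Y t) (Y b)"
      using mult_right_mono[of 1 \<beta> "dist (Y t) (Y b)"] \<beta> by simp
    have "val (Y t) \<le> val (Y b) + 2 * \<beta> * dist (Y t) (Y b) / (\<beta> - 1)"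
    proof (rule game_value_lipschitz[OF \<beta> _ Yb])
      show "blue (Y t) \<in> safe \<beta> \<rho> (Y t)" using assms(4)[OF t] playing_blue_in_safe by blast
      show "dist (blue (Y t)) (blue (Y b)) \<le> dist (Y t) (Y b)" by (rule dist_fst_le)
      show "dist (red1 (Y t)) (red1 (Y b)) \<le> \<beta> * dist (Y t) (Y b)"
        using dist_fst_le[of "snd (Y t)" "snd (Y b)"] dist_snd_le[of "Y t" "Y b"] 1 by linarith
      show "dist (red2 (Y t)) (red2 (Y b)) \<le> \<beta> * dist (Y t) (Y b)"
        using dist_snd_le[of "snd (Y t)" "snd (Y b)"] dist_snd_le[of "Y t" "Y b"] 1 by linarith
    qed
    then show "f t - K * dist (Y t) (Y b) \<le> val (Y b)" using assms(4)[OF t] by (simp add: K_def)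
  qed
  then show ?thesis by simp
qed

lemma target_ne_blue:
  assumes "y \<in> playing_states G" "val y > 0"
  shows "0 < dist (target y) (blue y)"
proof -
  have "0 < (1 + \<beta>) * dist (target y) (blue y)"
    using aim_dist_lower[of \<beta> \<rho> y A] assms \<beta> by (auto simp: playing_iff)
  then show ?thesis using \<beta> by (simp add: zero_less_mult_iff)
qed

text \<open>The target is safe, hence at least \<open>\<rho>\<close> away from both interceptors,
  and the directions to it are well defined. Freezing them realises \<open>red_step\<close> against
  every blue law.\<close>

lemma red_toward_target:
  assumes "y \<in> playing_states G"
  obtains \<phi> where "\<phi> \<in> headings \<times> headings"
    "\<And>\<gamma>\<^sub>B t s Y r. trajectory G \<gamma>\<^sub>B (\<lambda>_ _. \<phi>) t y (ereal s) Y \<Longrightarrow> t \<le> r \<Longrightarrow> r \<le> s \<Longrightarrow>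
       Y r = red_step \<beta> (target y) y (r - t) (blue (Y r)) \<and> dist (blue y) (blue (Y r)) \<le> r - t"
proof -
  obtain \<phi>1 where \<phi>1: "\<phi>1 \<in> headings" "target y - red1 y = dist (red1 y) (target y) *\<^sub>R cis \<phi>1" by (rule toward_heading)
  obtain \<phi>2 where \<phi>2: "\<phi>2 \<in> headings" "target y - red2 y = dist (red2 y) (target y) *\<^sub>R cis \<phi>2" by (rule toward_heading)
  have s: "target y \<in> safe \<beta> \<rho> y" by (rule aim_in_safe[OF playing_blue_in_safe[OF assms]])
  have nn: "0 \<le> \<beta> * dist (target y) (blue y)" using \<beta> by simp
  have "0 < dist (red1 y) (target y)" "0 < dist (red2 y) (target y)"
    using s nn \<rho> by (auto simp: safe_def slack_def dist_commute)
  then have sg: "sgn (target y - red1 y) = cis \<phi>1" "sgn (target y - red2 y) = cis \<phi>2"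
    unfolding \<phi>1(2) \<phi>2(2) by (simp_all add: sgn_scaleR sgn_div_norm)
  show thesis
  proof (rule that[of "(\<phi>1, \<phi>2)"])
    show "(\<phi>1, \<phi>2) \<in> headings \<times> headings" using \<phi>1 \<phi>2 by simp
    fix \<gamma>\<^sub>B t s Y r assume tY: "trajectory G \<gamma>\<^sub>B (\<lambda>_ _. (\<phi>1, \<phi>2)) t y (ereal s) Y" and r: "t \<le> r" "r \<le> s"
    have "dist (blue (Y t)) (blue (Y r)) \<le> r - t"
      by (rule trajectory_lipschitz(1)[OF tY]) (use r in auto)
    then show "Y r = red_step \<beta> (target y) y (r - t) (blue (Y r)) \<and> dist (blue y) (blue (Y r)) \<le> r - t"
      using red_constant_heading[OF tY r] tY unfolding red_step_def sg
      by (auto simp: prod_eq_iff trajectory_def mult.commute)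
  qed
qed

text \<open>Red can keep the value from dropping by repeatedly running straight at the current target.
  The loss over a step of length \<open>\<delta>\<close> is of order \<open>\<delta>\<^sup>2\<close>, hence below any positive rate.\<close>

lemma value_lower:
  assumes sp: "saddle_point G x \<gamma>\<^sub>B \<gamma>\<^sub>R" and pl: "play G \<gamma>\<^sub>B \<gamma>\<^sub>R x T X"
    and \<gamma>: "\<gamma> \<in> red_strategies G" and tr: "trajectory G \<gamma>\<^sub>B \<gamma> 0 x (ereal t0) Z"
    and Z: "Z t0 \<in> playing_states G" "0 < val (Z t0)"
  shows "ereal (val (Z t0)) \<le> payoff G T X"
proof (cases "payoff G T X")
  case (real v)
  have "val (Z t0) \<le> v + e" if e: "0 < e" "e < val (Z t0)" for e
  proof -
    define w where "w = val (Z t0)"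
    \<comment> \<open>A loss budget for unlimited time: \<open>\<phi>\<close> starts at 0, stays
      below 1 and always grows at a positive rate. The total loss is thus below \<open>e\<close>,
      yet every sufficiently short quadratic loss is affordable.\<close>
    define \<phi> where "\<phi> r = 1 - 1 / (1 + (r - t0))" for r
    define I where "I r y \<longleftrightarrow> w - e * \<phi> r \<le> val y" for r and y :: state
    have \<gamma>\<^sub>B: "\<gamma>\<^sub>B \<in> blue_strategies G" using sp by (simp add: saddle_point_def)
    have \<phi>1: "\<phi> r \<le> 1" "0 \<le> \<phi> r" if "t0 \<le> r" for r using that by (auto simp: \<phi>_def)
    have low: "0 < val y" if "I r y" "t0 \<le> r" for r y
      using that mult_left_mono[OF \<phi>1(1)[OF that(2)], of e] e unfolding I_def w_def by linarith
    obtain \<gamma>\<^sub>R' T' Y where dev: "\<gamma>\<^sub>R' \<in> red_strategies G" "play G \<gamma>\<^sub>B \<gamma>\<^sub>R' x T' Y" "ereal t0 < T'" "Y t0 = Z t0"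
      "\<And>t. t0 \<le> t \<Longrightarrow> ereal t < T' \<Longrightarrow> I t (Y t)"
      "T' \<noteq> \<infinity> \<Longrightarrow> I (real_of_ereal T') (Y (real_of_ereal T'))"
    proof (rule red_deviation[OF \<gamma>\<^sub>B \<gamma> tr Z(1), of I])
      show "I t0 (Z t0)" by (simp add: I_def \<phi>_def w_def)
    next
      fix Y :: "real \<Rightarrow> state" and s t
      assume *: "t0 \<le> t" "t < s" "continuous_on {t..s} Y"
        "\<And>r. t \<le> r \<Longrightarrow> r < s \<Longrightarrow> Y r \<in> playing_states G \<and> I r (Y r)"
      have "continuous_on {t..s} (\<lambda>r. w - e * \<phi> r)"
        unfolding \<phi>_def using *(1) by (intro continuous_intros) auto
      then show "I s (Y s)"
        unfolding I_def by (rule game_value_limit[OF *(2,3)]) (use *(4) in \<open>auto simp: I_def\<close>)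
    next
      fix t y assume *: "t0 \<le> t" "y \<in> playing_states G" "I t y"
      have vy: "0 < val y" by (rule low[OF *(3,1)])
      obtain \<theta> where \<theta>: "\<theta> \<in> headings \<times> headings"
        "\<And>\<gamma>\<^sub>B t s Y r. trajectory G \<gamma>\<^sub>B (\<lambda>_ _. \<theta>) t y (ereal s) Y \<Longrightarrow> t \<le> r \<Longrightarrow> r \<le> s \<Longrightarrow>
           Y r = red_step \<beta> (target y) y (r - t) (blue (Y r)) \<and> dist (blue y) (blue (Y r)) \<le> r - t"
        using red_toward_target[OF *(2)] by blast
      obtain C where C: "0 \<le> C" "\<And>\<delta> B'. \<lbrakk>0 \<le> \<delta>; \<delta> < dist (target y) (blue y); dist (blue y) B' \<le> \<delta>;
          B' \<in> safe \<beta> \<rho> (red_step \<beta> (target y) y \<delta> B')\<rbrakk> \<Longrightarrow>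
          val y - C * \<delta>\<^sup>2 \<le> val (red_step \<beta> (target y) y \<delta> B')"
        using game_value_red_step[OF \<beta> \<rho> playing_blue_in_safe[OF *(2)], of A] by blast
      \<comment> \<open>For steps of length at most 1, \<open>D\<close> bounds the denominator in
        \<open>\<phi> r - \<phi> t\<close>, so that this increment is at least
        \<open>\<delta> / D\<close>.\<close>
      define D where "D = (2 + (t - t0)) * (1 + (t - t0))"
      have D: "0 < D" using *(1) by (simp add: D_def)
      \<comment> \<open>The three caps serve the bound \<open>D\<close>, the range of the step
        estimate, and \<open>C * \<delta>^2 \<le> e * (\<delta> / D)\<close>. Using
        \<open>C + 1\<close> avoids division by zero.\<close>
      define \<epsilon> where "\<epsilon> = Min {1, dist (target y) (blue y), e / (D * (C + 1))}"
      have \<epsilon>: "0 < \<epsilon>" "\<epsilon> \<le> 1" "\<epsilon> \<le> dist (target y) (blue y)" "\<epsilon> \<le> e / (D * (C + 1))"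
        using target_ne_blue[OF *(2) vy] e D C(1) by (auto simp: \<epsilon>_def)
      show "\<exists>\<theta>\<in>headings \<times> headings. \<exists>e>0. \<forall>s Y r. trajectory G \<gamma>\<^sub>B (\<lambda>_ _. \<theta>) t y (ereal s) Y \<longrightarrow>
          t \<le> r \<longrightarrow> r < s \<longrightarrow> r < t + e \<longrightarrow> I r (Y r)"
      proof (intro bexI[OF _ \<theta>(1)] exI[of _ \<epsilon>] conjI allI impI \<epsilon>(1))
        fix s Y r assume tY: "trajectory G \<gamma>\<^sub>B (\<lambda>_ _. \<theta>) t y (ereal s) Y" and r: "t \<le> r" "r < s" "r < t + \<epsilon>"
        define \<delta> where "\<delta> = r - t"
        have Yr: "Y r = red_step \<beta> (target y) y \<delta> (blue (Y r))" "dist (blue y) (blue (Y r)) \<le> \<delta>"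
          using \<theta>(2)[OF tY r(1)] r(2) by (auto simp: \<delta>_def)
        have \<delta>: "0 \<le> \<delta>" "\<delta> < dist (target y) (blue y)" "\<delta> \<le> 1" "\<delta> \<le> e / (D * (C + 1))"
          using r \<epsilon> by (auto simp: \<delta>_def)
        have "Y r \<in> playing_states G" by (rule trajectory_playing[OF tY *(2)]) (use r in auto)
        then have "blue (Y r) \<in> safe \<beta> \<rho> (red_step \<beta> (target y) y \<delta> (blue (Y r)))"
          using playing_blue_in_safe Yr(1) by metis
        from C(2)[OF \<delta>(1,2) Yr(2) this] have v: "val y - C * \<delta>\<^sup>2 \<le> val (Y r)"
          using Yr(1) by simp
        have "\<phi> r - \<phi> t = \<delta> / ((1 + (r - t0)) * (1 + (t - t0)))"
          using r *(1) by (simp add: \<phi>_def \<delta>_def divide_simps) (simp add: algebra_simps)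
        also have "\<dots> \<ge> \<delta> / D"
          unfolding D_def using \<delta>(1,3) *(1) r(1)
          by (intro divide_left_mono mult_right_mono mult_pos_pos) (auto simp: \<delta>_def)
        finally have "e * (\<delta> / D) \<le> e * (\<phi> r - \<phi> t)" using e by (intro mult_left_mono) auto
        moreover have "C * \<delta>\<^sup>2 \<le> e * (\<delta> / D)"
        proof -
          have "\<delta> * (D * (C + 1)) \<le> e" using \<delta>(4) D C(1) by (simp add: pos_le_divide_eq)
          moreover have "\<delta> * D * C \<le> \<delta> * (D * (C + 1))" using \<delta>(1) D by (simp add: algebra_simps)
          ultimately have "\<delta> * D * C \<le> e" by linarith
          then have "\<delta> * C \<le> e / D" using D by (simp add: pos_le_divide_eq mult_ac)
          then have "\<delta> * (\<delta> * C) \<le> \<delta> * (e / D)" using \<delta>(1) by (intro mult_left_mono)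
          then show ?thesis by (simp add: power2_eq_square mult_ac)
        qed
        ultimately have "C * \<delta>\<^sup>2 \<le> e * \<phi> r - e * \<phi> t" by (simp add: algebra_simps)
        then show "I r (Y r)" using v *(3) unfolding I_def by linarith
      qed
    qed (rule that)
    have "payoff G T' Y \<le> ereal v"
      using sp pl dev(1,2) unfolding saddle_point_def real[symmetric] by blast
    then have "T' \<noteq> \<infinity>" by (auto simp: payoff_def)
    then obtain \<tau> where \<tau>: "T' = ereal \<tau>" using dev(3) by (cases T') auto
    have trY: "trajectory G \<gamma>\<^sub>B \<gamma>\<^sub>R' 0 x (ereal \<tau>) Y" using dev(2) \<tau> by (simp add: play_def)
    have t0\<tau>: "t0 < \<tau>" using dev(3) \<tau> by simp
    have t0: "0 \<le> t0" using tr by (simp add: trajectory_def)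
    have "Y r \<notin> terminal G" if "0 \<le> r" "r < \<tau>" for r using trY that by (simp add: trajectory_def)
    then have "Y r \<in> playing_states G" if "t0 \<le> r" "r < \<tau>" for r
      using that t0 dev(4) Z(1) trajectory_continuous[OF trY, of r t0] by (intro stays_playing[of t0 r Y]) auto
    \<comment> \<open>At the end blue's own position is safe, so the value is at most the distance
      that is paid.\<close>
    then have "blue (Y \<tau>) \<in> safe \<beta> \<rho> (Y \<tau>)"
      using playing_limit(2,3)[OF trajectory_continuous[OF trY _ t0] t0\<tau>] by (simp add: blue_in_safe)
    then have "val (Y \<tau>) \<le> dist (blue (Y \<tau>)) A"
      using game_value_le[of "blue (Y \<tau>)"] by (simp add: dist_commute)
    moreover have "w - e * \<phi> \<tau> \<le> val (Y \<tau>)" using dev(6) \<tau> by (simp add: I_def)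
    moreover have "e * \<phi> \<tau> \<le> e * 1" using \<phi>1(1)[of \<tau>] t0\<tau> e by (intro mult_left_mono) auto
    moreover have "dist (blue (Y \<tau>)) A \<le> v"
      using \<open>payoff G T' Y \<le> ereal v\<close> \<tau> by (simp add: payoff_def G)
    ultimately show ?thesis unfolding w_def by linarith
  qed
  then have "val (Z t0) \<le> v + e" if "0 < e" for e
    using that Z(2) by (cases "e < val (Z t0)") (force, smt (verit) dense)
  then show ?thesis unfolding real by (auto intro: field_le_epsilon)
next
  case MInf
  then show ?thesis by (auto simp: payoff_def split: if_splits)
qed simp

end

section \<open>First-order gain for red when blue does not head for the target\<close>

lemma right_difference_quotient:
  fixes f :: "real \<Rightarrow> 'a::real_normed_vector"
  assumes "(f has_vector_derivative D) (at_right t)"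
  shows "((\<lambda>r. (f r - f t) /\<^sub>R (r - t)) \<longlongrightarrow> D) (at_right t)"
proof -
  have "((\<lambda>r. (1 / norm (r - t)) *\<^sub>R (f r - (f t + (r - t) *\<^sub>R D))) \<longlongrightarrow> 0) (at_right t)"
    using assms by (simp add: has_vector_derivative_def has_derivative_within)
  moreover have "\<forall>\<^sub>F r in at_right t. (1 / norm (r - t)) *\<^sub>R (f r - (f t + (r - t) *\<^sub>R D))
      = (f r - f t) /\<^sub>R (r - t) - D"
    by (rule eventually_at_rightI[of t "t + 1"]) (auto simp: scaleR_diff_right scaleR_add_right inverse_eq_divide)
  ultimately have "((\<lambda>r. (f r - f t) /\<^sub>R (r - t) - D) \<longlongrightarrow> 0) (at_right t)"
    by (rule Lim_transform_eventually)
  then show ?thesis by (simp add: LIM_zero_iff)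
qed

lemma dist_right_deriv:
  fixes f :: "real \<Rightarrow> 'a::real_inner"
  assumes "(f has_vector_derivative D) (at_right t)" "f t \<noteq> q"
  shows "((\<lambda>t. dist q (f t)) has_real_derivative - inner (sgn (q - f t)) D) (at_right t)"
proof -
  have 1: "((\<lambda>t. q - f t) has_derivative (\<lambda>h. h *\<^sub>R (- D))) (at_right t)"
    using assms(1) unfolding has_vector_derivative_def by (auto intro!: derivative_eq_intros)
  have 2: "(norm has_derivative (\<lambda>h. inner h (sgn (q - f t)))) (at (q - f t))"
    by (rule has_derivative_norm) (use assms(2) in simp)
  have "((\<lambda>t. norm (q - f t)) has_derivative (\<lambda>h. inner (h *\<^sub>R (- D)) (sgn (q - f t)))) (at_right t)"
    by (rule has_derivative_compose[OF 1 2])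
  then show ?thesis
    unfolding has_field_derivative_def dist_norm
    by (rule has_derivative_eq_rhs) (auto simp: inner_commute mult.commute)
qed

lemma eq_if_inner_ge_1:
  fixes a b :: "'a::real_inner"
  assumes "norm a = 1" "norm b = 1" "1 \<le> inner a b"
  shows "a = b"
proof -
  have "(norm (a - b))\<^sup>2 = (norm a)\<^sup>2 + (norm b)\<^sup>2 - 2 * inner a b"
    unfolding power2_norm_eq_inner by (simp add: inner_diff_left inner_diff_right inner_commute)
  then have "(norm (a - b))\<^sup>2 \<le> 0" using assms by simp
  then show ?thesis by simp
qed

text \<open>If the value never rose, the new targets \<open>p r\<close> would converge to
  \<open>q\<close>. Blue's velocity has component less than 1 towards \<open>q\<close>, hence its
  detour relative to \<open>p r\<close> is of order \<open>r - t\<close> and beats the quadratic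
  error. Then \<open>p r\<close> is strictly slack in the old state, so it lies farther from the
  asset than the old value, a contradiction.\<close>

lemma red_step_gain:
  assumes \<beta>: "\<beta> > 1" and "\<rho> > 0" and x: "blue x \<in> safe \<beta> \<rho> x" and W: "0 < game_value \<beta> \<rho> A x"
    and q: "q = aim \<beta> \<rho> A x" "0 < dist q (blue x)"
    and v: "((\<lambda>r. (Bp r - blue x) /\<^sub>R (r - t)) \<longlongrightarrow> v) (at_right t)"
    and vq: "inner (sgn (q - blue x)) v < 1" and s: "t < s"
    and Bp: "\<And>r. t < r \<Longrightarrow> r < s \<Longrightarrow> dist (blue x) (Bp r) \<le> r - t \<and> Bp r \<in> safe \<beta> \<rho> (red_step \<beta> q x (r - t) (Bp r))"
  shows "\<exists>r. t < r \<and> r < s \<and> game_value \<beta> \<rho> A x < game_value \<beta> \<rho> A (red_step \<beta> q x (r - t) (Bp r))"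
proof (rule ccontr)
  assume "\<not> ?thesis"
  then have le: "game_value \<beta> \<rho> A (red_step \<beta> q x (r - t) (Bp r)) \<le> game_value \<beta> \<rho> A x" if "t < r" "r < s" for r
    using that by force
  define s' where "s' = min s (t + dist q (blue x))"
  have s': "t < s'" using s q(2) by (simp add: s'_def)
  define p where "p r = aim \<beta> \<rho> A (red_step \<beta> q x (r - t) (Bp r))" for r
  obtain C M where C: "0 \<le> C" "0 \<le> M"
    "\<And>\<delta> B' p. \<lbrakk>0 \<le> \<delta>; \<delta> < dist q (blue x); dist (blue x) B' \<le> \<delta>;
        p \<in> safe \<beta> \<rho> (red_step \<beta> q x \<delta> B'); dist A p \<le> game_value \<beta> \<rho> A x\<rbrakk> \<Longrightarrow>
      (dist p q)\<^sup>2 \<le> M * \<delta> \<and>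
      \<beta> * (\<delta> + dist p B' - dist p (blue x)) - C * \<delta>\<^sup>2 \<le> slack \<beta> \<rho> (blue x) (red1 x) p \<and>
      \<beta> * (\<delta> + dist p B' - dist p (blue x)) - C * \<delta>\<^sup>2 \<le> slack \<beta> \<rho> (blue x) (red2 x) p"
    unfolding q(1) using red_step_slack[OF \<beta> assms(2) x, of A] by blast
  have dA: "dist A (p r) \<le> game_value \<beta> \<rho> A x" if "t < r" "r < s'" for r
    using le[of r] that by (simp add: s'_def game_value_def p_def)
  have p: "(dist (p r) q)\<^sup>2 \<le> M * (r - t) \<and>
      \<beta> * ((r - t) + dist (p r) (Bp r) - dist (p r) (blue x)) - C * (r - t)\<^sup>2 \<le> slack \<beta> \<rho> (blue x) (red1 x) (p r) \<and>
      \<beta> * ((r - t) + dist (p r) (Bp r) - dist (p r) (blue x)) - C * (r - t)\<^sup>2 \<le> slack \<beta> \<rho> (blue x) (red2 x) (p r)"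
    if r: "t < r" "r < s'" for r
  proof (rule C(3))
    show "p r \<in> safe \<beta> \<rho> (red_step \<beta> q x (r - t) (Bp r))"
      unfolding p_def by (rule aim_in_safe) (use Bp[of r] r in \<open>simp add: red_step_def s'_def\<close>)
  qed (use r Bp[of r] dA in \<open>auto simp: s'_def\<close>)
  have near: "\<forall>\<^sub>F r in at_right t. t < r \<and> r < s'"
    by (rule eventually_at_rightI[OF _ s']) auto
  have "((\<lambda>r. (dist (p r) q)\<^sup>2) \<longlongrightarrow> 0) (at_right t)"
  proof (rule tendsto_sandwich[where f = "\<lambda>_. 0" and h = "\<lambda>r. M * (r - t)"])
    show "\<forall>\<^sub>F r in at_right t. (dist (p r) q)\<^sup>2 \<le> M * (r - t)"
      using near by eventually_elim (use p in blast)
    have "((\<lambda>r. M * (r - t)) \<longlongrightarrow> M * (t - t)) (at_right t)" by (intro tendsto_intros)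
    then show "((\<lambda>r. M * (r - t)) \<longlongrightarrow> 0) (at_right t)" by simp
  qed simp_all
  then have "((\<lambda>r. dist (p r) q) \<longlongrightarrow> 0) (at_right t)"
    using tendsto_real_sqrt[of "\<lambda>r. (dist (p r) q)\<^sup>2" 0 "at_right t"] by simp
  then have pq: "(p \<longlongrightarrow> q) (at_right t)" by (rule tendsto_dist_iff[THEN iffD2])
  have "((\<lambda>r. inner (sgn (p r - blue x)) ((Bp r - blue x) /\<^sub>R (r - t))) \<longlongrightarrow> inner (sgn (q - blue x)) v) (at_right t)"
    using pq v q(2) by (intro tendsto_intros) auto
  moreover have "((\<lambda>r. 1 - C * (r - t) / \<beta>) \<longlongrightarrow> 1 - C * (t - t) / \<beta>) (at_right t)"
    using \<beta> by (intro tendsto_intros) auto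
  ultimately have "((\<lambda>r. (1 - C * (r - t) / \<beta>) - inner (sgn (p r - blue x)) ((Bp r - blue x) /\<^sub>R (r - t)))
      \<longlongrightarrow> 1 - inner (sgn (q - blue x)) v) (at_right t)"
    by (auto intro: tendsto_diff)
  then have "\<forall>\<^sub>F r in at_right t. 0 < (1 - C * (r - t) / \<beta>) - inner (sgn (p r - blue x)) ((Bp r - blue x) /\<^sub>R (r - t))"
    by (rule order_tendstoD) (use vq in simp)
  from eventually_happens'[OF trivial_limit_at_right_real eventually_conj[OF near this]]
  obtain r where r: "t < r" "r < s'"
    and g: "0 < (1 - C * (r - t) / \<beta>) - inner (sgn (p r - blue x)) ((Bp r - blue x) /\<^sub>R (r - t))"
    by blast
  have "inner (sgn (p r - blue x)) (Bp r - blue x) = (r - t) * inner (sgn (p r - blue x)) ((Bp r - blue x) /\<^sub>R (r - t))"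
    using r by simp
  moreover have "(r - t) * inner (sgn (p r - blue x)) ((Bp r - blue x) /\<^sub>R (r - t)) < (r - t) * (1 - C * (r - t) / \<beta>)"
    using r g by (intro mult_strict_left_mono) auto
  \<comment> \<open>The subgradient inequality at \<open>p r - blue x\<close> turns the bound on
    blue's velocity into a bound on its actual progress towards \<open>p r\<close>.\<close>
  moreover have "dist (p r) (blue x) - inner (sgn (p r - blue x)) (Bp r - blue x) \<le> dist (p r) (Bp r)"
    using inner_sgn_le_norm_diff[of "p r - blue x" "p r - Bp r"] by (simp add: dist_norm inner_diff_right)
  ultimately have "(r - t) * (C * (r - t) / \<beta>) < (r - t) + dist (p r) (Bp r) - dist (p r) (blue x)"
    by (simp add: algebra_simps)
  then have "\<beta> * ((r - t) * (C * (r - t) / \<beta>)) < \<beta> * ((r - t) + dist (p r) (Bp r) - dist (p r) (blue x))"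
    using \<beta> by (intro mult_strict_left_mono) auto
  moreover have "\<beta> * ((r - t) * (C * (r - t) / \<beta>)) = C * (r - t)\<^sup>2" using \<beta> by (simp add: power2_eq_square)
  ultimately have sl: "0 < slack \<beta> \<rho> (blue x) (red1 x) (p r)" "0 < slack \<beta> \<rho> (blue x) (red2 x) (p r)"
    using p[OF r] by auto
  \<comment> \<open>The asset itself is not safe, since the value is positive.\<close>
  have "p r \<noteq> A"
  proof
    assume "p r = A"
    then have "A \<in> safe \<beta> \<rho> x" using sl by (simp add: safe_def)
    then show False using game_value_le[of A \<beta> \<rho> x A] W by simp
  qed
  then have "game_value \<beta> \<rho> A x < dist A (p r)"
    using game_value_interior[OF _ sl] \<beta> by simp
  then show False using dA[OF r] by simp
qed

context bvr
begin

text \<open>Otherwise red freezes its headings towards the current target while blue keeps its law.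
  By \<open>red_step_gain\<close> the value rises at some instant, and \<open>value_lower\<close>
  applied from there makes the saddle payoff at least this larger value.\<close>

lemma blue_heads_to_target:
  assumes sp: "saddle_point G x \<gamma>\<^sub>B \<gamma>\<^sub>R" and pl: "play G \<gamma>\<^sub>B \<gamma>\<^sub>R x T X" and x: "x \<in> playing_states G"
    and t: "0 \<le> t" "ereal t < T" and val: "payoff G T X = ereal (val (X t))" "0 < val (X t)"
  shows "cis (\<gamma>\<^sub>B t (X t)) = sgn (target (X t) - blue (X t))"
proof (rule ccontr)
  assume ne: "\<not> ?thesis"
  have tr: "trajectory G \<gamma>\<^sub>B \<gamma>\<^sub>R 0 x T X" using pl by (simp add: play_def)
  define y where "y = X t"
  have y: "y \<in> playing_states G" unfolding y_def by (rule trajectory_playing[OF tr x t])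
  have q: "0 < dist (target y) (blue y)" by (rule target_ne_blue[OF y]) (use val y_def in simp)
  have \<gamma>: "\<gamma>\<^sub>B \<in> blue_strategies G" "\<gamma>\<^sub>R \<in> red_strategies G" using sp by (auto simp: saddle_point_def)
  obtain \<phi> where \<phi>: "\<phi> \<in> headings \<times> headings"
    "\<And>\<gamma>\<^sub>B t s Y r. trajectory G \<gamma>\<^sub>B (\<lambda>_ _. \<phi>) t y (ereal s) Y \<Longrightarrow> t \<le> r \<Longrightarrow> r \<le> s \<Longrightarrow>
       Y r = red_step \<beta> (target y) y (r - t) (blue (Y r)) \<and> dist (blue y) (blue (Y r)) \<le> r - t"
    using red_toward_target[OF y] by blast
  obtain s Y where s: "t < s" and tY: "trajectory G \<gamma>\<^sub>B (\<lambda>_ _. \<phi>) t y (ereal s) Y"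
    using blue_strategyD(2)[OF \<gamma>(1) t(1) y \<phi>(1)] by blast
  have Yt: "Y t = y" using tY by (simp add: trajectory_def)
  have "\<exists>r. t < r \<and> r < s \<and> val y < val (red_step \<beta> (target y) y (r - t) (blue (Y r)))"
  proof (rule red_step_gain[OF \<beta> \<rho> playing_blue_in_safe[OF y] _ refl q _ _ s])
    show "0 < val y" using val y_def by simp
    show "((\<lambda>r. (blue (Y r) - blue y) /\<^sub>R (r - t)) \<longlongrightarrow> cis (\<gamma>\<^sub>B t y)) (at_right t)"
      using right_difference_quotient[OF trajectory_deriv(1)[OF tY order_refl]] s Yt by simp
    have "\<not> 1 \<le> inner (sgn (target y - blue y)) (cis (\<gamma>\<^sub>B t y))"
      using eq_if_inner_ge_1[of "sgn (target y - blue y)" "cis (\<gamma>\<^sub>B t y)"] q ne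
      by (auto simp: norm_sgn y_def)
    then show "inner (sgn (target y - blue y)) (cis (\<gamma>\<^sub>B t y)) < 1" by simp
    fix r assume r: "t < r" "r < s"
    then have Yr: "Y r = red_step \<beta> (target y) y (r - t) (blue (Y r))" "dist (blue y) (blue (Y r)) \<le> r - t"
      using \<phi>(2)[OF tY, of r] by auto
    have "Y r \<in> playing_states G" by (rule trajectory_playing[OF tY y]) (use r in auto)
    then show "dist (blue y) (blue (Y r)) \<le> r - t \<and>
        blue (Y r) \<in> safe \<beta> \<rho> (red_step \<beta> (target y) y (r - t) (blue (Y r)))"
      using Yr playing_blue_in_safe by metis
  qed
  then obtain r where r: "t < r" "r < s" "val y < val (Y r)"
    using \<phi>(2)[OF tY] by (metis less_imp_le)
  have "trajectory G \<gamma>\<^sub>B \<gamma>\<^sub>R 0 x (ereal t) X" by (rule trajectory_restrict[OF tr]) (use t in auto)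
  moreover have "trajectory G \<gamma>\<^sub>B (\<lambda>_ _. \<phi>) t (X t) (ereal r) Y"
    using trajectory_restrict[OF tY] r by (simp add: y_def)
  ultimately have "trajectory G \<gamma>\<^sub>B (switch t \<gamma>\<^sub>R (\<lambda>_ _. \<phi>)) 0 x (ereal r) (switch t X Y)"
    using trajectory_append[of \<gamma>\<^sub>B \<gamma>\<^sub>R 0 x t X \<gamma>\<^sub>B "\<lambda>_ _. \<phi>" "ereal r" Y] by simp
  moreover have "switch t X Y r = Y r" using r by (simp add: switch_def)
  moreover have "Y r \<in> playing_states G" by (rule trajectory_playing[OF tY y]) (use r in auto)
  moreover have "switch t \<gamma>\<^sub>R (\<lambda>_ _. \<phi>) \<in> red_strategies G"
    using switch_red_strategy[OF \<gamma>(2) right_locally_constant_const \<phi>(1)] .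
  ultimately have "ereal (val (Y r)) \<le> payoff G T X"
    using value_lower[OF sp pl, of "switch t \<gamma>\<^sub>R (\<lambda>_ _. \<phi>)" r "switch t X Y"] r val unfolding y_def by auto
  then show False using val r(3) by (simp add: y_def)
qed

text \<open>A play witnessing red's win ends at distance greater than \<open>\<sigma>\<close>,
  whereas \<open>value_upper\<close> bounds that distance by \<open>max \<sigma> (val x)\<close>.
  The maximum in \<open>value_upper\<close> therefore becomes harmless.\<close>

lemma red_winning_value:
  assumes "x \<in> red_winning G"
  shows "\<sigma> < val x"
proof -
  obtain \<gamma>\<^sub>B \<gamma>\<^sub>R where x: "x \<in> playing_states G" and sp: "saddle_point G x \<gamma>\<^sub>B \<gamma>\<^sub>R"
    and win: "\<And>T X. play G \<gamma>\<^sub>B \<gamma>\<^sub>R x T X \<Longrightarrow> T \<noteq> \<infinity> \<and> X (real_of_ereal T) \<in> blocked G - asset_reached G"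
    using assms unfolding red_winning_def by blast
  obtain T X where pl: "play G \<gamma>\<^sub>B \<gamma>\<^sub>R x T X" using sp unfolding saddle_point_def by blast
  have tr: "trajectory G \<gamma>\<^sub>B \<gamma>\<^sub>R 0 x T X" using pl by (simp add: play_def)
  then have "ereal 0 \<le> T" by (simp add: trajectory_def)
  then obtain \<tau> where \<tau>: "T = ereal \<tau>" using win[OF pl] by (cases T) auto
  have X\<tau>: "X \<tau> \<in> blocked G - asset_reached G" using win[OF pl] \<tau> by simp
  have "\<tau> \<noteq> 0"
  proof
    assume "\<tau> = 0"
    then have "x \<in> terminal G" using X\<tau> tr by (simp add: trajectory_def terminal_def)
    then show False using playing_not_terminal[OF x] by simp
  qed
  then have pos: "0 < \<tau>" using \<open>ereal 0 \<le> T\<close> \<tau> by simp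
  have "\<sigma> \<le> dist (blue (X \<tau>)) A"
    by (rule playing_limit(1)[OF trajectory_continuous[OF tr, of \<tau> 0] pos])
      (use trajectory_playing[OF tr x] \<tau> in auto)
  moreover have "dist (blue (X \<tau>)) A \<noteq> \<sigma>" using X\<tau> by (simp add: asset_reached_def G)
  moreover have "payoff G T X \<le> ereal (max \<sigma> (val (X 0)))"
    by (rule value_upper[OF sp pl x]) (use pos \<tau> in auto)
  ultimately show ?thesis using tr \<tau> by (auto simp: payoff_def G trajectory_def max_def split: if_splits)
qed

end

section \<open>Optimal plays with simultaneous blocking\<close>

context bvr
begin

lemma blue_progress_deriv:
  assumes "q \<noteq> B" "p \<noteq> B"
  shows "1 - inner (sgn (q - B)) (sgn (p - B)) \<le> (dist q p)\<^sup>2 / (2 * dist q B * dist p B)"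
  using inner_sgn_ge[of "q - B" "p - B"] assms by (simp add: dist_norm)

text \<open>If blue always runs towards the current target \<open>p t\<close> while the value stays constant, then the
  delay \<open>E t\<close> of blue on its way to the initial target \<open>q\<close> controls \<open>|q - p t|\<^sup>2\<close>, which in turn controls
  the derivative of \<open>E\<close>. Gronwall's argument then gives \<open>E = 0\<close>.\<close>

lemma no_delay:
  assumes tr: "trajectory G \<gamma>\<^sub>B \<gamma>\<^sub>R 0 x (ereal T) X" and x: "x \<in> playing_states G"
    and \<tau>: "0 \<le> \<tau>" "\<tau> < T" "\<tau> < dist (target x) (blue x)"
    and head: "\<And>t. 0 \<le> t \<Longrightarrow> t < T \<Longrightarrow> cis (\<gamma>\<^sub>B t (X t)) = sgn (target (X t) - blue (X t))"
    and const: "\<And>t. 0 \<le> t \<Longrightarrow> t < T \<Longrightarrow> val (X t) = val x" and pos: "0 < val x"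
  shows "dist (target x) (blue (X \<tau>)) \<le> dist (target x) (blue x) - \<tau>"
proof -
  define q where "q = target x"
  define E where "E t = dist q (blue (X t)) - dist q (blue x) + t" for t
  have X0: "X 0 = x" using tr by (simp add: trajectory_def)
  have playing: "X t \<in> playing_states G" if "0 \<le> t" "t < T" for t
    using trajectory_playing[OF tr x] that by simp
  have lip: "dist (blue x) (blue (X t)) \<le> t" "dist (red1 x) (red1 (X t)) \<le> \<beta> * t" "dist (red2 x) (red2 (X t)) \<le> \<beta> * t"
    if "0 \<le> t" "t < T" for t
    using trajectory_lipschitz[OF tr order_refl that(1)] that X0 by auto
  have E0: "0 \<le> E t" "E t \<le> 2 * \<tau>" if "0 \<le> t" "t \<le> \<tau>" for t
    using lip(1)[of t] dist_triangle[of q "blue x" "blue (X t)"] dist_triangle[of q "blue (X t)" "blue x"] that \<tau>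
    by (auto simp: E_def dist_commute)
  have cX: "continuous_on {0..\<tau>} X" by (rule trajectory_continuous[OF tr]) (use \<tau> in auto)

  \<comment> \<open>Compactness of \<open>[0, \<tau>]\<close> gives one positive bound
    \<open>c\<close> for the distance between blue and its current target; \<open>a\<close> plays
    the same role for \<open>q\<close>. Both enter the denominator of \<open>K\<close>.\<close>
  define D where "D t = min (dist (blue (X t)) (red1 (X t))) (dist (blue (X t)) (red2 (X t))) - \<rho>" for t
  have "continuous_on {0..\<tau>} D" unfolding D_def using cX by (intro continuous_intros)
  then obtain t' where t': "0 \<le> t'" "t' \<le> \<tau>" "\<And>t. 0 \<le> t \<Longrightarrow> t \<le> \<tau> \<Longrightarrow> D t' \<le> D t"
    using continuous_attains_inf[of "{0..\<tau>}" D] \<tau>(1) by auto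
  have Dpos: "0 < D t'" using playing[of t'] t' \<tau> by (auto simp: D_def playing_iff)
  define c where "c = D t' / (1 + \<beta>)"
  have c: "0 < c" using Dpos \<beta> by (simp add: c_def)
  have target_far: "c \<le> dist (target (X t)) (blue (X t))" if "0 \<le> t" "t \<le> \<tau>" for t
  proof -
    have "D t \<le> (1 + \<beta>) * dist (target (X t)) (blue (X t))"
      unfolding D_def
      by (rule aim_dist_lower) (use playing[of t] const[of t] that \<tau> \<beta> pos in \<open>auto simp: playing_iff\<close>)
    then have "D t' \<le> (1 + \<beta>) * dist (target (X t)) (blue (X t))" using t'(3)[OF that] by linarith
    then show ?thesis using \<beta> by (simp add: c_def pos_divide_le_eq mult.commute)
  qed
  define a where "a = dist q (blue x) - \<tau>"
  have a: "0 < a" using \<tau> by (simp add: a_def q_def)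
  have q_far: "a \<le> dist q (blue (X t))" if "0 \<le> t" "t \<le> \<tau>" for t
    using lip(1)[of t] dist_triangle[of q "blue x" "blue (X t)"] that \<tau> by (simp add: a_def dist_commute)

  \<comment> \<open>At time \<open>t\<close> the point \<open>q\<close> violates the current
    constraints by at most \<open>\<beta> * E t\<close>, which is repaired within
    \<open>k * E t\<close>. Projection stability then gives \<open>M\<close>, with one factor
    \<open>E t\<close> replaced by \<open>2 * \<tau>\<close>.\<close>
  define k where "k = \<beta> / (\<beta> - 1)"
  have k: "0 < k" using \<beta> by (simp add: k_def)
  define M where "M = 8 * k\<^sup>2 * \<tau> + 4 * k * val x"
  have M: "0 \<le> M" using k \<tau> pos by (simp add: M_def)
  have near: "(dist q (target (X t)))\<^sup>2 \<le> M * E t" if t: "0 \<le> t" "t \<le> \<tau>" for t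
  proof -
    have tT: "t < T" using t \<tau> by simp
    have q: "q \<in> safe \<beta> \<rho> x" unfolding q_def by (rule aim_in_safe[OF playing_blue_in_safe[OF x]])
    have e: "0 \<le> E t" by (rule E0(1)[OF t])
    have "dist q (red1 x) \<le> dist q (red1 (X t)) + \<beta> * t" "dist q (red2 x) \<le> dist q (red2 (X t)) + \<beta> * t"
      using lip(2,3)[OF t(1) tT] dist_triangle[of q "red1 x" "red1 (X t)"] dist_triangle[of q "red2 x" "red2 (X t)"]
      by (auto simp: dist_commute)
    then have "- (\<beta> * E t) \<le> slack \<beta> \<rho> (blue (X t)) (red1 (X t)) q" "- (\<beta> * E t) \<le> slack \<beta> \<rho> (blue (X t)) (red2 (X t)) q"
      using q by (auto simp: safe_def slack_def E_def algebra_simps)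
    moreover have "0 \<le> \<beta> * E t" using e \<beta> by simp
    moreover have "blue (X t) \<in> safe \<beta> \<rho> (X t)" by (rule playing_blue_in_safe[OF playing[OF t(1) tT]])
    ultimately obtain p where p: "p \<in> safe \<beta> \<rho> (X t)" "dist q p \<le> k * E t"
      using safe_near[OF \<beta>] by (metis k_def times_divide_eq_left)
    have "dist A q = val x" by (simp add: q_def game_value_def)
    then have "dist A p \<le> val x + k * E t" using dist_triangle[of A p q] p(2) by simp
    then have "(dist A p)\<^sup>2 \<le> (val x + k * E t)\<^sup>2" by (intro power_mono) auto
    then have "(dist p (target (X t)))\<^sup>2 \<le> 2 * val x * (k * E t) + (k * E t)\<^sup>2"
      using dist_aim_le[OF \<beta> \<rho> p(1), of A] const[OF t(1) tT] by (simp add: power2_sum)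
    moreover have "(dist q p)\<^sup>2 \<le> (k * E t)\<^sup>2" using p(2) by (intro power_mono) auto
    moreover have "(dist q (target (X t)))\<^sup>2 \<le> (dist q p + dist p (target (X t)))\<^sup>2"
      by (intro power_mono dist_triangle) auto
    moreover have "(dist q p + dist p (target (X t)))\<^sup>2 \<le> 2 * (dist q p)\<^sup>2 + 2 * (dist p (target (X t)))\<^sup>2"
      using sum_squares_bound[of "dist q p" "dist p (target (X t))"] by (simp add: power2_sum)
    moreover have "(k * E t)\<^sup>2 \<le> k\<^sup>2 * (2 * \<tau>) * E t"
    proof -
      have "k\<^sup>2 * (E t * E t) \<le> k\<^sup>2 * (2 * \<tau> * E t)"
        using E0(2)[OF t] e by (intro mult_left_mono mult_right_mono) auto
      then show ?thesis by (simp add: power_mult_distrib power2_eq_square mult_ac)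
    qed
    moreover have "M * E t = 4 * (k\<^sup>2 * (2 * \<tau>) * E t) + 2 * (2 * val x * (k * E t))"
      by (simp add: M_def algebra_simps)
    ultimately show ?thesis by linarith
  qed

  \<comment> \<open>\<open>E\<close> grows at the rate one minus the cosine between the directions
    to \<open>q\<close> and to the current target, hence at most at the rate \<open>K * E t\<close>.
    The exponential is the integrating factor.\<close>
  define K where "K = M / (2 * a * c)"
  define \<phi> where "\<phi> t = exp (- K * t) * E t" for t
  have "\<phi> \<tau> \<le> \<phi> 0"
  proof (rule nonincreasing_if_right_deriv_nonpos[OF \<tau>(1)])
    show "continuous_on {0..\<tau>} \<phi>"
      unfolding \<phi>_def E_def using cX by (intro continuous_intros)
    fix t assume t: "0 \<le> t" "t < \<tau>"
    let ?B = "blue (X t)" and ?p = "target (X t)"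
    have tT: "t < T" using t \<tau> by simp
    have far: "a \<le> dist q ?B" "c \<le> dist ?p ?B" using q_far[of t] target_far[of t] t by auto
    have ne: "q \<noteq> ?B" "?p \<noteq> ?B" using far a c by auto
    define e where "e = 1 - inner (sgn (q - ?B)) (sgn (?p - ?B))"
    have "((\<lambda>t. dist q (blue (X t))) has_real_derivative - inner (sgn (q - ?B)) (cis (\<gamma>\<^sub>B t (X t)))) (at_right t)"
      by (rule dist_right_deriv[OF trajectory_deriv(1)[OF tr t(1)]]) (use ne tT in auto)
    then have dE: "(E has_real_derivative e) (at_right t)"
      unfolding E_def e_def head[OF t(1) tT] by (auto intro!: derivative_eq_intros)
    have "e \<le> (dist q ?p)\<^sup>2 / (2 * dist q ?B * dist ?p ?B)"
      unfolding e_def by (rule blue_progress_deriv[OF ne])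
    also have "\<dots> \<le> (dist q ?p)\<^sup>2 / (2 * a * c)"
      using far a c by (intro divide_left_mono mult_mono) (auto intro!: mult_pos_pos)
    also have "\<dots> \<le> M * E t / (2 * a * c)"
      using near[of t] t a c by (intro divide_right_mono) auto
    finally have e: "e \<le> K * E t" by (simp add: K_def)
    have "(\<phi> has_real_derivative exp (- K * t) * (e - K * E t)) (at_right t)"
      unfolding \<phi>_def using dE by (auto intro!: derivative_eq_intros simp: algebra_simps)
    moreover have "exp (- K * t) * (e - K * E t) \<le> 0" using e by (simp add: mult_le_0_iff)
    ultimately show "\<exists>D\<le>0. (\<phi> has_real_derivative D) (at_right t)" by blast
  qed
  also have "\<phi> 0 = 0" by (simp add: \<phi>_def E_def X0)
  finally have "E \<tau> \<le> 0" by (simp add: \<phi>_def mult_le_0_iff)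
  then show ?thesis by (simp add: E_def q_def)
qed

text \<open>Approaching \<open>q\<close> at the full rate \<open>\<beta>\<close> immediately after
  time 0 forces the forward velocity to point at \<open>q\<close>, by the equality case of
  Cauchy-Schwarz.\<close>

lemma straight_run_heading:
  fixes f :: "real \<Rightarrow> complex"
  assumes d: "(f has_vector_derivative \<beta> *\<^sub>R cis \<theta>) (at_right 0)" and "0 < T"
    and le: "\<And>t. 0 < t \<Longrightarrow> t < T \<Longrightarrow> dist q (f t) \<le> dist q (f 0) - \<beta> * t" and "f 0 \<noteq> q"
  shows "cis \<theta> = sgn (q - f 0)"
proof -
  have D: "((\<lambda>t. dist q (f t) + \<beta> * t) has_real_derivative - inner (sgn (q - f 0)) (\<beta> *\<^sub>R cis \<theta>) + \<beta>) (at_right 0)"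
    using dist_right_deriv[OF d assms(4)] by (auto intro!: derivative_eq_intros)
  have "\<not> 0 < - inner (sgn (q - f 0)) (\<beta> *\<^sub>R cis \<theta>) + \<beta>"
  proof
    assume "0 < - inner (sgn (q - f 0)) (\<beta> *\<^sub>R cis \<theta>) + \<beta>"
    from has_real_derivative_pos_inc_right[OF D this]
    obtain d where d: "0 < d" "\<And>h. 0 < h \<Longrightarrow> h < d \<Longrightarrow> dist q (f 0) < dist q (f h) + \<beta> * h" by auto
    define h where "h = min (d / 2) (T / 2)"
    have "0 < h" "h < d" "h < T" using d(1) \<open>0 < T\<close> by (auto simp: h_def min_def)
    then show False using d(2)[of h] le[of h] by simp
  qed
  then have "1 \<le> inner (sgn (q - f 0)) (cis \<theta>)" using \<beta> by (simp add: algebra_simps)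
  then show ?thesis
    using eq_if_inner_ge_1[of "sgn (q - f 0)" "cis \<theta>"] assms(4) by (simp add: norm_sgn)
qed

text \<open>With \<open>t1\<close> blue's travel time to \<open>q\<close>, safety gives
  \<open>\<rho> + \<beta> * t1 \<le> dist q R\<close>, and the blocking instant gives
  \<open>dist q R \<le> (t1 - T) + \<rho> + \<beta> * T\<close> for each interceptor. Together with
  \<open>T \<le> t1\<close> this forces \<open>t1 = T\<close> and equality throughout, which places
  \<open>q\<close> on both ovals and leaves red no detour.\<close>

lemma simultaneous_blocking_headings:
  assumes win: "x \<in> red_winning G" and sp: "saddle_point G x \<gamma>\<^sub>B \<gamma>\<^sub>R"
    and pl: "play G \<gamma>\<^sub>B \<gamma>\<^sub>R x (ereal T) X"
    and block: "dist (blue (X T)) (red1 (X T)) = \<rho>" "dist (blue (X T)) (red2 (X T)) = \<rho>"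
  defines "q \<equiv> target x"
  shows "q \<noteq> blue x" "slack \<beta> \<rho> (blue x) (red1 x) q = 0" "slack \<beta> \<rho> (blue x) (red2 x) q = 0"
    "cis (\<gamma>\<^sub>B 0 x) = sgn (q - blue x)"
    "cis (fst (\<gamma>\<^sub>R 0 x)) = sgn (q - red1 x)" "cis (snd (\<gamma>\<^sub>R 0 x)) = sgn (q - red2 x)"
proof -
  have x: "x \<in> playing_states G" using win by (simp add: red_winning_def)
  have tr: "trajectory G \<gamma>\<^sub>B \<gamma>\<^sub>R 0 x (ereal T) X" using pl by (simp add: play_def)
  have X0: "X 0 = x" "0 \<le> T" using tr by (auto simp: trajectory_def)
  have \<gamma>\<^sub>R: "\<gamma>\<^sub>R \<in> red_strategies G" using sp by (simp add: saddle_point_def)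
  have "T \<noteq> 0" using block(1) X0 x by (auto simp: playing_iff)
  then have T: "0 < T" using X0 by simp
  have playing: "X t \<in> playing_states G" if "0 \<le> t" "t < T" for t
    using trajectory_playing[OF tr x that(1)] that by simp
  have vx: "\<sigma> < val x" by (rule red_winning_value[OF win])
  define v where "v = dist (blue (X T)) A"
  have pay: "payoff G (ereal T) X = ereal v" by (simp add: payoff_def G v_def)
  have lower: "val (X t) \<le> v" if "0 \<le> t" "t < T" "0 < val (X t)" for t
    using value_lower[OF sp pl \<gamma>\<^sub>R trajectory_restrict[OF tr, of "ereal t"] playing] that by (simp add: pay)
  have upper: "v \<le> max \<sigma> (val (X t))" if "0 \<le> t" "t < T" for t
  proof -
    have "payoff G (ereal T) X \<le> ereal (max \<sigma> (val (X t)))"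
      by (rule value_upper[OF sp pl x that(1)]) (use that in simp)
    then show ?thesis unfolding pay ereal_less_eq(3) .
  qed
  have "val x \<le> v" using lower[of 0] T X0 vx \<sigma> by simp
  then have v: "\<sigma> < v" using vx by simp
  \<comment> \<open>Since \<open>v > \<sigma>\<close>, the upper bound shows that the value is at
    least \<open>v\<close>, hence positive, and the lower bound then applies.\<close>
  have valX: "val (X t) = v" if "0 \<le> t" "t < T" for t
    using lower[OF that] upper[OF that] v \<sigma> by (auto simp: max_def split: if_splits)
  have valx: "val x = v" using valX[of 0] T X0 by simp
  have head: "cis (\<gamma>\<^sub>B t (X t)) = sgn (target (X t) - blue (X t))" if "0 \<le> t" "t < T" for t
    by (rule blue_heads_to_target[OF sp pl x that(1)]) (use that valX[OF that] v \<sigma> pay in auto)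
  show "cis (\<gamma>\<^sub>B 0 x) = sgn (q - blue x)" using head[of 0] T X0 by (simp add: q_def)
  define t1 where "t1 = dist q (blue x)"
  have t1: "0 < t1" unfolding t1_def q_def by (rule target_ne_blue[OF x]) (use vx \<sigma> in simp)
  then show "q \<noteq> blue x" by (auto simp: t1_def)
  have delay: "dist q (blue (X t)) \<le> t1 - t" if "0 \<le> t" "t < T" "t < t1" for t
    unfolding t1_def q_def
    by (rule no_delay[OF tr x that(1,2)]) (use that head valX valx v \<sigma> in \<open>auto simp: t1_def q_def\<close>)
  have delay': "dist q (blue (X s)) \<le> t1 - s" if "0 < s" "s \<le> T" "s \<le> t1" for s
  proof -
    have "dist q (blue (X s)) + s \<le> t1"
    proof (rule le_at_right_end[OF that(1)])
      show "continuous_on {0..s} (\<lambda>s. dist q (blue (X s)) + s)"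
        using trajectory_continuous[OF tr, of s 0] that by (intro continuous_intros) auto
      show "dist q (blue (X t)) + t \<le> t1" if "0 \<le> t" "t < s" for t
        using delay[of t] that \<open>s \<le> T\<close> \<open>s \<le> t1\<close> by simp
    qed
    then show ?thesis by simp
  qed
  have qs: "\<rho> + \<beta> * t1 \<le> dist q (red1 x)" "\<rho> + \<beta> * t1 \<le> dist q (red2 x)"
    using aim_in_safe[OF playing_blue_in_safe[OF x], of A] by (auto simp: safe_def slack_def q_def t1_def)
  \<comment> \<open>If blue were at \<open>q\<close> and the play still running, \<open>q\<close>
    would have positive slack in the current state, so the value would drop below
    \<open>dist A q = v\<close>.\<close>
  have "\<not> t1 < T"
  proof
    assume "t1 < T"
    then have B: "blue (X t1) = q" using delay'[of t1] t1 by simp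
    have pt: "X t1 \<in> playing_states G" using playing[of t1] t1 \<open>t1 < T\<close> by simp
    have "val (X t1) < dist A (blue (X t1))"
      by (rule game_value_interior) (use pt \<beta> \<sigma> in \<open>auto simp: slack_self playing_iff\<close>)
    moreover have "dist A q = v" using valx by (simp add: game_value_def q_def)
    ultimately show False using valX[of t1] t1 \<open>t1 < T\<close> B by simp
  qed
  then have qB: "dist q (blue (X T)) \<le> t1 - T" using delay'[of T] T by simp
  have L: "dist (red1 x) (red1 (X T)) \<le> \<beta> * T" "dist (red2 x) (red2 (X T)) \<le> \<beta> * T"
    using trajectory_lipschitz(2,3)[OF tr order_refl X0(2)] X0 by auto
  have "dist q (red1 x) \<le> dist q (blue (X T)) + \<rho> + \<beta> * T" "dist q (red2 x) \<le> dist q (blue (X T)) + \<rho> + \<beta> * T"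
    using dist_triangle[of q "red1 x" "red1 (X T)"] dist_triangle[of q "red1 (X T)" "blue (X T)"]
      dist_triangle[of q "red2 x" "red2 (X T)"] dist_triangle[of q "red2 (X T)" "blue (X T)"] L block
    by (auto simp: dist_commute)
  then have up: "dist q (red1 x) \<le> t1 - T + \<rho> + \<beta> * T" "dist q (red2 x) \<le> t1 - T + \<rho> + \<beta> * T"
    using qB by auto
  then have "(\<beta> - 1) * (t1 - T) \<le> 0" using qs by (simp add: algebra_simps)
  then have "t1 = T" using \<beta> \<open>\<not> t1 < T\<close> by (simp add: mult_le_0_iff)
  have d1: "dist q (red1 x) = \<rho> + \<beta> * T" and d2: "dist q (red2 x) = \<rho> + \<beta> * T"
    using up qs \<open>t1 = T\<close> by auto
  show "slack \<beta> \<rho> (blue x) (red1 x) q = 0" "slack \<beta> \<rho> (blue x) (red2 x) q = 0"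
    using d1 d2 \<open>t1 = T\<close> by (auto simp: slack_def t1_def)
  have qT: "blue (X T) = q" using qB \<open>t1 = T\<close> by simp
  \<comment> \<open>By time \<open>T\<close> each interceptor must be within \<open>\<rho>\<close>
    of \<open>q\<close>, and the speed bound tells how close it must be at every earlier
    time.\<close>
  have red: "dist q (red1 (X t)) \<le> dist q (red1 (X 0)) - \<beta> * t" "dist q (red2 (X t)) \<le> dist q (red2 (X 0)) - \<beta> * t"
    if "0 < t" "t < T" for t
  proof -
    have "dist (red1 (X t)) (red1 (X T)) \<le> \<beta> * (T - t)" "dist (red2 (X t)) (red2 (X T)) \<le> \<beta> * (T - t)"
      using trajectory_lipschitz(2,3)[OF tr, of t T] that by auto
    then show "dist q (red1 (X t)) \<le> dist q (red1 (X 0)) - \<beta> * t" "dist q (red2 (X t)) \<le> dist q (red2 (X 0)) - \<beta> * t"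
      using dist_triangle[of q "red1 (X t)" "red1 (X T)"] dist_triangle[of q "red2 (X t)" "red2 (X T)"]
        block d1 d2 X0(1) unfolding qT by (auto simp: dist_commute algebra_simps)
  qed
  have "0 < \<rho> + \<beta> * T" using \<rho> \<beta> T by (intro add_pos_pos mult_pos_pos) auto
  then have far: "red1 (X 0) \<noteq> q" "red2 (X 0) \<noteq> q"
    unfolding X0(1) using d1 d2 by (metis dist_self less_irrefl)+
  have dr: "((\<lambda>t. red1 (X t)) has_vector_derivative \<beta> *\<^sub>R cis (fst (\<gamma>\<^sub>R 0 (X 0)))) (at_right 0)"
    "((\<lambda>t. red2 (X t)) has_vector_derivative \<beta> *\<^sub>R cis (snd (\<gamma>\<^sub>R 0 (X 0)))) (at_right 0)"
    using trajectory_deriv(2,3)[OF tr order_refl] T by simp_all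
  show "cis (fst (\<gamma>\<^sub>R 0 x)) = sgn (q - red1 x)"
    using straight_run_heading[OF dr(1) T red(1) far(1)] X0(1) by simp
  show "cis (snd (\<gamma>\<^sub>R 0 x)) = sgn (q - red2 x)"
    using straight_run_heading[OF dr(2) T red(2) far(2)] X0(1) by simp
qed

end

section \<open>The relative frame\<close>

text \<open>Squaring twice removes \<open>sqrt P\<close> and then \<open>sqrt Q\<close>: the quartic
  is the expansion of \<open>(P - \<beta>^2 * Q - \<rho>^2)^2 - 4 * \<beta>^2 * \<rho>^2 *
  Q\<close>.\<close>

lemma quartic_if_oval:
  assumes "oval_fun \<beta> \<rho> x\<^sub>1 m n x = 0"
  shows "quartic \<beta> \<rho> x\<^sub>1 m n x = 0"
proof -
  define P Q where "P = (x - x\<^sub>1)\<^sup>2 + (m * x + n)\<^sup>2" and "Q = x\<^sup>2 + (m * x + n)\<^sup>2"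
  have "sqrt P = \<beta> * sqrt Q + \<rho>" using assms by (simp add: oval_fun_def P_def Q_def)
  then have "(sqrt P)\<^sup>2 = \<beta>\<^sup>2 * (sqrt Q)\<^sup>2 + \<rho>\<^sup>2 + 2 * \<beta> * \<rho> * sqrt Q"
    by (simp add: power2_eq_square algebra_simps)
  then have PQ: "P - \<beta>\<^sup>2 * Q - \<rho>\<^sup>2 = 2 * \<beta> * \<rho> * sqrt Q" by (simp add: P_def Q_def)
  have "(P - \<beta>\<^sup>2 * Q - \<rho>\<^sup>2)\<^sup>2 = 4 * \<beta>\<^sup>2 * \<rho>\<^sup>2 * Q"
    unfolding PQ by (simp add: power_mult_distrib Q_def)
  moreover have "quartic \<beta> \<rho> x\<^sub>1 m n x = (P - \<beta>\<^sup>2 * Q - \<rho>\<^sup>2)\<^sup>2 - 4 * \<beta>\<^sup>2 * \<rho>\<^sup>2 * Q"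
    unfolding quartic_def Let_def P_def Q_def by (simp add: field_simps) algebra
  ultimately show ?thesis by simp
qed

text \<open>The quadratic terms cancel; \<open>y\<^sub>2 \<noteq> 0\<close> allows solving the
  remaining linear equation for \<open>w\<close>.\<close>

lemma bisector_iff:
  assumes "y\<^sub>2 \<noteq> 0"
  shows "(u - x\<^sub>1)\<^sup>2 + w\<^sup>2 = (u - x\<^sub>2)\<^sup>2 + (w - y\<^sub>2)\<^sup>2 \<longleftrightarrow>
    w = bisector_slope x\<^sub>1 x\<^sub>2 y\<^sub>2 * u + bisector_intercept x\<^sub>1 x\<^sub>2 y\<^sub>2"
proof -
  have eq: "bisector_slope x\<^sub>1 x\<^sub>2 y\<^sub>2 * u + bisector_intercept x\<^sub>1 x\<^sub>2 y\<^sub>2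
      = (2 * (x\<^sub>1 - x\<^sub>2) * u - (x\<^sub>1\<^sup>2 - y\<^sub>2\<^sup>2 - x\<^sub>2\<^sup>2)) / (2 * y\<^sub>2)"
    using assms by (simp add: bisector_slope_def bisector_intercept_def field_simps)
  have "w = bisector_slope x\<^sub>1 x\<^sub>2 y\<^sub>2 * u + bisector_intercept x\<^sub>1 x\<^sub>2 y\<^sub>2 \<longleftrightarrow>
      w * (2 * y\<^sub>2) = 2 * (x\<^sub>1 - x\<^sub>2) * u - (x\<^sub>1\<^sup>2 - y\<^sub>2\<^sup>2 - x\<^sub>2\<^sup>2)"
    unfolding eq using assms by (simp add: eq_divide_eq)
  then show ?thesis by (simp add: power2_eq_square algebra_simps)
qed

text \<open>Written as one complex rigid motion, so that distances are preserved and a heading is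
  rotated by subtracting an angle; \<open>rel_x\<close> and \<open>rel_y\<close> are its
  coordinates.\<close>

definition rel_frame :: "state \<Rightarrow> complex \<Rightarrow> complex" where
  "rel_frame x p = (p - blue x) * cis (- polar_angle x (red1 x))"

lemma rel_frame_eq: "rel_frame x p = Complex (rel_x x p) (rel_y x p)"
proof -
  have "p - blue x = rcis (dist (blue x) p) (polar_angle x p)"
    by (simp add: polar_angle_def dist_norm norm_minus_commute rcis_cmod_Arg)
  then have "rel_frame x p = rcis (dist (blue x) p) (polar_angle x p - polar_angle x (red1 x))"
    by (simp add: rel_frame_def rcis_def cis_mult)
  then show ?thesis by (simp add: rel_x_def rel_y_def complex_eq_iff)
qed

lemma rel_frame_red1: "rel_frame x (red1 x) = of_real (dist (blue x) (red1 x))"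
  unfolding rel_frame_eq by (simp add: rel_x_def rel_y_def complex_eq_iff)

lemma rel_frame_blue: "rel_frame x (blue x) = 0"
  by (simp add: rel_frame_def)

lemma rel_frame_diff: "rel_frame x p - rel_frame x q = (p - q) * cis (- polar_angle x (red1 x))"
  by (simp add: rel_frame_def algebra_simps)

lemma dist_rel_frame: "dist (rel_frame x p) (rel_frame x q) = dist p q"
  unfolding dist_norm rel_frame_diff by (simp add: norm_mult)

lemma rel_frame_surj:
  obtains p where "rel_frame x p = z"
proof
  show "rel_frame x (blue x + z * cis (polar_angle x (red1 x))) = z"
    by (simp add: rel_frame_def mult.assoc cis_mult)
qed

lemma rel_frame_inj: "rel_frame x p = rel_frame x q \<longleftrightarrow> p = q"
  using dist_rel_frame[of x p q] by (metis dist_eq_0_iff)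

lemma dist_Complex: "dist (Complex a b) (Complex c d) = sqrt ((a - c)\<^sup>2 + (b - d)\<^sup>2)"
  by (simp add: dist_norm cmod_def)

lemma rel_heading:
  assumes "cis \<theta> = sgn (p - q)"
  shows "cis (\<theta> - polar_angle x (red1 x)) = (rel_frame x p - rel_frame x q) /\<^sub>R dist p q"
proof -
  have "cis (\<theta> - polar_angle x (red1 x)) = cis \<theta> * cis (- polar_angle x (red1 x))"
    by (simp add: cis_mult)
  then show ?thesis unfolding assms rel_frame_diff by (simp add: sgn_div_norm dist_norm)
qed

lemma rel_heading_components:
  assumes "cis \<theta> = sgn (p - q)" "rel_frame x p = Complex u w" "rel_frame x q = Complex a b"
  shows "cos (\<theta> - polar_angle x (red1 x)) = (u - a) / sqrt ((u - a)\<^sup>2 + (w - b)\<^sup>2)"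
    "sin (\<theta> - polar_angle x (red1 x)) = (w - b) / sqrt ((u - a)\<^sup>2 + (w - b)\<^sup>2)"
proof -
  have "dist p q = sqrt ((u - a)\<^sup>2 + (w - b)\<^sup>2)"
    using dist_rel_frame[of x p q] unfolding assms(2,3) dist_Complex by simp
  then have "cis (\<theta> - polar_angle x (red1 x))
      = (Complex u w - Complex a b) /\<^sub>R sqrt ((u - a)\<^sup>2 + (w - b)\<^sup>2)"
    using rel_heading[OF assms(1), of x] assms(2,3) by simp
  then show "cos (\<theta> - polar_angle x (red1 x)) = (u - a) / sqrt ((u - a)\<^sup>2 + (w - b)\<^sup>2)"
    "sin (\<theta> - polar_angle x (red1 x)) = (w - b) / sqrt ((u - a)\<^sup>2 + (w - b)\<^sup>2)"
    by (simp_all add: complex_eq_iff divide_inverse mult.commute)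
qed

text \<open>The second point may coincide with the first, as when the bisector touches the
  oval.\<close>

lemma at_most_two_points:
  fixes S :: "'a::linorder set"
  assumes "u \<in> S" and three: "\<And>a b c. a \<in> S \<Longrightarrow> b \<in> S \<Longrightarrow> c \<in> S \<Longrightarrow> a < b \<Longrightarrow> b < c \<Longrightarrow> False"
  shows "\<exists>v. S = {u, v}"
proof (cases "S = {u}")
  case True
  then show ?thesis by simp
next
  case False
  then obtain v where v: "v \<in> S" "v \<noteq> u" using assms(1) by blast
  have "w = u \<or> w = v" if "w \<in> S" for w
    using that v assms(1) three by (metis neqE)
  then have "S = {u, v}" using v assms(1) by auto
  then show ?thesis ..
qed

text \<open>\<open>arg_min_on\<close> is a choice among minimizers, so it is determined only once
  the minimizer is known to be unique.\<close>

lemma arg_min_on_unique: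
  assumes "u \<in> S" "\<And>v. v \<in> S \<Longrightarrow> v \<noteq> u \<Longrightarrow> f u < (f v :: 'b::linorder)"
  shows "arg_min_on f S = u"
  unfolding arg_min_on_def arg_min_def is_arg_min_def
proof (rule some_equality)
  show "u \<in> S \<and> \<not> (\<exists>y. y \<in> S \<and> f y < f u)" using assms by (metis less_asym less_irrefl)
  show "v = u" if "v \<in> S \<and> \<not> (\<exists>y. y \<in> S \<and> f y < f v)" for v using assms that by blast
qed

section \<open>Identification of the target among the oval points on the bisector\<close>

theorem theorem2:
  fixes \<beta> \<rho> \<rho>\<^sub>s :: real and R\<^sub>s :: complex and G :: bvr_game
    and x :: state and \<gamma>\<^sub>B :: blue_law and \<gamma>\<^sub>R :: red_law
    and t\<^sub>f :: real and X :: "real \<Rightarrow> state"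
    and \<theta>\<^sub>B \<theta>\<^sub>1 \<theta>\<^sub>2 x\<^sub>1 x\<^sub>2 y\<^sub>2 x\<^sub>s y\<^sub>s m n :: real
  assumes "\<beta> > 1" and "\<rho> > 0" and "\<rho>\<^sub>s > 0"
    and "G = \<lparr>beta = \<beta>, rho = \<rho>, rho_s = \<rho>\<^sub>s, asset = R\<^sub>s\<rparr>"
    and "x \<in> red_winning G"
    (* optimal strategies, and an optimal play with simultaneous blocking *)
    and "saddle_point G x \<gamma>\<^sub>B \<gamma>\<^sub>R"
    and "play G \<gamma>\<^sub>B \<gamma>\<^sub>R x (ereal t\<^sub>f) X"
    and "dist (blue (X t\<^sub>f)) (red1 (X t\<^sub>f)) = \<rho>"
    and "dist (blue (X t\<^sub>f)) (red2 (X t\<^sub>f)) = \<rho>"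
    (* the relative frame *)
    and "x\<^sub>1 = dist (blue x) (red1 x)"
    and "x\<^sub>2 = rel_x x (red2 x)" and "y\<^sub>2 = rel_y x (red2 x)"
    and "x\<^sub>s = rel_x x R\<^sub>s" and "y\<^sub>s = rel_y x R\<^sub>s"
    and "y\<^sub>2 \<noteq> 0"
    and "m = bisector_slope x\<^sub>1 x\<^sub>2 y\<^sub>2" and "n = bisector_intercept x\<^sub>1 x\<^sub>2 y\<^sub>2"
    (* the optimal headings in the state x, measured in the relative frame *)
    and "\<theta>\<^sub>B = \<gamma>\<^sub>B 0 x - polar_angle x (red1 x)"
    and "\<theta>\<^sub>1 = fst (\<gamma>\<^sub>R 0 x) - polar_angle x (red1 x)"
    and "\<theta>\<^sub>2 = snd (\<gamma>\<^sub>R 0 x) - polar_angle x (red1 x)"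
  shows "\<exists>xin\<^sub>1 xin\<^sub>2.
    {u. quartic \<beta> \<rho> x\<^sub>1 m n u = 0 \<and> oval_fun \<beta> \<rho> x\<^sub>1 m n u = 0} = {xin\<^sub>1, xin\<^sub>2} \<and>
    (let xs = arg_min_on (asset_dist x\<^sub>s y\<^sub>s m n) {xin\<^sub>1, xin\<^sub>2};
         ys = m * xs + n
     in cos \<theta>\<^sub>B = xs / sqrt (xs\<^sup>2 + ys\<^sup>2) \<and>
        sin \<theta>\<^sub>B = ys / sqrt (xs\<^sup>2 + ys\<^sup>2) \<and>
        cos \<theta>\<^sub>1 = (xs - x\<^sub>1) / sqrt ((xs - x\<^sub>1)\<^sup>2 + ys\<^sup>2) \<and>
        sin \<theta>\<^sub>1 = ys / sqrt ((xs - x\<^sub>1)\<^sup>2 + ys\<^sup>2) \<and>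
        cos \<theta>\<^sub>2 = (xs - x\<^sub>2) / sqrt ((xs - x\<^sub>2)\<^sup>2 + (ys - y\<^sub>2)\<^sup>2) \<and>
        sin \<theta>\<^sub>2 = (ys - y\<^sub>2) / sqrt ((xs - x\<^sub>2)\<^sup>2 + (ys - y\<^sub>2)\<^sup>2))"
proof -
  interpret bvr G \<beta> \<rho> \<rho>\<^sub>s R\<^sub>s by unfold_locales (use assms in auto)
  define q where "q = aim \<beta> \<rho> R\<^sub>s x"
  note opt = simultaneous_blocking_headings[OF assms(5-9), folded q_def]
  have x: "x \<in> playing_states G" using assms(5) by (simp add: red_winning_def)
  have R1: "rel_frame x (red1 x) = Complex x\<^sub>1 0"
    by (simp add: rel_frame_red1 assms(10) complex_eq_iff)
  have R2: "rel_frame x (red2 x) = Complex x\<^sub>2 y\<^sub>2" and Rs: "rel_frame x R\<^sub>s = Complex x\<^sub>s y\<^sub>s"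
    by (simp_all add: rel_frame_eq assms(11-14))
  have dists: "dist p (blue x) = sqrt (u\<^sup>2 + w\<^sup>2)" "dist p (red1 x) = sqrt ((u - x\<^sub>1)\<^sup>2 + w\<^sup>2)"
    "dist p (red2 x) = sqrt ((u - x\<^sub>2)\<^sup>2 + (w - y\<^sub>2)\<^sup>2)" "dist R\<^sub>s p = sqrt ((x\<^sub>s - u)\<^sup>2 + (y\<^sub>s - w)\<^sup>2)"
    if "rel_frame x p = Complex u w" for p u w
    using dist_rel_frame[of x p "blue x"] dist_rel_frame[of x p "red1 x"]
      dist_rel_frame[of x p "red2 x"] dist_rel_frame[of x "R\<^sub>s" p]
    unfolding R1 R2 Rs that rel_frame_blue zero_complex.code dist_Complex by simp_all

  \<comment> \<open>\<open>pt\<close> parametrizes the bisector by the relative abscissa. On it both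
    slacks coincide with \<open>oval_fun\<close>, so every root belongs to both ovals and is
    safe.\<close>
  define pt where "pt u = (SOME p. rel_frame x p = Complex u (m * u + n))" for u
  have pt: "rel_frame x (pt u) = Complex u (m * u + n)" for u
    unfolding pt_def by (rule someI_ex) (metis rel_frame_surj)
  have sl: "slack \<beta> \<rho> (blue x) (red1 x) (pt u) = oval_fun \<beta> \<rho> x\<^sub>1 m n u"
    "slack \<beta> \<rho> (blue x) (red2 x) (pt u) = oval_fun \<beta> \<rho> x\<^sub>1 m n u" for u
    using bisector_iff[OF assms(15), of u x\<^sub>1 "m * u + n" x\<^sub>2] assms(16,17)
    by (simp_all add: slack_def oval_fun_def dists[OF pt])
  have J: "asset_dist x\<^sub>s y\<^sub>s m n u = dist R\<^sub>s (pt u)" for u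
    by (simp add: asset_dist_def dists(4)[OF pt] algebra_simps)
  define S where "S = {u. oval_fun \<beta> \<rho> x\<^sub>1 m n u = 0}"
  have S: "{u. quartic \<beta> \<rho> x\<^sub>1 m n u = 0 \<and> oval_fun \<beta> \<rho> x\<^sub>1 m n u = 0} = S"
    using quartic_if_oval by (auto simp: S_def)
  define u where "u = Re (rel_frame x q)"
  have "dist q (red1 x) = dist q (red2 x)" using opt(2,3) by (simp add: slack_def)
  then have q: "rel_frame x q = Complex u (m * u + n)"
    using bisector_iff[OF assms(15), of u x\<^sub>1 "Im (rel_frame x q)" x\<^sub>2] assms(16,17)
      dists(2,3)[of q u "Im (rel_frame x q)"] by (simp add: u_def complex_eq_iff)
  then have ptu: "pt u = q" using pt rel_frame_inj by metis
  then have uS: "u \<in> S" using sl(1)[of u] opt(2) by (simp add: S_def)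
  \<comment> \<open>Of three collinear oval points, the middle one would have positive slack by
    strict convexity.\<close>
  have three: False if "a \<in> S" "b \<in> S" "c \<in> S" "a < b" "b < c" for a b c
  proof -
    define t where "t = (b - a) / (c - a)"
    have t: "0 < t" "t < 1" using that by (auto simp: t_def)
    have "t * (c - a) = b - a" using that by (simp add: t_def)
    then have b: "b = (1 - t) * a + t * c" by (simp add: algebra_simps)
    have "rel_frame x ((1 - t) *\<^sub>R pt a + t *\<^sub>R pt c) = (1 - t) *\<^sub>R rel_frame x (pt a) + t *\<^sub>R rel_frame x (pt c)"
      by (simp add: rel_frame_def algebra_simps scaleR_conv_of_real)
    also have "\<dots> = rel_frame x (pt b)" unfolding pt by (simp add: complex_eq_iff b algebra_simps)
    finally have "(1 - t) *\<^sub>R pt a + t *\<^sub>R pt c = pt b" by (simp add: rel_frame_inj)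
    moreover have "pt a \<noteq> pt c" using pt[of a] pt[of c] that by auto
    ultimately have "0 < slack \<beta> \<rho> (blue x) (red1 x) (pt b)"
      using slack_convex_combination[OF assms(1,2), of "blue x" "red1 x" "pt a" "pt c" t] t that sl
      by (simp add: S_def)
    then show False using that sl by (simp add: S_def)
  qed
  have "\<exists>v. S = {u, v}" by (rule at_most_two_points[OF uS]) (rule three)
  then obtain v where v: "S = {u, v}" ..
  \<comment> \<open>Another root would be a safe point different from \<open>q\<close>, hence
    strictly farther from the asset by \<open>dist_aim_le\<close>.\<close>
  have "arg_min_on (asset_dist x\<^sub>s y\<^sub>s m n) {u, v} = u"
  proof (rule arg_min_on_unique)
    fix w assume "w \<in> {u, v}" "w \<noteq> u"
    then have w: "pt w \<in> safe \<beta> \<rho> x" "pt w \<noteq> q"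
      using v sl pt[of w] q by (auto simp: S_def safe_def)
    have "0 < (dist (pt w) q)\<^sup>2" using w(2) by simp
    also have "\<dots> \<le> (dist R\<^sub>s (pt w))\<^sup>2 - (dist R\<^sub>s q)\<^sup>2"
      using dist_aim_le[OF assms(1,2) w(1), of R\<^sub>s] by (simp add: q_def game_value_def)
    finally show "asset_dist x\<^sub>s y\<^sub>s m n u < asset_dist x\<^sub>s y\<^sub>s m n w"
      unfolding J ptu by (intro power2_less_imp_less[of "dist R\<^sub>s q" "dist R\<^sub>s (pt w)"]) auto
  qed simp
  moreover have "cos \<theta>\<^sub>B = u / sqrt (u\<^sup>2 + (m * u + n)\<^sup>2)" "sin \<theta>\<^sub>B = (m * u + n) / sqrt (u\<^sup>2 + (m * u + n)\<^sup>2)"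
    using rel_heading_components[OF opt(4) q, of 0 0] unfolding assms(18)
    by (simp_all add: rel_frame_blue complex_eq_iff)
  moreover have "cos \<theta>\<^sub>1 = (u - x\<^sub>1) / sqrt ((u - x\<^sub>1)\<^sup>2 + (m * u + n)\<^sup>2)"
    "sin \<theta>\<^sub>1 = (m * u + n) / sqrt ((u - x\<^sub>1)\<^sup>2 + (m * u + n)\<^sup>2)"
    using rel_heading_components[OF opt(5) q R1] unfolding assms(19) by simp_all
  moreover have "cos \<theta>\<^sub>2 = (u - x\<^sub>2) / sqrt ((u - x\<^sub>2)\<^sup>2 + (m * u + n - y\<^sub>2)\<^sup>2)"
    "sin \<theta>\<^sub>2 = (m * u + n - y\<^sub>2) / sqrt ((u - x\<^sub>2)\<^sup>2 + (m * u + n - y\<^sub>2)\<^sup>2)"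
    using rel_heading_components[OF opt(6) q R2] unfolding assms(20) by simp_all
  ultimately show ?thesis
    unfolding S by (intro exI[of _ u] exI[of _ v]) (simp add: v Let_def)
qed

end
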